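(* Let $d$ be the degree sequence of a simple graph. The following are equivalent: (a) $\mathscr{G}(d)$ is bipartite; (b) $\mathscr{G}(d)$ is triangle-free; (c) $\mathscr{G}(d)$ is (isomorphic to) a Cartesian product of transposition graphs and at most one copy of $K_{6,6}-6K_2$; (d) $d$ is the degree sequence of a graph that is both pseudo-split and matrogenic.
   Context: All graphs are finite and simple. For a degree sequence $d=(d_1,\dots,d_n)$, a realization of $d$ is a graph with vertex set $\{1,\dots,n\}$ in which vertex $i$ has degree $d_i$ (realizations are distinguished by edge sets). A 2-switch replaces edges $ab,cd$ by $ad,bc$, where $a,b,c,d$ are distinct vertices, $ab,cd$ are edges and $ad,bc$ are non-edges. The realization graph $\mathscr{G}(d)$ has the realizations of $d$ as vertices, two being adjacent iff one is obtained from the other by a single 2-switch. The transposition graph $T_k$ ($k\ge1$) has as vertices the permutations of $\{1,\dots,k\}$, two permutations adjacent iff they differ by exactly one transposition (so $T_1\cong K_1$, $T_2\cong K_2$, $T_3\cong K_{3,3}$). $K_{6,6}-6K_2$ is $K_{6,6}$ with the edges of a perfect matching removed. A graph is pseudo-split if its vertex set can be partitioned into sets $V_1,V_2,V_3$ with $V_1$ independent, $V_2$ a clique, no edges between $V_1$ and $V_3$, every vertex of $V_2$ adjacent to every vertex of $V_3$, and either $V_3=\emptyset$ or $G[V_3]\cong C_5$ (equivalently, $G$ has no induced $2K_2$ or $C_4$). A graph $G$ is matrogenic if the vertex sets of its alternating 4-cycles form the circuits of a matroid on $V(G)$; equivalently (Földes–Hammer), $G$ contains no five vertices $v,a,b,c,e$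 such that $va,cb$ are edges... — more precisely, a graph is pseudo-split and matrogenic iff it has no induced subgraph isomorphic to $2K_2$, $C_4$, the chair (the tree obtained from the path $P_4$ by adding a pendant vertex adjacent to one of its two interior vertices), or the kite (the complement of the chair). *)

theory Defs
  imports "HOL-Library.Ramsey" "HOL-Combinatorics.Permutations"
begin

type_synonym 'a graph = "'a set \<times> 'a set set"

abbreviation verts :: "'a graph \<Rightarrow> 'a set" where
  "verts G \<equiv> fst G"

abbreviation edges :: "'a graph \<Rightarrow> 'a set set" where
  "edges G \<equiv> snd G"

definition simple_graph :: "'a graph \<Rightarrow> bool" where
  "simple_graph G \<longleftrightarrow> finite (verts G) \<and> edges G \<subseteq> [verts G]\<^bsup>2\<^esup>"

definition adj :: "'a graph \<Rightarrow> 'a \<Rightarrow> 'a \<Rightarrow> bool" where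
  "adj G u v \<longleftrightarrow> {u, v} \<in> edges G"

definition degree :: "'a graph \<Rightarrow> 'a \<Rightarrow> nat" where
  "degree G v = card {u \<in> verts G. adj G v u}"

definition induced_subgraph :: "'a graph \<Rightarrow> 'a set \<Rightarrow> 'a graph" where
  "induced_subgraph G W = (W, {e \<in> edges G. e \<subseteq> W})"

definition graph_iso :: "'a graph \<Rightarrow> 'b graph \<Rightarrow> bool" (infix \<open>\<simeq>\<^sub>g\<close> 50) where
  "G \<simeq>\<^sub>g H \<longleftrightarrow> (\<exists>f. bij_betw f (verts G) (verts H) \<and>
     (\<forall>u\<in>verts G. \<forall>v\<in>verts G. adj G u v \<longleftrightarrow> adj H (f u) (f v)))"

definition bipartite :: "'a graph \<Rightarrow> bool" where
  "bipartite G \<longleftrightarrow> (\<exists>A B. A \<union> B = verts G \<and> A \<inter> B = {} \<and>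
     indep A (edges G) \<and> indep B (edges G))"

definition triangle_free :: "'a graph \<Rightarrow> bool" where
  "triangle_free G \<longleftrightarrow> \<not> (\<exists>x\<in>verts G. \<exists>y\<in>verts G. \<exists>z\<in>verts G.
     adj G x y \<and> adj G y z \<and> adj G x z)"

definition cycle_graph :: "nat \<Rightarrow> nat graph" where
  "cycle_graph n = ({..<n}, {{i, Suc i mod n} | i. i < n})"

definition complete_bipartite :: "nat \<Rightarrow> nat \<Rightarrow> (nat + nat) graph" where
  "complete_bipartite m n =
     (Inl ` {1..m} \<union> Inr ` {1..n}, {{Inl i, Inr j} | i j. i \<in> {1..m} \<and> j \<in> {1..n}})"

definition K66_minus_6K2 :: "(nat + nat) graph" where
  "K66_minus_6K2 =
     (verts (complete_bipartite 6 6),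
      edges (complete_bipartite 6 6) - {{Inl i, Inr i} | i. i \<in> {1..6}})"

text \<open>Multiplying by the transposition on the left instead gives the same edges,
  since \<open>p \<circ> transpose i j = transpose (p i) (p j) \<circ> p\<close>.\<close>

definition transposition_graph :: "nat \<Rightarrow> (nat \<Rightarrow> nat) graph" where
  "transposition_graph k =
     ({p. p permutes {1..k}},
      {{p, p \<circ> transpose i j} | p i j.
         p permutes {1..k} \<and> i \<in> {1..k} \<and> j \<in> {1..k} \<and> i \<noteq> j})"

definition cartesian_product :: "'a graph \<Rightarrow> 'b graph \<Rightarrow> ('a \<times> 'b) graph" (infixr \<open>\<box>\<^sub>g\<close> 70) where
  "G \<box>\<^sub>g H =
     (verts G \<times> verts H,
      {{(u, v), (u', v')} | u v u' v'.
         u \<in> verts G \<and> u' \<in> verts G \<and> v \<in> verts H \<and> v' \<in> verts H \<and>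
         (u = u' \<and> adj H v v' \<or> v = v' \<and> adj G u u')})"

text \<open>The Cartesian product of a finite family of graphs; the empty product is a single vertex.\<close>

definition cartesian_product_list :: "'a graph list \<Rightarrow> 'a list graph" where
  "cartesian_product_list Gs =
     (let V = {xs. length xs = length Gs \<and> (\<forall>i<length Gs. xs ! i \<in> verts (Gs ! i))}
      in (V, {{xs, ys} | xs ys. xs \<in> V \<and> ys \<in> V \<and>
            (\<exists>i<length Gs. adj (Gs ! i) (xs ! i) (ys ! i) \<and>
               (\<forall>j<length Gs. j \<noteq> i \<longrightarrow> xs ! j = ys ! j))}))"

definition pseudo_split :: "'a graph \<Rightarrow> bool" where
  "pseudo_split G \<longleftrightarrow> (\<exists>V1 V2 V3.
     V1 \<union> V2 \<union> V3 = verts G \<and>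
     V1 \<inter> V2 = {} \<and> V1 \<inter> V3 = {} \<and> V2 \<inter> V3 = {} \<and>
     indep V1 (edges G) \<and> clique V2 (edges G) \<and>
     (\<forall>u\<in>V1. \<forall>v\<in>V3. \<not> adj G u v) \<and>
     (\<forall>u\<in>V2. \<forall>v\<in>V3. adj G u v) \<and>
     (V3 = {} \<or> induced_subgraph G V3 \<simeq>\<^sub>g cycle_graph 5))"

definition matroid_circuits :: "'a set \<Rightarrow> 'a set set \<Rightarrow> bool" where
  "matroid_circuits E \<C> \<longleftrightarrow> finite E \<and> \<C> \<subseteq> Pow E \<and> {} \<notin> \<C> \<and>
     (\<forall>C\<in>\<C>. \<forall>D\<in>\<C>. C \<subseteq> D \<longrightarrow> C = D) \<and>
     (\<forall>C\<in>\<C>. \<forall>D\<in>\<C>. \<forall>x\<in>C \<inter> D. C \<noteq> D \<longrightarrow> (\<exists>F\<in>\<C>. F \<subseteq> C \<union> D - {x}))"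

definition alternating_4_cycle :: "'a graph \<Rightarrow> 'a \<Rightarrow> 'a \<Rightarrow> 'a \<Rightarrow> 'a \<Rightarrow> bool" where
  "alternating_4_cycle G a b c d \<longleftrightarrow>
     {a, b, c, d} \<subseteq> verts G \<and> distinct [a, b, c, d] \<and>
     adj G a b \<and> \<not> adj G b c \<and> adj G c d \<and> \<not> adj G d a"

definition matrogenic :: "'a graph \<Rightarrow> bool" where
  "matrogenic G \<longleftrightarrow>
     matroid_circuits (verts G) {{a, b, c, d} | a b c d. alternating_4_cycle G a b c d}"

text \<open>The degree of vertex \<open>i\<close> is \<open>d ! (i - 1)\<close>, as vertices are numbered from 1
  and lists from 0.\<close>

definition realization :: "nat list \<Rightarrow> nat graph \<Rightarrow> bool" where
  "realization d G \<longleftrightarrow> simple_graph G \<and> verts G = {1..length d} \<and>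
     (\<forall>i\<in>{1..length d}. degree G i = d ! (i - 1))"

definition two_switch :: "'a graph \<Rightarrow> 'a graph \<Rightarrow> bool" where
  "two_switch G H \<longleftrightarrow> (\<exists>a b c d.
     {a, b, c, d} \<subseteq> verts G \<and> distinct [a, b, c, d] \<and>
     adj G a b \<and> adj G c d \<and> \<not> adj G a d \<and> \<not> adj G b c \<and>
     H = (verts G, edges G - {{a, b}, {c, d}} \<union> {{a, d}, {b, c}}))"

definition realization_graph :: "nat list \<Rightarrow> nat graph graph" where
  "realization_graph d =
     ({G. realization d G},
      {{G, H} | G H. realization d G \<and> realization d H \<and> two_switch G H})"

end

theory Submission
  imports Defs
begin

text \<open>
  Call a graph uniform if, for every alternating 4-cycle \<open>a b c d\<close>, exactly one of the pairs
  \<open>{a, c}\<close> and \<open>{b, d}\<close> is an edge and every further vertex is adjacent to both or to neither of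
  \<open>a\<close> and \<open>c\<close>. A failure of either condition produces three realizations that pairwise differ
  by a 2-switch, and pseudo-split matrogenic graphs are uniform; hence it remains to decompose the
  realization graph of a uniform graph.

  In a uniform graph the degree classes of \<open>a\<close> and \<open>b\<close> for an alternating 4-cycle \<open>a b c d\<close> form a
  block: either both are one and the same 5-cycle (this happens for at most one class), or they are
  disjoint and joined by a perfect matching or the complement of one. Distinct blocks share no vertex.
  If \<open>ab\<close> is an edge of \<open>G\<close> missing in another realization and \<open>bc\<close> is an edge gained by it, then
  the degree of \<open>a\<close> is at least that of \<open>c\<close>, and double counting turns this into an equality. So all
  realizations agree outside the blocks, and they are obtained by choosing independently a perfect
  matching in each bipartite block and a 5-cycle in the exceptional one. Two realizations are joined by
  a 2-switch iff exactly two edges of the one are missing in the other, which turns the independent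
  choices into a Cartesian product; matchings yield transposition graphs, and the twelve 5-cycles on
  five points yield the graph \<open>K\<^sub>6\<^sub>,\<^sub>6\<close> minus a perfect matching.
\<close>

section \<open>Isomorphisms, products and bipartiteness\<close>

text \<open>The hinge is uniformity, a property of a single realization: triangle-freeness forces it
  on every realization, pseudo-split and matrogenic together imply it and follow from it, and it
  suffices for the decomposition, whose factors are all bipartite. Its first half says that an
  alternating 4-cycle induces a path on four vertices, never a 4-cycle or two disjoint edges. Its
  second half gives \<open>a\<close> and \<open>c\<close> the same neighbours outside the cycle,
  hence the same degree; this ties switches to degree classes, which all realizations share. The
  obstacle is that a distant realization is reached only through graphs not known to be uniform.
  Edge sets are therefore compared directly: degrees being equal, every vertex loses as many edges
  as it gains. One lost edge alone is impossible and two always form a 2-switch, so adjacency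
  becomes a statement about cardinalities of differences, which add up over vertex-disjoint blocks.
  Twelve is 5!/10. A 5-cycle and its complement are disjoint, which accounts for the matching absent
  from \<open>K66_minus_6K2\<close>.\<close>

lemma adj_commute: "adj G u v \<longleftrightarrow> adj G v u"
  by (simp add: adj_def insert_commute)

lemma graph_isoI:
  assumes "bij_betw f (verts G) (verts H)"
    and "\<And>u v. u \<in> verts G \<Longrightarrow> v \<in> verts G \<Longrightarrow> adj G u v \<longleftrightarrow> adj H (f u) (f v)"
  shows "G \<simeq>\<^sub>g H"
  using assms unfolding graph_iso_def by blast

lemma graph_iso_sym:
  assumes "G \<simeq>\<^sub>g H"
  shows "H \<simeq>\<^sub>g G"
proof -
  obtain f where f: "bij_betw f (verts G) (verts H)"
    and a: "\<forall>u\<in>verts G. \<forall>v\<in>verts G. adj G u v \<longleftrightarrow> adj H (f u) (f v)"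
    using assms unfolding graph_iso_def by blast
  let ?g = "inv_into (verts G) f"
  have g: "?g u \<in> verts G" "f (?g u) = u" if "u \<in> verts H" for u
    using that f by (simp_all add: bij_betw_def inv_into_into f_inv_into_f)
  show ?thesis
    by (rule graph_isoI[of ?g]) (use f a g in \<open>auto simp: bij_betw_inv_into\<close>)
qed

lemma graph_iso_trans [trans]:
  assumes "G \<simeq>\<^sub>g H" "H \<simeq>\<^sub>g K"
  shows "G \<simeq>\<^sub>g K"
proof -
  obtain f where f: "bij_betw f (verts G) (verts H)"
    "\<forall>u\<in>verts G. \<forall>v\<in>verts G. adj G u v \<longleftrightarrow> adj H (f u) (f v)"
    using assms unfolding graph_iso_def by blast
  obtain g where g: "bij_betw g (verts H) (verts K)"
    "\<forall>u\<in>verts H. \<forall>v\<in>verts H. adj H u v \<longleftrightarrow> adj K (g u) (g v)"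
    using assms unfolding graph_iso_def by blast
  show ?thesis
    by (rule graph_isoI[of "g \<circ> f"])
      (use f g bij_betw_trans[OF f(1) g(1)] in \<open>auto dest: bij_betwE\<close>)
qed

lemma verts_cartesian_product [simp]: "verts (G \<box>\<^sub>g H) = verts G \<times> verts H"
  by (simp add: cartesian_product_def)

lemma adj_cartesian_product:
  "adj (G \<box>\<^sub>g H) (u, v) (u', v') \<longleftrightarrow>
     u \<in> verts G \<and> u' \<in> verts G \<and> v \<in> verts H \<and> v' \<in> verts H \<and>
     (u = u' \<and> adj H v v' \<or> v = v' \<and> adj G u u')"
  (is "?L \<longleftrightarrow> ?R u v u' v'")
proof -
  have E: "adj (G \<box>\<^sub>g H) p q \<longleftrightarrow> {p, q} \<in> {{(x, y), (x', y')} | x y x' y'. ?R x y x' y'}" for p q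
    unfolding adj_def[of "G \<box>\<^sub>g H"] by (simp only: cartesian_product_def snd_conv)
  \<comment> \<open>Edges are unordered pairs, so a pair may match the description in the reverse
    order; the condition has to be symmetric.\<close>
  have R: "?R x y x' y'" if "?R x' y' x y" for x y x' y'
    using that adj_commute[of G x x'] adj_commute[of H y y'] by metis
  show ?thesis
  proof
    assume ?L
    then have "{(u, v), (u', v')} \<in> {{(x, y), (x', y')} | x y x' y'. ?R x y x' y'}"
      unfolding E .
    then obtain x y x' y' where e: "{(u, v), (u', v')} = {(x, y), (x', y')}" and r: "?R x y x' y'"
      by (elim CollectE exE conjE[of "_ = _"]) blast
    from e consider "u = x" "v = y" "u' = x'" "v' = y'" | "u = x'" "v = y'" "u' = x" "v' = y"
      unfolding doubleton_eq_iff prod.inject by blast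
    then show "?R u v u' v'"
    proof cases
      case 1
      then show ?thesis using r by simp
    next
      case 2
      show ?thesis unfolding 2 using r by (rule R)
    qed
  next
    assume "?R u v u' v'"
    then have "{(u, v), (u', v')} \<in> {{(x, y), (x', y')} | x y x' y'. ?R x y x' y'}"
      by blast
    then show ?L
      unfolding E .
  qed
qed

lemma cartesian_product_cong:
  assumes "G \<simeq>\<^sub>g G'" "H \<simeq>\<^sub>g H'"
  shows "G \<box>\<^sub>g H \<simeq>\<^sub>g G' \<box>\<^sub>g H'"
proof -
  obtain f where f: "bij_betw f (verts G) (verts G')"
    "\<forall>u\<in>verts G. \<forall>v\<in>verts G. adj G u v \<longleftrightarrow> adj G' (f u) (f v)"
    using assms unfolding graph_iso_def by blast
  obtain g where g: "bij_betw g (verts H) (verts H')"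
    "\<forall>u\<in>verts H. \<forall>v\<in>verts H. adj H u v \<longleftrightarrow> adj H' (g u) (g v)"
    using assms unfolding graph_iso_def by blast
  have "bij_betw (map_prod f g) (verts G \<times> verts H) (verts G' \<times> verts H')"
    using f g by (intro bij_betw_map_prod)
  moreover have "adj (G \<box>\<^sub>g H) p q \<longleftrightarrow> adj (G' \<box>\<^sub>g H') (map_prod f g p) (map_prod f g q)"
    if pq: "p \<in> verts (G \<box>\<^sub>g H)" "q \<in> verts (G \<box>\<^sub>g H)" for p q
  proof -
    obtain u v u' v' where uv: "p = (u, v)" "q = (u', v')"
      "u \<in> verts G" "v \<in> verts H" "u' \<in> verts G" "v' \<in> verts H"
      using pq by auto
    have "f u \<in> verts G'" "f u' \<in> verts G'" "g v \<in> verts H'" "g v' \<in> verts H'"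
      using uv f(1) g(1) by (auto dest: bij_betwE)
    moreover have "f u = f u' \<longleftrightarrow> u = u'" "g v = g v' \<longleftrightarrow> v = v'"
      using uv f(1) g(1) by (auto simp: bij_betw_def inj_on_eq_iff)
    ultimately show ?thesis
      using uv f(2) g(2) by (simp add: adj_cartesian_product)
  qed
  ultimately show ?thesis
    by (intro graph_isoI[of "map_prod f g"]) simp_all
qed

lemma verts_cartesian_product_list:
  "verts (cartesian_product_list Gs) =
     {xs. length xs = length Gs \<and> (\<forall>i<length Gs. xs ! i \<in> verts (Gs ! i))}"
  by (simp add: cartesian_product_list_def Let_def)

lemma adj_cartesian_product_list:
  "adj (cartesian_product_list Gs) xs ys \<longleftrightarrow>
     xs \<in> verts (cartesian_product_list Gs) \<and> ys \<in> verts (cartesian_product_list Gs) \<and>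
     (\<exists>i<length Gs. adj (Gs ! i) (xs ! i) (ys ! i) \<and> (\<forall>j<length Gs. j \<noteq> i \<longrightarrow> xs ! j = ys ! j))"
  (is "?L \<longleftrightarrow> ?R xs ys")
proof -
  have "?L \<longleftrightarrow> (\<exists>xs' ys'. {xs, ys} = {xs', ys'} \<and> ?R xs' ys')"
    unfolding verts_cartesian_product_list adj_def
    by (auto simp: cartesian_product_list_def Let_def adj_def)
  also have "\<dots> \<longleftrightarrow> ?R xs ys \<or> ?R ys xs"
    by (auto simp: doubleton_eq_iff)
  also have "?R ys xs \<longleftrightarrow> ?R xs ys"
    by (metis adj_commute)
  finally show ?thesis by simp
qed

lemma cartesian_product_list_Cons:
  "G \<box>\<^sub>g cartesian_product_list Gs \<simeq>\<^sub>g cartesian_product_list (G # Gs)"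
proof (rule graph_isoI[of "\<lambda>(x, xs). x # xs"])
  have v: "x # xs \<in> verts (cartesian_product_list (G # Gs)) \<longleftrightarrow>
      x \<in> verts G \<and> xs \<in> verts (cartesian_product_list Gs)" for x xs
    by (auto simp: verts_cartesian_product_list nth_Cons split: nat.split)
  have c: "\<exists>x xs. zs = x # xs" if "zs \<in> verts (cartesian_product_list (G # Gs))" for zs
    using that by (auto simp: verts_cartesian_product_list length_Suc_conv)
  show "bij_betw (\<lambda>(x, xs). x # xs) (verts (G \<box>\<^sub>g cartesian_product_list Gs))
     (verts (cartesian_product_list (G # Gs)))"
    unfolding bij_betw_def
  proof
    show "inj_on (\<lambda>(x, xs). x # xs) (verts (G \<box>\<^sub>g cartesian_product_list Gs))"
      by (auto simp: inj_on_def)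
    show "(\<lambda>(x, xs). x # xs) ` verts (G \<box>\<^sub>g cartesian_product_list Gs) =
        verts (cartesian_product_list (G # Gs))"
    proof
      show "verts (cartesian_product_list (G # Gs)) \<subseteq>
          (\<lambda>(x, xs). x # xs) ` verts (G \<box>\<^sub>g cartesian_product_list Gs)"
        using c v by (fastforce simp: image_iff)
    qed (auto simp: v)
  qed
  fix p q assume "p \<in> verts (G \<box>\<^sub>g cartesian_product_list Gs)"
    "q \<in> verts (G \<box>\<^sub>g cartesian_product_list Gs)"
  then obtain x xs y ys where pq: "p = (x, xs)" "q = (y, ys)"
    "x \<in> verts G" "y \<in> verts G"
    "xs \<in> verts (cartesian_product_list Gs)" "ys \<in> verts (cartesian_product_list Gs)"
    by auto
  have l: "length xs = length Gs" "length ys = length Gs"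
    using pq by (auto simp: verts_cartesian_product_list)
  have eq: "xs = ys \<longleftrightarrow> (\<forall>j<length Gs. xs ! j = ys ! j)"
    using l by (auto simp: list_eq_iff_nth_eq)
  have "adj (cartesian_product_list (G # Gs)) (x # xs) (y # ys) \<longleftrightarrow>
    (\<exists>i<Suc (length Gs). adj ((G # Gs) ! i) ((x # xs) ! i) ((y # ys) ! i) \<and>
      (\<forall>j<Suc (length Gs). j \<noteq> i \<longrightarrow> (x # xs) ! j = (y # ys) ! j))"
    using pq by (simp add: adj_cartesian_product_list v)
  also have "\<dots> \<longleftrightarrow> adj G x y \<and> xs = ys \<or> x = y \<and> adj (cartesian_product_list Gs) xs ys"
    unfolding Ex_less_Suc2 All_less_Suc2 eq using pq
    by (auto simp: adj_cartesian_product_list)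
  finally show "adj (G \<box>\<^sub>g cartesian_product_list Gs) p q =
      adj (cartesian_product_list (G # Gs)) (case p of (x, xs) \<Rightarrow> x # xs) (case q of (x, xs) \<Rightarrow> x # xs)"
    using pq by (auto simp: adj_cartesian_product)
qed

text \<open>Colourings are easier to pull back and combine than partitions. The clause
  \<open>u \<noteq> v\<close> mirrors \<open>indep\<close>, which speaks only of distinct
  vertices.\<close>

lemma bipartite_iff_colouring:
  "bipartite G \<longleftrightarrow> (\<exists>c :: 'a \<Rightarrow> bool. \<forall>u\<in>verts G. \<forall>v\<in>verts G. u \<noteq> v \<longrightarrow> adj G u v \<longrightarrow> c u \<noteq> c v)"
  for G :: "'a graph"
proof
  assume "bipartite G"
  then obtain A B where AB: "A \<union> B = verts G" "A \<inter> B = {}" "indep A (edges G)" "indep B (edges G)"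
    unfolding bipartite_def by blast
  have "\<forall>u\<in>verts G. \<forall>v\<in>verts G. u \<noteq> v \<longrightarrow> adj G u v \<longrightarrow> (u \<in> A) \<noteq> (v \<in> A)"
  proof (intro ballI impI)
    fix u v assume uv: "u \<in> verts G" "v \<in> verts G" "u \<noteq> v" "adj G u v"
    then have "\<not> (u \<in> A \<and> v \<in> A)" "\<not> (u \<in> B \<and> v \<in> B)"
      using AB(3,4) by (auto simp: indep_def adj_def)
    moreover have "u \<in> A \<or> u \<in> B" "v \<in> A \<or> v \<in> B"
      using uv AB(1) by auto
    ultimately show "(u \<in> A) \<noteq> (v \<in> A)"
      by argo
  qed
  then show "\<exists>c :: 'a \<Rightarrow> bool. \<forall>u\<in>verts G. \<forall>v\<in>verts G. u \<noteq> v \<longrightarrow> adj G u v \<longrightarrow> c u \<noteq> c v"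
    by (rule exI[of _ "\<lambda>u. u \<in> A"])
next
  assume "\<exists>c :: 'a \<Rightarrow> bool. \<forall>u\<in>verts G. \<forall>v\<in>verts G. u \<noteq> v \<longrightarrow> adj G u v \<longrightarrow> c u \<noteq> c v"
  then obtain c :: "'a \<Rightarrow> bool"
    where "\<forall>u\<in>verts G. \<forall>v\<in>verts G. u \<noteq> v \<longrightarrow> adj G u v \<longrightarrow> c u \<noteq> c v" ..
  then show "bipartite G"
    unfolding bipartite_def
    by (intro exI[of _ "{v \<in> verts G. c v}"] exI[of _ "{v \<in> verts G. \<not> c v}"])
      (auto simp: indep_def adj_def)
qed

lemma bipartite_iso:
  assumes "G \<simeq>\<^sub>g H" "bipartite H"
  shows "bipartite G"
proof -
  obtain f where f: "bij_betw f (verts G) (verts H)"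
    "\<forall>u\<in>verts G. \<forall>v\<in>verts G. adj G u v \<longleftrightarrow> adj H (f u) (f v)"
    using assms unfolding graph_iso_def by blast
  obtain c :: "_ \<Rightarrow> bool"
    where c: "\<forall>u\<in>verts H. \<forall>v\<in>verts H. u \<noteq> v \<longrightarrow> adj H u v \<longrightarrow> c u \<noteq> c v"
    using assms unfolding bipartite_iff_colouring by (elim exE)
  have "\<forall>u\<in>verts G. \<forall>v\<in>verts G. u \<noteq> v \<longrightarrow> adj G u v \<longrightarrow> c (f u) \<noteq> c (f v)"
  proof (intro ballI impI)
    fix u v assume uv: "u \<in> verts G" "v \<in> verts G" "u \<noteq> v" "adj G u v"
    then have "f u \<in> verts H" "f v \<in> verts H" "f u \<noteq> f v" "adj H (f u) (f v)"
      using f by (auto simp: bij_betw_def inj_on_eq_iff)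
    then show "c (f u) \<noteq> c (f v)"
      using c by blast
  qed
  then show ?thesis
    unfolding bipartite_iff_colouring by (rule exI[of _ "\<lambda>u. c (f u)"])
qed

lemma bipartite_cartesian_product:
  assumes "bipartite G" "bipartite H"
  shows "bipartite (G \<box>\<^sub>g H)"
proof -
  obtain c :: "_ \<Rightarrow> bool"
    where c: "\<forall>u\<in>verts G. \<forall>v\<in>verts G. u \<noteq> v \<longrightarrow> adj G u v \<longrightarrow> c u \<noteq> c v"
    using assms unfolding bipartite_iff_colouring by (elim exE)
  obtain c' :: "_ \<Rightarrow> bool"
    where c': "\<forall>u\<in>verts H. \<forall>v\<in>verts H. u \<noteq> v \<longrightarrow> adj H u v \<longrightarrow> c' u \<noteq> c' v"
    using assms unfolding bipartite_iff_colouring by (elim exE)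
  \<comment> \<open>A step in the product changes the colour of exactly one coordinate, so it flips
    whether the two colours agree.\<close>
  show ?thesis
    unfolding bipartite_iff_colouring
    by (intro exI[of _ "\<lambda>(u, v). c u = c' v"]) (use c c' in \<open>auto simp: adj_cartesian_product\<close>)
qed

lemma bipartite_cartesian_product_list:
  "(\<And>G. G \<in> set Gs \<Longrightarrow> bipartite G) \<Longrightarrow> bipartite (cartesian_product_list Gs)"
proof (induction Gs)
  case Nil
  show ?case
    by (auto simp: bipartite_iff_colouring verts_cartesian_product_list)
next
  case (Cons G Gs)
  then have "bipartite (G \<box>\<^sub>g cartesian_product_list Gs)"
    by (intro bipartite_cartesian_product) auto
  then show ?case
    using bipartite_iso[OF graph_iso_sym[OF cartesian_product_list_Cons]] by blast
qed

lemma verts_transposition_graph [simp]: "verts (transposition_graph k) = {p. p permutes {1..k}}"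
  by (simp add: transposition_graph_def)

lemma adj_transposition_graph:
  "adj (transposition_graph k) p q \<longleftrightarrow>
     p permutes {1..k} \<and> (\<exists>i\<in>{1..k}. \<exists>j\<in>{1..k}. i \<noteq> j \<and> q = p \<circ> transpose i j)"
proof
  assume "adj (transposition_graph k) p q"
  then obtain r i j where r: "{p, q} = {r, r \<circ> transpose i j}" "r permutes {1..k}"
    "i \<in> {1..k}" "j \<in> {1..k}" "i \<noteq> j"
    unfolding adj_def transposition_graph_def by auto
  have "r = r \<circ> transpose i j \<circ> transpose i j"
    by (simp flip: o_assoc)
  moreover have "r \<circ> transpose i j permutes {1..k}"
    using r by (intro permutes_compose permutes_swap_id)
  ultimately show "p permutes {1..k} \<and> (\<exists>i\<in>{1..k}. \<exists>j\<in>{1..k}. i \<noteq> j \<and> q = p \<circ> transpose i j)"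
    using r unfolding doubleton_eq_iff by metis
next
  assume "p permutes {1..k} \<and> (\<exists>i\<in>{1..k}. \<exists>j\<in>{1..k}. i \<noteq> j \<and> q = p \<circ> transpose i j)"
  then show "adj (transposition_graph k) p q"
    unfolding adj_def transposition_graph_def snd_conv by blast
qed

text \<open>The colour is the sign of the permutation, which every transposition reverses.\<close>

lemma bipartite_transposition_graph: "bipartite (transposition_graph k)"
proof -
  have "evenperm p \<noteq> evenperm q" if a: "adj (transposition_graph k) p q" for p q
  proof -
    obtain i j where ij: "p permutes {1..k}" "i \<noteq> j" "q = p \<circ> transpose i j"
      using a unfolding adj_transposition_graph by blast
    have "permutation p"
      using ij(1) permutation_permutes by blast
    then show ?thesis
      using ij by (simp add: evenperm_comp permutation_swap_id evenperm_swap)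
  qed
  then show ?thesis
    unfolding bipartite_iff_colouring by (intro exI[of _ evenperm]) simp
qed

lemma verts_K66_minus_6K2 [simp]: "verts K66_minus_6K2 = Inl ` {1..6} \<union> Inr ` {1..6}"
  by (simp add: K66_minus_6K2_def complete_bipartite_def)

lemma adj_K66_minus_6K2:
  "adj K66_minus_6K2 (Inl i) (Inr j) \<longleftrightarrow> i \<in> {1..6} \<and> j \<in> {1..6} \<and> i \<noteq> j"
  "adj K66_minus_6K2 (Inr j) (Inl i) \<longleftrightarrow> i \<in> {1..6} \<and> j \<in> {1..6} \<and> i \<noteq> j"
  "\<not> adj K66_minus_6K2 (Inl i) (Inl j)"
  "\<not> adj K66_minus_6K2 (Inr i) (Inr j)"
  unfolding adj_def K66_minus_6K2_def complete_bipartite_def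
  by (auto simp: doubleton_eq_iff)

lemma bipartite_K66_minus_6K2: "bipartite K66_minus_6K2"
  unfolding bipartite_iff_colouring
  by (intro exI[of _ isl]) (auto simp: adj_K66_minus_6K2)

section \<open>Switch graphs of families of edge sets\<close>

text \<open>Realizations share their vertex set, so only edge sets matter. Counting edges rather
  than neighbours makes the degree additive over disjoint edge sets, as needed to restrict a degree
  condition to one block.\<close>

definition edeg :: "'a set set \<Rightarrow> 'a \<Rightarrow> nat" where
  "edeg A v = card {e \<in> A. v \<in> e}"

definition switch_graph :: "'a set set set \<Rightarrow> 'a set set graph" where
  "switch_graph P = (P, {{A, B} | A B. A \<in> P \<and> B \<in> P \<and> card (A - B) = 2 \<and> card (B - A) = 2})"

text \<open>\<open>U\<close> is the set of pairs that may be used as edges, and \<open>F\<close>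
  enters only through the degrees of \<open>F \<inter> U\<close>. With all pairs as \<open>U\<close>
  these are the realizations; with a block as \<open>U\<close>, the possible states of that
  block.\<close>

definition same_degrees :: "'a set set \<Rightarrow> 'a set set \<Rightarrow> 'a set set set" where
  "same_degrees U F = {A. A \<subseteq> U \<and> (\<forall>v. edeg A v = edeg (F \<inter> U) v)}"

lemma verts_switch_graph [simp]: "verts (switch_graph P) = P"
  by (simp add: switch_graph_def)

lemma adj_switch_graph:
  "adj (switch_graph P) A B \<longleftrightarrow> A \<in> P \<and> B \<in> P \<and> card (A - B) = 2 \<and> card (B - A) = 2"
proof -
  have "adj (switch_graph P) A B \<longleftrightarrow>
    (\<exists>A' B'. {A, B} = {A', B'} \<and> A' \<in> P \<and> B' \<in> P \<and> card (A' - B') = 2 \<and> card (B' - A') = 2)"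
    by (simp add: adj_def switch_graph_def)
  then show ?thesis
    unfolding doubleton_eq_iff by blast
qed

lemma edeg_Un_disjoint:
  assumes "finite A" "finite B" "A \<inter> B = {}"
  shows "edeg (A \<union> B) v = edeg A v + edeg B v"
proof -
  have "{e \<in> A \<union> B. v \<in> e} = {e \<in> A. v \<in> e} \<union> {e \<in> B. v \<in> e}"
    by blast
  then show ?thesis
    unfolding edeg_def using assms by (simp add: card_Un_disjoint disjoint_iff)
qed

lemma edeg_Int_Diff: "finite A \<Longrightarrow> edeg A v = edeg (A \<inter> B) v + edeg (A - B) v"
  using edeg_Un_disjoint[of "A \<inter> B" "A - B" v] by (simp add: Int_Diff_Un Int_Diff_disjoint)

lemma edeg_Diff_eq:
  assumes "finite A" "finite B" "\<forall>v. edeg A v = edeg B v"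
  shows "edeg (A - B) v = edeg (B - A) v"
  using edeg_Int_Diff[OF assms(1), of v B] edeg_Int_Diff[OF assms(2), of v A] assms(3)
  by (simp add: Int_commute)

lemma edeg_eq_0_iff: "finite A \<Longrightarrow> edeg A v = 0 \<longleftrightarrow> v \<notin> \<Union>A"
  by (auto simp: edeg_def)

lemma finite_edge_set: "finite V \<Longrightarrow> A \<subseteq> [V]\<^bsup>2\<^esup> \<Longrightarrow> finite A"
  using finite_imp_finite_nsets finite_subset by blast

lemma sum_edeg:
  assumes "finite V" "A \<subseteq> [V]\<^bsup>2\<^esup>"
  shows "(\<Sum>v\<in>V. edeg A v) = 2 * card A"
proof -
  have f: "finite A"
    using assms by (rule finite_edge_set)
  have "{v \<in> V. v \<in> e} = e" "card e = 2" if "e \<in> A" for e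
    using that assms by (auto simp: nsets_def)
  then show ?thesis
    unfolding edeg_def by (intro sum_multicount) (use assms f in auto)
qed

lemma edeg_eq_imp_card_eq:
  assumes "finite V" "A \<subseteq> [V]\<^bsup>2\<^esup>" "B \<subseteq> [V]\<^bsup>2\<^esup>" "\<forall>v. edeg A v = edeg B v"
  shows "card A = card B"
  using sum_edeg[OF assms(1,2)] sum_edeg[OF assms(1,3)] assms(4) by simp

lemma edeg_eq_imp_card_Diff_eq:
  assumes "finite V" "A \<subseteq> [V]\<^bsup>2\<^esup>" "B \<subseteq> [V]\<^bsup>2\<^esup>" "\<forall>v. edeg A v = edeg B v"
  shows "card (A - B) = card (B - A)"
proof -
  have "finite A" "finite B"
    using finite_edge_set[OF assms(1)] assms(2,3) by simp_all
  then have "\<forall>v. edeg (A - B) v = edeg (B - A) v"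
    using edeg_Diff_eq[OF _ _ assms(4)] by simp
  then show ?thesis
    using assms by (intro edeg_eq_imp_card_eq[of V]) auto
qed

text \<open>A single lost edge and a single gained edge would have the same ends and so be equal.
  This later rules out a difference of two made of one edge in each of two blocks.\<close>

lemma edeg_eq_imp_card_Diff_neq_1:
  assumes "finite V" "A \<subseteq> [V]\<^bsup>2\<^esup>" "B \<subseteq> [V]\<^bsup>2\<^esup>" "\<forall>v. edeg A v = edeg B v"
  shows "card (A - B) \<noteq> 1"
proof
  assume 1: "card (A - B) = 1"
  then have 2: "card (B - A) = 1"
    using edeg_eq_imp_card_Diff_eq[OF assms] by simp
  obtain e where e: "A - B = {e}"
    using 1 card_1_singletonE by blast
  obtain f where f: "B - A = {f}"
    using 2 card_1_singletonE by blast
  have fin: "finite A" "finite B"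
    using finite_edge_set[OF assms(1)] assms(2,3) by simp_all
  have "v \<in> e \<longleftrightarrow> v \<in> f" for v
    using edeg_Diff_eq[OF fin assms(4), of v] edeg_eq_0_iff[of "{e}" v] edeg_eq_0_iff[of "{f}" v]
    unfolding e f by simp
  then have "e = f" by blast
  then show False
    using e f by blast
qed

text \<open>Every vertex lies on as many lost edges as gained ones. Once the two lost edges are
  known to be disjoint, each of their four ends lies on exactly one gained edge, and the gained
  edges must cross between them.\<close>

lemma card_Diff_eq_2_imp_switch:
  assumes AB: "A \<subseteq> [V]\<^bsup>2\<^esup>" "B \<subseteq> [V]\<^bsup>2\<^esup>" "finite V" "\<forall>v. edeg A v = edeg B v" "card (A - B) = 2"
  obtains a b c d where "{a, b, c, d} \<subseteq> V" "distinct [a, b, c, d]"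
    "A - B = {{a, b}, {c, d}}" "B - A = {{a, d}, {b, c}}"
proof -
  have fin: "finite A" "finite B"
    using finite_edge_set[OF AB(3)] AB(1,2) by simp_all
  have D: "edeg (A - B) v = edeg (B - A) v" for v
    using edeg_Diff_eq[OF fin AB(4)] .
  have mem: "v \<in> \<Union>(A - B) \<longleftrightarrow> v \<in> \<Union>(B - A)" for v
    using D[of v] fin edeg_eq_0_iff[of "A - B" v] edeg_eq_0_iff[of "B - A" v] by (metis finite_Diff)
  have two: "\<exists>x y. e = {x, y} \<and> x \<noteq> y \<and> x \<in> V \<and> y \<in> V" if "e \<in> A \<or> e \<in> B" for e
    using that AB(1,2) by (auto elim!: nsets2_E dest!: subsetD)
  obtain e1 e2 where e: "A - B = {e1, e2}" "e1 \<noteq> e2"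
    using AB(5) by (auto simp: card_2_iff)
  have "card (B - A) = 2"
    using edeg_eq_imp_card_Diff_eq[OF AB(3,1,2,4)] AB(5) by simp
  then obtain f1 f2 where f: "B - A = {f1, f2}" "f1 \<noteq> f2"
    by (auto simp: card_2_iff)
  have ef: "e1 \<noteq> f1" "e1 \<noteq> f2" "e2 \<noteq> f1" "e2 \<noteq> f2"
    using e f by blast+
  \<comment> \<open>A common vertex \<open>x\<close> would lie on both gained edges. The other end
    of \<open>e1\<close> lies on a gained edge as well, and that edge would then be
    \<open>e1\<close> itself.\<close>
  have dis: "e1 \<inter> e2 = {}"
  proof (rule ccontr)
    assume "e1 \<inter> e2 \<noteq> {}"
    then obtain x where x: "x \<in> e1" "x \<in> e2" by blast
    have "{e \<in> {e1, e2}. x \<in> e} = {e1, e2}"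
      using x by blast
    then have "edeg (B - A) x = 2"
      using D[of x] e by (simp add: edeg_def)
    then have "card {e \<in> {f1, f2}. x \<in> e} = card {f1, f2}"
      using f by (simp add: edeg_def)
    then have "{e \<in> {f1, f2}. x \<in> e} = {f1, f2}"
      by (intro card_subset_eq) auto
    then have "x \<in> f1" "x \<in> f2"
      by blast+
    moreover obtain y where "e1 = {x, y}" "y \<noteq> x"
      using two[of e1] e x by (metis Diff_iff doubleton_eq_iff empty_iff insert_iff)
    moreover have "y \<in> f1 \<or> y \<in> f2"
      using mem[of y] \<open>e1 = {x, y}\<close> unfolding e f by simp
    moreover have "card f1 = 2" "card f2 = 2"
      using two f by (metis Diff_iff card_2_iff insertI1 insert_iff)+
    ultimately show False
      using ef by (metis card_2_iff doubleton_eq_iff insert_iff singletonD)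
  qed
  obtain a b where ab: "e1 = {a, b}" "a \<noteq> b" "a \<in> V" "b \<in> V"
    using two[of e1] e by blast
  have "\<exists>g1 g2. {f1, f2} = {g1, g2} \<and> a \<in> g1"
    using mem[of a] ab unfolding e f by blast
  then obtain g1 g2 where g: "{f1, f2} = {g1, g2}" "a \<in> g1"
    by blast
  have gn: "g1 \<noteq> e1" "g2 \<noteq> e1" "g1 \<noteq> e2" "g2 \<noteq> e2" "g1 \<noteq> g2"
    using g ef f(2) by (auto simp: doubleton_eq_iff)
  have B: "B - A = {g1, g2}"
    using f g by simp
  obtain d where d: "g1 = {a, d}" "d \<noteq> a"
    using two[of g1] B g(2) by (metis Diff_iff doubleton_eq_iff empty_iff insert_iff)
  have "d \<noteq> b"
    using d ab gn by auto
  then have "d \<in> e2"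
    using mem[of d] d ab unfolding e B by simp
  then obtain c where c: "e2 = {c, d}" "c \<noteq> d" "c \<in> V" "d \<in> V"
    using two[of e2] e by (metis Diff_iff doubleton_eq_iff empty_iff insert_iff)
  have neq: "distinct [a, b, c, d]"
    using dis ab c d by auto
  have "b \<in> g2"
    using mem[of b] ab neq d unfolding e B by auto
  moreover have "c \<in> g2"
    using mem[of c] c neq d unfolding e B by auto
  moreover have "card g2 = 2"
  proof -
    have "g2 \<in> B - A"
      unfolding B by simp
    then show ?thesis
      using two[of g2] by (auto simp: card_2_iff)
  qed
  ultimately have "{b, c} = g2"
    using neq by (intro card_subset_eq) (auto intro: card_ge_0_finite)
  then show ?thesis
    using e(1) B ab c d(1) neq by (intro that[of a b c d]) simp_all
qed

section \<open>Realizations as edge sets with prescribed degrees\<close>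

lemma two_switchD:
  assumes "two_switch G H"
  obtains a b c d where "{a, b, c, d} \<subseteq> verts G" "distinct [a, b, c, d]" "verts H = verts G"
    "edges G - edges H = {{a, b}, {c, d}}" "edges H - edges G = {{a, d}, {b, c}}"
proof -
  obtain a b c d where *: "{a, b, c, d} \<subseteq> verts G" "distinct [a, b, c, d]"
    "adj G a b" "adj G c d" "\<not> adj G a d" "\<not> adj G b c"
    "H = (verts G, edges G - {{a, b}, {c, d}} \<union> {{a, d}, {b, c}})"
    using assms unfolding two_switch_def by blast
  have "{a, b} \<noteq> {a, d}" "{a, b} \<noteq> {b, c}" "{c, d} \<noteq> {a, d}" "{c, d} \<noteq> {b, c}"
    using *(2) by (auto simp: doubleton_eq_iff)
  then have "edges G - edges H = {{a, b}, {c, d}}" "edges H - edges G = {{a, d}, {b, c}}"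
    using *(3-7) unfolding adj_def by auto
  then show ?thesis
    using *(1,2,7) by (intro that[of a b c d]) simp_all
qed

lemma two_switch_iff_card_Diff:
  assumes "simple_graph G" "simple_graph H" "verts G = verts H"
    "\<forall>v. edeg (edges G) v = edeg (edges H) v"
  shows "two_switch G H \<longleftrightarrow> card (edges G - edges H) = 2"
proof
  assume "two_switch G H"
  then obtain a b c d where "distinct [a, b, c, d]" "edges G - edges H = {{a, b}, {c, d}}"
    by (rule two_switchD)
  then show "card (edges G - edges H) = 2"
    by (auto simp: doubleton_eq_iff)
next
  assume 2: "card (edges G - edges H) = 2"
  have s: "edges G \<subseteq> [verts G]\<^bsup>2\<^esup>" "edges H \<subseteq> [verts G]\<^bsup>2\<^esup>" "finite (verts G)"
    using assms(1-3) unfolding simple_graph_def by simp_all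
  obtain a b c d where *: "{a, b, c, d} \<subseteq> verts G" "distinct [a, b, c, d]"
    "edges G - edges H = {{a, b}, {c, d}}" "edges H - edges G = {{a, d}, {b, c}}"
    by (rule card_Diff_eq_2_imp_switch[OF s assms(4) 2])
  have "edges H = edges G - (edges G - edges H) \<union> (edges H - edges G)"
    by blast
  then have "H = (verts G, edges G - {{a, b}, {c, d}} \<union> {{a, d}, {b, c}})"
    using * assms(3) by (simp add: prod_eq_iff)
  moreover have "adj G a b" "adj G c d" "\<not> adj G a d" "\<not> adj G b c"
    using *(3,4) unfolding adj_def by blast+
  ultimately show "two_switch G H"
    unfolding two_switch_def using *(1,2) by blast
qed

text \<open>The two removed edges and the two added ones each cover the four vertices exactly
  once.\<close>

lemma edeg_two_switch:
  assumes "simple_graph G" "two_switch G H"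
  shows "simple_graph H" "edeg (edges H) v = edeg (edges G) v"
proof -
  obtain a b c d where *: "{a, b, c, d} \<subseteq> verts G" "distinct [a, b, c, d]" "verts H = verts G"
    "edges G - edges H = {{a, b}, {c, d}}" "edges H - edges G = {{a, d}, {b, c}}"
    by (rule two_switchD[OF assms(2)])
  have "edges H - edges G \<subseteq> [verts G]\<^bsup>2\<^esup>"
    unfolding *(5) using * by simp
  then show H: "simple_graph H"
    using assms(1) unfolding simple_graph_def *(3) by blast
  have fin: "finite (edges G)" "finite (edges H)"
    using H assms(1) unfolding simple_graph_def by (auto intro: finite_edge_set)
  have "edeg {{x, y}, {z, w}} v = of_bool (v \<in> {x, y, z, w})" if "distinct [x, y, z, w]" for x y z w
  proof -
    have "{e \<in> {{x, y}, {z, w}}. v \<in> e} =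
      (if v \<in> {x, y} then {{x, y}} else if v \<in> {z, w} then {{z, w}} else {})"
      using that by auto
    then show ?thesis
      unfolding edeg_def by auto
  qed
  from this[of a b c d] this[of a d b c]
  have "edeg (edges G - edges H) v = edeg (edges H - edges G) v"
    unfolding *(4,5) using *(2) by auto
  then show "edeg (edges H) v = edeg (edges G) v"
    using edeg_Int_Diff[OF fin(1), of v "edges H"] edeg_Int_Diff[OF fin(2), of v "edges G"]
    by (simp add: Int_commute)
qed

lemma degree_eq_edeg:
  assumes "simple_graph G"
  shows "degree G v = edeg (edges G) v"
proof -
  have "{e \<in> edges G. v \<in> e} = (\<lambda>u. {v, u}) ` {u \<in> verts G. adj G v u}"
  proof (intro equalityI subsetI)
    fix e assume e: "e \<in> {e \<in> edges G. v \<in> e}"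
    then have "e \<in> [verts G]\<^bsup>2\<^esup>"
      using assms unfolding simple_graph_def by blast
    then obtain x y where "e = {x, y}" "x \<in> verts G" "y \<in> verts G"
      by (elim nsets2_E)
    with e show "e \<in> (\<lambda>u. {v, u}) ` {u \<in> verts G. adj G v u}"
      unfolding adj_def by (auto simp: insert_commute)
  qed (auto simp: adj_def)
  moreover have "inj_on (\<lambda>u. {v, u}) {u \<in> verts G. adj G v u}"
    by (auto simp: inj_on_def doubleton_eq_iff)
  ultimately show ?thesis
    unfolding degree_def edeg_def by (simp add: card_image)
qed

lemma realization_two_switch:
  assumes "realization d G" "two_switch G H"
  shows "realization d H"
proof -
  have G: "simple_graph G"
    using assms(1) unfolding realization_def by simp
  have "verts H = verts G"
    using assms(2) by (rule two_switchD)
  moreover have "degree H v = degree G v" for v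
    using edeg_two_switch[OF G assms(2)] G by (simp add: degree_eq_edeg)
  ultimately show ?thesis
    using edeg_two_switch(1)[OF G assms(2)] assms(1) unfolding realization_def by simp
qed

lemma realization_iff_same_degrees:
  assumes "realization d G"
  shows "realization d H \<longleftrightarrow>
    verts H = verts G \<and> edges H \<in> same_degrees ([verts G]\<^bsup>2\<^esup>) (edges G)"
proof -
  have G: "simple_graph G" "verts G = {1..length d}" "\<forall>i\<in>{1..length d}. degree G i = d ! (i - 1)"
    using assms unfolding realization_def by auto
  then have "edges G \<inter> [verts G]\<^bsup>2\<^esup> = edges G"
    unfolding simple_graph_def by blast
  then have sd: "A \<in> same_degrees ([verts G]\<^bsup>2\<^esup>) (edges G) \<longleftrightarrow>
      A \<subseteq> [verts G]\<^bsup>2\<^esup> \<and> (\<forall>v. edeg A v = edeg (edges G) v)" for A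
    unfolding same_degrees_def by simp
  \<comment> \<open>\<open>same_degrees\<close> constrains all elements of the type, a realization
    only its own vertices; elsewhere both degrees vanish.\<close>
  have z: "edeg A v = 0" if "A \<subseteq> [verts G]\<^bsup>2\<^esup>" "v \<notin> verts G" for A v
    using that unfolding edeg_def by (auto simp: nsets_def card_eq_0_iff)
  show ?thesis
  proof
    assume H: "realization d H"
    then have vH: "verts H = verts G" "simple_graph H" "\<forall>i\<in>verts G. degree H i = d ! (i - 1)"
      unfolding realization_def using G by auto
    then have "edges H \<subseteq> [verts G]\<^bsup>2\<^esup>"
      unfolding simple_graph_def by simp
    moreover have "edeg (edges H) v = edeg (edges G) v" for v
    proof (cases "v \<in> verts G")
      case True
      then show ?thesis
        using G vH by (simp flip: degree_eq_edeg)
    next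
      case False
      then show ?thesis
        using z[OF calculation] z[of "edges G"] G(1) unfolding simple_graph_def by simp
    qed
    ultimately show "verts H = verts G \<and> edges H \<in> same_degrees ([verts G]\<^bsup>2\<^esup>) (edges G)"
      using sd vH by blast
  next
    assume H: "verts H = verts G \<and> edges H \<in> same_degrees ([verts G]\<^bsup>2\<^esup>) (edges G)"
    then have "simple_graph H"
      using G(1) sd unfolding simple_graph_def by simp
    moreover from this have "degree H v = degree G v" for v
      using H sd G(1) by (simp add: degree_eq_edeg)
    ultimately show "realization d H"
      using H G unfolding realization_def by simp
  qed
qed

text \<open>An edge may stem from a switch in either direction. The cardinality criterion is
  symmetric, because equal degrees make the two differences equally large.\<close>

lemma adj_realization_graph:
  "adj (realization_graph d) G H \<longleftrightarrow> realization d G \<and> realization d H \<and> card (edges G - edges H) = 2"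
proof -
  have eq: "two_switch G H \<longleftrightarrow> card (edges G - edges H) = 2" "card (edges H - edges G) = card (edges G - edges H)"
    if "realization d G" "realization d H" for G H
  proof -
    have s: "simple_graph G" "simple_graph H" "verts H = verts G"
      using that unfolding realization_def by auto
    have "edges H \<in> same_degrees ([verts G]\<^bsup>2\<^esup>) (edges G)"
      using realization_iff_same_degrees[OF that(1)] that(2) by blast
    moreover have "edges G \<inter> [verts G]\<^bsup>2\<^esup> = edges G"
      using s unfolding simple_graph_def by blast
    ultimately have d: "\<forall>v. edeg (edges G) v = edeg (edges H) v"
      unfolding same_degrees_def by simp
    show "two_switch G H \<longleftrightarrow> card (edges G - edges H) = 2"
      using two_switch_iff_card_Diff[OF s(1,2) s(3)[symmetric] d] .
    show "card (edges H - edges G) = card (edges G - edges H)"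
      using edeg_eq_imp_card_Diff_eq[of "verts G" "edges G" "edges H"] s d
      unfolding simple_graph_def by simp
  qed
  have "adj (realization_graph d) G H \<longleftrightarrow>
     (\<exists>G' H'. {G, H} = {G', H'} \<and> realization d G' \<and> realization d H' \<and> two_switch G' H')"
    by (simp add: adj_def realization_graph_def)
  also have "\<dots> \<longleftrightarrow> (realization d G \<and> realization d H \<and> (two_switch G H \<or> two_switch H G))"
    unfolding doubleton_eq_iff by blast
  finally show ?thesis
    using eq by metis
qed

lemma verts_realization_graph [simp]: "verts (realization_graph d) = {G. realization d G}"
  by (simp add: realization_graph_def)

lemma realization_graph_iso_switch_graph:
  assumes "realization d G"
  shows "realization_graph d \<simeq>\<^sub>g switch_graph (same_degrees ([verts G]\<^bsup>2\<^esup>) (edges G))"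
proof (rule graph_isoI[of snd])
  note iff = realization_iff_same_degrees[OF assms]
  show "bij_betw snd (verts (realization_graph d))
      (verts (switch_graph (same_degrees ([verts G]\<^bsup>2\<^esup>) (edges G))))"
    by (rule bij_betw_byWitness[where f' = "\<lambda>A. (verts G, A)"])
      (auto simp: iff prod_eq_iff)
  fix H K assume HK: "H \<in> verts (realization_graph d)" "K \<in> verts (realization_graph d)"
  then show "adj (realization_graph d) H K \<longleftrightarrow>
     adj (switch_graph (same_degrees ([verts G]\<^bsup>2\<^esup>) (edges G))) (edges H) (edges K)"
    using adj_realization_graph[of d H K] adj_realization_graph[of d K H]
      adj_commute[of "realization_graph d" H K] iff
    unfolding adj_switch_graph by auto
qed

section \<open>Products, restrictions and complements of switch graphs\<close>

lemma same_degrees_finite_card: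
  assumes "finite V" "U \<subseteq> [V]\<^bsup>2\<^esup>" "A \<in> same_degrees U F" "B \<in> same_degrees U F"
  shows "finite A" "card (A - B) = card (B - A)" "card (A - B) \<noteq> 1" "card (A - B) = 0 \<longleftrightarrow> A = B"
proof -
  have AB: "A \<subseteq> [V]\<^bsup>2\<^esup>" "B \<subseteq> [V]\<^bsup>2\<^esup>" "\<forall>v. edeg A v = edeg B v"
    using assms(2-4) unfolding same_degrees_def by auto
  show fin: "finite A"
    using assms(1) AB(1) by (rule finite_edge_set)
  have fin': "finite B"
    using assms(1) AB(2) by (rule finite_edge_set)
  show eq: "card (A - B) = card (B - A)" and "card (A - B) \<noteq> 1"
    using edeg_eq_imp_card_Diff_eq[OF assms(1) AB] edeg_eq_imp_card_Diff_neq_1[OF assms(1) AB] .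
  show "card (A - B) = 0 \<longleftrightarrow> A = B"
  proof
    assume "card (A - B) = 0"
    then have "A - B = {}" "B - A = {}"
      using eq fin fin' by (metis card_0_eq finite_Diff)+
    then show "A = B" by blast
  qed simp
qed

text \<open>The hypothesis \<open>dis\<close> concerns vertices: no vertex meets pairs of both sets,
  so at each vertex one summand of the degree vanishes and the degree condition on the union splits
  into two independent ones.\<close>

lemma switch_graph_same_degrees_Un:
  assumes V: "finite V" and U: "U1 \<subseteq> [V]\<^bsup>2\<^esup>" "U2 \<subseteq> [V]\<^bsup>2\<^esup>" and dis: "\<Union>U1 \<inter> \<Union>U2 = {}"
  shows "switch_graph (same_degrees U1 F) \<box>\<^sub>g switch_graph (same_degrees U2 F) \<simeq>\<^sub>g
    switch_graph (same_degrees (U1 \<union> U2) F)"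
proof (rule graph_isoI[of "\<lambda>(A, B). A \<union> B"])
  have ne: "{} \<notin> U1" "{} \<notin> U2"
    using U by (auto simp: nsets_def)
  have dU: "U1 \<inter> U2 = {}"
  proof (rule equals0I)
    fix e assume "e \<in> U1 \<inter> U2"
    then have "e \<subseteq> \<Union>U1 \<inter> \<Union>U2" "e \<noteq> {}"
      using ne by auto
    then show False
      using dis by simp
  qed
  have fin: "finite U1" "finite U2"
    using U finite_edge_set[OF V] by auto
  have split: "edeg A v = edeg (A \<inter> U1) v + edeg (A \<inter> U2) v" if "A \<subseteq> U1 \<union> U2" for A v
  proof -
    have "A = (A \<inter> U1) \<union> (A \<inter> U2)"
      using that by blast
    then show ?thesis
      using edeg_Un_disjoint[of "A \<inter> U1" "A \<inter> U2" v] fin dU by auto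
  qed
  have z: "edeg (A \<inter> W) v = 0" if "v \<notin> \<Union>W" for A W v
    using that unfolding edeg_def by (auto simp: card_eq_0_iff)
  have 1: "A \<union> B \<in> same_degrees (U1 \<union> U2) F"
    if "A \<in> same_degrees U1 F" "B \<in> same_degrees U2 F" for A B
  proof -
    have AB: "A \<subseteq> U1" "B \<subseteq> U2" "\<And>v. edeg A v = edeg (F \<inter> U1) v" "\<And>v. edeg B v = edeg (F \<inter> U2) v"
      using that unfolding same_degrees_def by auto
    have i: "(A \<union> B) \<inter> U1 = A" "(A \<union> B) \<inter> U2 = B"
      using AB dU by auto
    have j: "F \<inter> (U1 \<union> U2) \<inter> U1 = F \<inter> U1" "F \<inter> (U1 \<union> U2) \<inter> U2 = F \<inter> U2"
      by auto
    have "edeg (A \<union> B) v = edeg (F \<inter> (U1 \<union> U2)) v" for v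
      using split[of "A \<union> B" v] split[of "F \<inter> (U1 \<union> U2)" v] AB i j by auto
    then show ?thesis
      using AB unfolding same_degrees_def by auto
  qed
  have 2: "C \<inter> U1 \<in> same_degrees U1 F" "C \<inter> U2 \<in> same_degrees U2 F"
    if "C \<in> same_degrees (U1 \<union> U2) F" for C
  proof -
    have C: "C \<subseteq> U1 \<union> U2" "\<And>v. edeg C v = edeg (F \<inter> (U1 \<union> U2)) v"
      using that unfolding same_degrees_def by auto
    have j: "F \<inter> (U1 \<union> U2) \<inter> U1 = F \<inter> U1" "F \<inter> (U1 \<union> U2) \<inter> U2 = F \<inter> U2"
      by auto
    have s: "edeg (C \<inter> U1) v + edeg (C \<inter> U2) v = edeg (F \<inter> U1) v + edeg (F \<inter> U2) v" for v
      using split[OF C(1), of v] split[of "F \<inter> (U1 \<union> U2)" v] C(2)[of v] j by simp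
    have "edeg (C \<inter> U1) v = edeg (F \<inter> U1) v \<and> edeg (C \<inter> U2) v = edeg (F \<inter> U2) v" for v
    proof (cases "v \<in> \<Union>U1")
      case True
      then have "v \<notin> \<Union>U2"
        using dis by blast
      then show ?thesis
        using s[of v] z[of v U2 C] z[of v U2 F] by linarith
    next
      case False
      then show ?thesis
        using s[of v] z[of v U1 C] z[of v U1 F] by linarith
    qed
    then show "C \<inter> U1 \<in> same_degrees U1 F" "C \<inter> U2 \<in> same_degrees U2 F"
      unfolding same_degrees_def by simp_all
  qed
  have sub: "A \<subseteq> U1" if "A \<in> same_degrees U1 F" for A
    using that unfolding same_degrees_def by simp
  have sub': "B \<subseteq> U2" if "B \<in> same_degrees U2 F" for B
    using that unfolding same_degrees_def by simp
  show "bij_betw (\<lambda>(A, B). A \<union> B)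
     (verts (switch_graph (same_degrees U1 F) \<box>\<^sub>g switch_graph (same_degrees U2 F)))
     (verts (switch_graph (same_degrees (U1 \<union> U2) F)))"
  proof (rule bij_betw_byWitness[where f' = "\<lambda>C. (C \<inter> U1, C \<inter> U2)"])
    show "\<forall>p\<in>verts (switch_graph (same_degrees U1 F) \<box>\<^sub>g switch_graph (same_degrees U2 F)).
        (\<lambda>C. (C \<inter> U1, C \<inter> U2)) (case p of (A, B) \<Rightarrow> A \<union> B) = p"
      using dU by (auto dest!: sub sub')
    show "\<forall>C\<in>verts (switch_graph (same_degrees (U1 \<union> U2) F)). (case (C \<inter> U1, C \<inter> U2) of (A, B) \<Rightarrow> A \<union> B) = C"
      by (auto simp: same_degrees_def)
    show "(\<lambda>(A, B). A \<union> B) ` verts (switch_graph (same_degrees U1 F) \<box>\<^sub>g switch_graph (same_degrees U2 F))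
        \<subseteq> verts (switch_graph (same_degrees (U1 \<union> U2) F))"
      using 1 by auto
    show "(\<lambda>C. (C \<inter> U1, C \<inter> U2)) ` verts (switch_graph (same_degrees (U1 \<union> U2) F))
        \<subseteq> verts (switch_graph (same_degrees U1 F) \<box>\<^sub>g switch_graph (same_degrees U2 F))"
      using 2 by auto
  qed
  fix p q
  assume "p \<in> verts (switch_graph (same_degrees U1 F) \<box>\<^sub>g switch_graph (same_degrees U2 F))"
    "q \<in> verts (switch_graph (same_degrees U1 F) \<box>\<^sub>g switch_graph (same_degrees U2 F))"
  then obtain A B A' B' where pq: "p = (A, B)" "q = (A', B')"
    and A: "A \<in> same_degrees U1 F" "A' \<in> same_degrees U1 F"
    and B: "B \<in> same_degrees U2 F" "B' \<in> same_degrees U2 F"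
    by auto
  have c: "card ((C \<union> D) - (C' \<union> D')) = card (C - C') + card (D - D')"
    if "C \<in> same_degrees U1 F" "C' \<in> same_degrees U1 F" "D \<in> same_degrees U2 F" "D' \<in> same_degrees U2 F"
    for C C' D D'
  proof -
    have "(C \<union> D) - (C' \<union> D') = (C - C') \<union> (D - D')" "(C - C') \<inter> (D - D') = {}"
      using sub[OF that(1)] sub[OF that(2)] sub'[OF that(3)] sub'[OF that(4)] dU by auto
    moreover have "finite C" "finite D"
      using sub[OF that(1)] sub'[OF that(3)] fin finite_subset by auto
    ultimately show ?thesis
      by (simp add: card_Un_disjoint)
  qed
  note eA = same_degrees_finite_card(2-4)[OF V U(1) A]
  note eB = same_degrees_finite_card(2-4)[OF V U(2) B]
  have "adj (switch_graph (same_degrees U1 F) \<box>\<^sub>g switch_graph (same_degrees U2 F)) p q \<longleftrightarrow>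
      A = A' \<and> card (B - B') = 2 \<or> B = B' \<and> card (A - A') = 2"
    unfolding pq adj_cartesian_product adj_switch_graph verts_switch_graph
    using A B eA(1) eB(1) by simp
  \<comment> \<open>Neither summand can be 1, so a total of 2 means that one of them is 2 and the
    other 0.\<close>
  also have "\<dots> \<longleftrightarrow> card (A - A') + card (B - B') = 2"
    using eA(2) eB(2) unfolding eA(3)[symmetric] eB(3)[symmetric] by arith
  also have "\<dots> \<longleftrightarrow> adj (switch_graph (same_degrees (U1 \<union> U2) F)) (A \<union> B) (A' \<union> B')"
    unfolding adj_switch_graph c[OF A B] c[OF A(2,1) B(2,1)]
    using 1[OF A(1) B(1)] 1[OF A(2) B(2)] eA(1) eB(1) by simp
  finally show "adj (switch_graph (same_degrees U1 F) \<box>\<^sub>g switch_graph (same_degrees U2 F)) p q \<longleftrightarrow>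
      adj (switch_graph (same_degrees (U1 \<union> U2) F)) (case p of (A, B) \<Rightarrow> A \<union> B) (case q of (A, B) \<Rightarrow> A \<union> B)"
    unfolding pq by simp
qed

text \<open>The pairs outside \<open>W\<close> are frozen: they contribute the same amount to every
  degree and nothing to any difference, so they can be removed or restored at will.\<close>

lemma switch_graph_same_degrees_restrict:
  assumes V: "finite V" "U \<subseteq> [V]\<^bsup>2\<^esup>" "W \<subseteq> U"
    and fixed: "\<And>A. A \<in> same_degrees U F \<Longrightarrow> A - W = F \<inter> U - W"
  shows "switch_graph (same_degrees U F) \<simeq>\<^sub>g switch_graph (same_degrees W F)"
proof (rule graph_isoI[of "\<lambda>A. A \<inter> W"])
  let ?R = "F \<inter> U - W"
  have fin: "finite U"
    using V finite_edge_set by blast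
  have FW: "F \<inter> U \<inter> W = F \<inter> W"
    using V by blast
  have 1: "A \<inter> W \<in> same_degrees W F" if A: "A \<in> same_degrees U F" for A
  proof -
    have "finite A" "finite (F \<inter> U)" "edeg A v = edeg (F \<inter> U) v" for v
      using A fin finite_subset unfolding same_degrees_def by auto
    then have "edeg (A \<inter> W) v = edeg (F \<inter> W) v" for v
      using edeg_Int_Diff[of A v W] edeg_Int_Diff[of "F \<inter> U" v W] fixed[OF A] FW by simp
    then show ?thesis
      unfolding same_degrees_def by simp
  qed
  have 2: "B \<union> ?R \<in> same_degrees U F" "(B \<union> ?R) \<inter> W = B" if B: "B \<in> same_degrees W F" for B
  proof -
    have BW: "B \<subseteq> W" "\<And>v. edeg B v = edeg (F \<inter> W) v"
      using B unfolding same_degrees_def by simp_all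
    then have "finite B" "finite (F \<inter> U)" "finite ?R" "B \<inter> ?R = {}"
      using fin V finite_subset[of B U] by auto
    then have "edeg (B \<union> ?R) v = edeg (F \<inter> U) v" for v
      using edeg_Un_disjoint[of B ?R v] edeg_Int_Diff[of "F \<inter> U" v W] BW FW by simp
    then show "B \<union> ?R \<in> same_degrees U F"
      using BW V unfolding same_degrees_def by auto
    show "(B \<union> ?R) \<inter> W = B"
      using BW by auto
  qed
  show "bij_betw (\<lambda>A. A \<inter> W) (verts (switch_graph (same_degrees U F)))
      (verts (switch_graph (same_degrees W F)))"
  proof (rule bij_betw_byWitness[where f' = "\<lambda>B. B \<union> ?R"])
    have "A \<inter> W \<union> ?R = A" if "A \<in> same_degrees U F" for A
      using fixed[OF that] by auto
    then show "\<forall>A\<in>verts (switch_graph (same_degrees U F)). A \<inter> W \<union> ?R = A"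
      by simp
  qed (use 1 2 in auto)
  fix A B assume AB: "A \<in> verts (switch_graph (same_degrees U F))" "B \<in> verts (switch_graph (same_degrees U F))"
  then have "A - W = B - W"
    using fixed by simp
  then have "A \<inter> W - B \<inter> W = A - B" "B \<inter> W - A \<inter> W = B - A"
    by auto
  then show "adj (switch_graph (same_degrees U F)) A B \<longleftrightarrow>
      adj (switch_graph (same_degrees W F)) (A \<inter> W) (B \<inter> W)"
    using AB 1 by (simp add: adj_switch_graph)
qed

text \<open>Complementing inside \<open>U\<close> interchanges \<open>A - B\<close> and
  \<open>B - A\<close>. This reduces complements of perfect matchings to perfect matchings.\<close>

lemma switch_graph_same_degrees_complement:
  assumes "finite U"
  shows "switch_graph (same_degrees U F) \<simeq>\<^sub>g switch_graph (same_degrees U (U - F))"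
proof (rule graph_isoI[of "\<lambda>A. U - A"])
  have 1: "U - A \<in> same_degrees U (U - F)" if A: "A \<in> same_degrees U F" for A F
  proof -
    have "A \<subseteq> U" "\<And>v. edeg A v = edeg (F \<inter> U) v"
      using A unfolding same_degrees_def by auto
    moreover have "(U - F) \<inter> U = U - F" "U \<inter> F = F \<inter> U" "U \<inter> A = A"
      using calculation by auto
    ultimately have "edeg (U - A) v = edeg ((U - F) \<inter> U) v" for v
      using edeg_Int_Diff[OF assms, of v A] edeg_Int_Diff[OF assms, of v F] by simp
    then show ?thesis
      unfolding same_degrees_def by auto
  qed
  have F: "U - (U - F) = F \<inter> U"
    by auto
  have 2: "U - A \<in> same_degrees U F" if "A \<in> same_degrees U (U - F)" for A
    using 1[OF that] unfolding F by (simp add: same_degrees_def)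
  show "bij_betw (\<lambda>A. U - A) (verts (switch_graph (same_degrees U F)))
      (verts (switch_graph (same_degrees U (U - F))))"
  proof (rule bij_betw_byWitness[where f' = "\<lambda>A. U - A"])
    show "\<forall>A\<in>verts (switch_graph (same_degrees U F)). U - (U - A) = A"
      "\<forall>A\<in>verts (switch_graph (same_degrees U (U - F))). U - (U - A) = A"
      by (auto simp: same_degrees_def)
  qed (use 1 2 in auto)
  fix A B assume AB: "A \<in> verts (switch_graph (same_degrees U F))" "B \<in> verts (switch_graph (same_degrees U F))"
  then have "(U - A) - (U - B) = B - A" "(U - B) - (U - A) = A - B"
    unfolding same_degrees_def by auto
  then show "adj (switch_graph (same_degrees U F)) A B \<longleftrightarrow>
      adj (switch_graph (same_degrees U (U - F))) (U - A) (U - B)"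
    using AB 1 by (auto simp: adj_switch_graph)
qed

section \<open>Perfect matchings and permutations\<close>

text \<open>The clause \<open>x \<noteq> y\<close> lets one formula serve both kinds of block: for
  disjoint sets it gives all pairs between them, and for \<open>X = Y\<close> all pairs inside
  \<open>X\<close>.\<close>

definition cross :: "'a set \<Rightarrow> 'a set \<Rightarrow> 'a set set" where
  "cross X Y = {{x, y} | x y. x \<in> X \<and> y \<in> Y \<and> x \<noteq> y}"

lemma cross_self: "cross X X = [X]\<^bsup>2\<^esup>"
  unfolding cross_def nsets_2_eq by auto

lemma perfect_matching_bij:
  assumes "X \<inter> Y = {}" "A \<subseteq> cross X Y" "\<And>v. v \<in> X \<union> Y \<Longrightarrow> edeg A v = 1"
  obtains h where "bij_betw h X Y" "A = (\<lambda>x. {x, h x}) ` X"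
proof -
  have ex1: "\<exists>!e. e \<in> A \<and> v \<in> e" if v: "v \<in> X \<union> Y" for v
  proof -
    obtain e where "{e \<in> A. v \<in> e} = {e}"
      using assms(3)[OF v] unfolding edeg_def by (rule card_1_singletonE)
    then show ?thesis
      by (intro ex1I[of _ e]) blast+
  qed
  have X: "\<exists>y\<in>Y. {x, y} \<in> A" if x: "x \<in> X" for x
  proof -
    obtain e where e: "e \<in> A" "x \<in> e"
      using ex1[of x] x by blast
    then obtain u w where "e = {u, w}" "u \<in> X" "w \<in> Y"
      using assms(2) unfolding cross_def by blast
    then show ?thesis
      using e that assms(1) by auto
  qed
  then obtain h where h: "\<And>x. x \<in> X \<Longrightarrow> h x \<in> Y \<and> {x, h x} \<in> A"
    by metis
  have A: "A = (\<lambda>x. {x, h x}) ` X"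
  proof
    show "A \<subseteq> (\<lambda>x. {x, h x}) ` X"
    proof
      fix e assume e: "e \<in> A"
      then obtain u w where u: "e = {u, w}" "u \<in> X" "w \<in> Y"
        using assms(2) unfolding cross_def by blast
      then have "e = {u, h u}"
        using ex1[of u] h[of u] e by auto
      then show "e \<in> (\<lambda>x. {x, h x}) ` X"
        using u by blast
    qed
  qed (use h in auto)
  have "bij_betw h X Y"
    unfolding bij_betw_def
  proof
    show "inj_on h X"
    proof (rule inj_onI)
      fix x x' assume x: "x \<in> X" "x' \<in> X" "h x = h x'"
      then have "{x, h x} = {x', h x'}"
        using ex1[of "h x"] h[of x] h[of x'] by auto
      moreover have "h x \<in> Y" "h x' \<in> Y"
        using x h by simp_all
      then have "h x \<noteq> x'" "h x' \<noteq> x"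
        using x assms(1) by auto
      ultimately show "x = x'"
        using x by (auto simp: doubleton_eq_iff)
    qed
    show "h ` X = Y"
    proof
      show "Y \<subseteq> h ` X"
      proof
        fix y assume y: "y \<in> Y"
        then obtain e where "e \<in> A" "y \<in> e"
          using ex1[of y] by blast
        then obtain x where "x \<in> X" "y \<in> {x, h x}"
          using A by auto
        then show "y \<in> h ` X"
          using y assms(1) by auto
      qed
    qed (use h in auto)
  qed
  then show ?thesis
    using A that by blast
qed

text \<open>Where the permutations agree they use up the same values, so on the remaining two points
  they take the same two values in opposite order.\<close>

lemma permutes_differ_in_two:
  assumes p: "p permutes S" and q: "q permutes S" and c: "card {i \<in> S. p i \<noteq> q i} = 2"
  shows "\<exists>i\<in>S. \<exists>j\<in>S. i \<noteq> j \<and> q = p \<circ> transpose i j"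
proof -
  obtain i j where ij: "{i \<in> S. p i \<noteq> q i} = {i, j}" "i \<noteq> j"
    using c by (auto simp: card_2_iff)
  have S: "i \<in> S" "j \<in> S" "p i \<noteq> q i" "p j \<noteq> q j"
    using ij by auto
  have other: "p k = q k" if "k \<noteq> i" "k \<noteq> j" for k
  proof (cases "k \<in> S")
    case True
    then show ?thesis using ij that by blast
  next
    case False
    then show ?thesis using p q by (simp add: permutes_not_in)
  qed
  have inj: "inj p" "inj q"
    using p q by (auto intro: permutes_inj)
  \<comment> \<open>The \<open>p\<close>-preimage of \<open>q a\<close> is not \<open>a\<close>. It
    cannot be a point of agreement either, since injectivity of \<open>q\<close> would make it
    \<open>a\<close>; so it is \<open>b\<close>.\<close>
  have sw: "q a = p b" if ab: "{a, b} = {i, j}" "a \<noteq> b" for a b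
  proof -
    have "q a \<in> S"
      using q S ab permutes_in_image[OF q] by (auto simp: doubleton_eq_iff)
    then obtain k where k: "p k = q a"
      using p by (metis permutes_def)
    have "k \<noteq> a"
      using k S ab by (auto simp: doubleton_eq_iff)
    moreover have "k = a" if "k \<noteq> i" "k \<noteq> j"
      using other[OF that] k inj(2) by (auto dest: injD)
    ultimately have "k = b"
      using ab by (auto simp: doubleton_eq_iff)
    then show ?thesis
      using k by simp
  qed
  have "q = p \<circ> transpose i j"
  proof
    fix k
    show "q k = (p \<circ> transpose i j) k"
      using sw[of i j] sw[of j i] other[of k] ij(2) by (auto simp: transpose_def insert_commute)
  qed
  then show ?thesis
    using S ij(2) by blast
qed

text \<open>Label \<open>X\<close> by \<open>g\<close>, and label \<open>Y\<close> by carrying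
  \<open>g\<close> along the matching contained in \<open>F\<close>. Matchings then become
  permutations of the labels, and two matchings differ in as many edges as the permutations differ
  in arguments.\<close>

lemma switch_graph_matchings:
  assumes "finite X" "X \<inter> Y = {}" and F: "\<And>v. v \<in> X \<union> Y \<Longrightarrow> edeg (F \<inter> cross X Y) v = 1"
  shows "transposition_graph (card X) \<simeq>\<^sub>g switch_graph (same_degrees (cross X Y) F)"
proof -
  let ?k = "card X"
  have cs: "\<Union>(cross X Y) \<subseteq> X \<union> Y"
    unfolding cross_def by auto
  obtain h0 where h0: "bij_betw h0 X Y" "F \<inter> cross X Y = (\<lambda>x. {x, h0 x}) ` X"
    using perfect_matching_bij[OF assms(2) Int_lower2 F] .
  obtain g where g: "bij_betw g {1..?k} X"
    using ex_bij_betw_nat_finite_1[OF assms(1)] by blast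
  define h where "h = h0 \<circ> g"
  have h: "bij_betw h {1..?k} Y"
    unfolding h_def using bij_betw_trans[OF g h0(1)] .
  define M where "M p = (\<lambda>i. {g i, h (p i)}) ` {1..?k}" for p
  have gX: "g i \<in> X" if "i \<in> {1..?k}" for i
    using g that bij_betwE by blast
  have hY: "h i \<in> Y" if "i \<in> {1..?k}" for i
    using h that bij_betwE by blast
  have gh: "g i \<noteq> h j" if "i \<in> {1..?k}" "j \<in> {1..?k}" for i j
    using gX[OF that(1)] hY[OF that(2)] assms(2) by auto
  have eq: "{g i, h j} = {g i', h j'} \<longleftrightarrow> i = i' \<and> j = j'"
    if "i \<in> {1..?k}" "j \<in> {1..?k}" "i' \<in> {1..?k}" "j' \<in> {1..?k}" for i j i' j'
  proof -
    have "g i \<noteq> h j'" "g i' \<noteq> h j"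
      using gh that by simp_all
    moreover have "g i = g i' \<longleftrightarrow> i = i'" "h j = h j' \<longleftrightarrow> j = j'"
      using g h that by (auto simp: bij_betw_def inj_on_eq_iff)
    ultimately show ?thesis
      by (auto simp: doubleton_eq_iff)
  qed
  have pin: "p i \<in> {1..?k}" if "p permutes {1..?k}" "i \<in> {1..?k}" for p i
    using that permutes_in_image by metis
  have mem: "{g i, h j} \<in> M p \<longleftrightarrow> p i = j" if "p permutes {1..?k}" "i \<in> {1..?k}" "j \<in> {1..?k}" for p i j
  proof
    assume "{g i, h j} \<in> M p"
    then obtain i' where i': "i' \<in> {1..?k}" "{g i, h j} = {g i', h (p i')}"
      unfolding M_def by blast
    then show "p i = j"
      using eq[OF that(2,3) i'(1) pin[OF that(1) i'(1)]] by simp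
  qed (use that in \<open>auto simp: M_def\<close>)
  have Msub: "M p \<subseteq> cross X Y" if "p permutes {1..?k}" for p
  proof
    fix e assume "e \<in> M p"
    then obtain i where "i \<in> {1..?k}" "e = {g i, h (p i)}"
      unfolding M_def by blast
    moreover from this have "g i \<in> X" "h (p i) \<in> Y"
      using gX hY pin[OF that] by simp_all
    moreover have "g i \<noteq> h (p i)"
      using calculation assms(2) by auto
    ultimately show "e \<in> cross X Y"
      unfolding cross_def by blast
  qed
  have degM: "edeg (M p) v = 1" if p: "p permutes {1..?k}" and v: "v \<in> X \<union> Y" for p v
  proof -
    obtain i where i: "i \<in> {1..?k}" "v = g i \<or> v = h (p i)"
    proof (cases "v \<in> X")
      case True
      then show ?thesis
        using g that unfolding bij_betw_def by blast
    next
      case False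
      then obtain j where "j \<in> {1..?k}" "v = h j"
        using h v unfolding bij_betw_def by blast
      moreover from this have "j \<in> p ` {1..?k}"
        using permutes_image[OF p] by simp
      then obtain i where "i \<in> {1..?k}" "j = p i"
        by blast
      ultimately show ?thesis
        using that[of i] by simp
    qed
    have "{e \<in> M p. v \<in> e} = {{g i, h (p i)}}"
    proof (intro equalityI subsetI)
      fix e assume "e \<in> {e \<in> M p. v \<in> e}"
      then obtain i' where i': "i' \<in> {1..?k}" "e = {g i', h (p i')}" "v \<in> e"
        unfolding M_def by blast
      have ne: "g i \<noteq> h (p i')" "g i' \<noteq> h (p i)"
        using gh pin[OF p] i(1) i'(1) by simp_all
      have "g i = g i' \<or> h (p i) = h (p i')"
        using i(2) i'(2,3) ne by auto
      then have "i = i' \<or> p i = p i'"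
        using g h i(1) i'(1) pin[OF p] by (auto simp: bij_betw_def inj_on_eq_iff)
      then have "i = i'"
        using permutes_inj[OF p] by (auto dest: injD)
      then show "e \<in> {{g i, h (p i)}}"
        using i' by simp
    qed (use i in \<open>auto simp: M_def\<close>)
    then show ?thesis
      unfolding edeg_def by simp
  qed
  have z: "edeg A v = 0" if "A \<subseteq> cross X Y" "v \<notin> X \<union> Y" for A v
    using that cs unfolding edeg_def by (auto simp: card_eq_0_iff)
  have sd: "A \<in> same_degrees (cross X Y) F \<longleftrightarrow> A \<subseteq> cross X Y \<and> (\<forall>v\<in>X \<union> Y. edeg A v = 1)" for A
  proof -
    have "(\<forall>v. edeg A v = edeg (F \<inter> cross X Y) v) \<longleftrightarrow> (\<forall>v\<in>X \<union> Y. edeg A v = 1)" if "A \<subseteq> cross X Y"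
      using F z[OF that] z[of "F \<inter> cross X Y"] by (metis Int_lower2)
    then show ?thesis
      unfolding same_degrees_def by auto
  qed
  have surj: "\<exists>p. p permutes {1..?k} \<and> M p = A" if A: "A \<in> same_degrees (cross X Y) F" for A
  proof -
    obtain f where f: "bij_betw f X Y" "A = (\<lambda>x. {x, f x}) ` X"
      using perfect_matching_bij[OF assms(2), of A] A sd by blast
    \<comment> \<open>The identity outside the labels is required by
      \<open>permutes\<close>.\<close>
    define p where "p i = (if i \<in> {1..?k} then inv_into {1..?k} h (f (g i)) else i)" for i
    have "bij_betw (inv_into {1..?k} h \<circ> (f \<circ> g)) {1..?k} {1..?k}"
      using bij_betw_trans[OF bij_betw_trans[OF g f(1)] bij_betw_inv_into[OF h]] .
    then have "bij_betw p {1..?k} {1..?k}"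
      by (rule bij_betw_cong[THEN iffD1, rotated]) (simp add: p_def)
    then have p: "p permutes {1..?k}"
      by (rule bij_imp_permutes) (auto simp: p_def)
    have "h (p i) = f (g i)" if i: "i \<in> {1..?k}" for i
    proof -
      have "f (g i) \<in> h ` {1..?k}"
        using f(1) h gX[OF i] by (auto simp: bij_betw_def)
      then show ?thesis
        using i by (simp add: p_def f_inv_into_f)
    qed
    then have "M p = (\<lambda>i. {g i, f (g i)}) ` {1..?k}"
      unfolding M_def by (intro image_cong) auto
    also have "\<dots> = (\<lambda>x. {x, f x}) ` g ` {1..?k}"
      by (simp add: image_image)
    also have "\<dots> = A"
      using g f by (simp add: bij_betw_def)
    finally show ?thesis
      using p by blast
  qed
  have diff: "card (M p - M q) = card {i \<in> {1..?k}. p i \<noteq> q i}"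
    if p: "p permutes {1..?k}" and q: "q permutes {1..?k}" for p q
  proof -
    have "M p - M q = (\<lambda>i. {g i, h (p i)}) ` {i \<in> {1..?k}. p i \<noteq> q i}"
    proof (intro equalityI subsetI)
      fix e assume e: "e \<in> M p - M q"
      then obtain i where i: "i \<in> {1..?k}" "e = {g i, h (p i)}"
        unfolding M_def by blast
      then show "e \<in> (\<lambda>i. {g i, h (p i)}) ` {i \<in> {1..?k}. p i \<noteq> q i}"
        using e mem[OF q i(1) pin[OF p i(1)]] by auto
    next
      fix e assume "e \<in> (\<lambda>i. {g i, h (p i)}) ` {i \<in> {1..?k}. p i \<noteq> q i}"
      then obtain i where i: "i \<in> {1..?k}" "e = {g i, h (p i)}" "p i \<noteq> q i"
        by blast
      then show "e \<in> M p - M q"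
        using mem[OF q i(1) pin[OF p i(1)]] mem[OF p i(1) pin[OF p i(1)]] by auto
    qed
    moreover have "inj_on (\<lambda>i. {g i, h (p i)}) {i \<in> {1..?k}. p i \<noteq> q i}"
      by (rule inj_onI) (use eq pin[OF p] in blast)
    ultimately show ?thesis
      by (simp add: card_image)
  qed
  show ?thesis
  proof (rule graph_isoI[of M])
    show "bij_betw M (verts (transposition_graph ?k)) (verts (switch_graph (same_degrees (cross X Y) F)))"
      unfolding bij_betw_def
    proof
      show "inj_on M (verts (transposition_graph ?k))"
      proof (rule inj_onI)
        fix p q assume pq: "p \<in> verts (transposition_graph ?k)" "q \<in> verts (transposition_graph ?k)" "M p = M q"
        then have p: "p permutes {1..?k}" "q permutes {1..?k}"
          by simp_all
        have "card {i \<in> {1..?k}. p i \<noteq> q i} = 0"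
          using diff[OF p] pq(3) by simp
        then have "p i = q i" if "i \<in> {1..?k}" for i
          using that by auto
        moreover have "p i = q i" if "i \<notin> {1..?k}" for i
          using permutes_not_in[OF p(1) that] permutes_not_in[OF p(2) that] by simp
        ultimately show "p = q"
          by blast
      qed
      show "M ` verts (transposition_graph ?k) = verts (switch_graph (same_degrees (cross X Y) F))"
      proof (intro equalityI subsetI)
        fix A assume "A \<in> verts (switch_graph (same_degrees (cross X Y) F))"
        then obtain p where "p permutes {1..?k}" "M p = A"
          using surj by auto
        then show "A \<in> M ` verts (transposition_graph ?k)"
          by auto
      qed (use Msub degM in \<open>auto simp: sd\<close>)
    qed
    fix p q assume pq: "p \<in> verts (transposition_graph ?k)" "q \<in> verts (transposition_graph ?k)"
    then have p: "p permutes {1..?k}" "q permutes {1..?k}"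
      by simp_all
    then have in_sd: "M p \<in> same_degrees (cross X Y) F" "M q \<in> same_degrees (cross X Y) F"
      using Msub degM by (auto simp: sd)
    have sym: "{i \<in> {1..?k}. q i \<noteq> p i} = {i \<in> {1..?k}. p i \<noteq> q i}"
      by auto
    have "card {i \<in> {1..?k}. p i \<noteq> q i} = 2 \<longleftrightarrow> (\<exists>i\<in>{1..?k}. \<exists>j\<in>{1..?k}. i \<noteq> j \<and> q = p \<circ> transpose i j)"
    proof
      assume "\<exists>i\<in>{1..?k}. \<exists>j\<in>{1..?k}. i \<noteq> j \<and> q = p \<circ> transpose i j"
      then obtain i j where ij: "i \<in> {1..?k}" "j \<in> {1..?k}" "i \<noteq> j" "q = p \<circ> transpose i j"
        by blast
      have "{l \<in> {1..?k}. p l \<noteq> q l} = {i, j}"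
        using ij permutes_inj[OF p(1)] by (auto simp: transpose_def dest: injD)
      then show "card {l \<in> {1..?k}. p l \<noteq> q l} = 2"
        using ij by simp
    qed (rule permutes_differ_in_two[OF p])
    then show "adj (transposition_graph ?k) p q \<longleftrightarrow>
        adj (switch_graph (same_degrees (cross X Y) F)) (M p) (M q)"
      using p in_sd diff[OF p] diff[OF p(2,1)] sym
      unfolding adj_transposition_graph adj_switch_graph by simp
  qed
qed

section \<open>The twelve 5-cycles on five points\<close>

definition K5 :: "nat set set" where
  "K5 = {{0,1}, {0,2}, {0,3}, {0,4}, {1,2}, {1,3}, {1,4}, {2,3}, {2,4}, {3,4}}"

lemma card_K5: "card K5 = 10"
  by (simp add: K5_def doubleton_eq_iff)

lemma K5_eq: "[{..<5}]\<^bsup>2\<^esup> = K5"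
proof -
  have "K5 \<subseteq> [{..<5}]\<^bsup>2\<^esup>"
    unfolding K5_def by simp
  moreover have "card ([{..<5::nat}]\<^bsup>2\<^esup>) = 10"
    by (simp add: choose_two)
  ultimately show ?thesis
    using card_subset_eq[of "[{..<5}]\<^bsup>2\<^esup>" K5] by (simp add: card_K5 finite_imp_finite_nsets)
qed

text \<open>The orbit of one pentagon under the alternating group; the remaining six pentagons are the
  complements.\<close>

definition pentagon :: "nat \<Rightarrow> nat set set" where
  "pentagon i =
    [{{0,1}, {0,2}, {1,3}, {2,4}, {3,4}},
     {{0,1}, {0,3}, {1,4}, {2,3}, {2,4}},
     {{0,1}, {0,4}, {1,2}, {2,3}, {3,4}},
     {{0,2}, {0,3}, {1,2}, {1,4}, {3,4}},
     {{0,2}, {0,4}, {1,3}, {1,4}, {2,3}},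
     {{0,3}, {0,4}, {1,2}, {1,3}, {2,4}}] ! (i - 1)"

lemma atLeastAtMost_1_6: "{1..6::nat} = {1, 2, 3, 4, 5, 6}"
  by auto

lemma pentagon_subset: "i \<in> {1..6} \<Longrightarrow> pentagon i \<subseteq> K5"
  unfolding atLeastAtMost_1_6 by (elim insertE emptyE; simp add: pentagon_def K5_def)

lemma card_pentagon: "i \<in> {1..6} \<Longrightarrow> card (pentagon i) = 5"
  unfolding atLeastAtMost_1_6 by (elim insertE emptyE; simp add: pentagon_def doubleton_eq_iff)

text \<open>Two different pentagons of the list share exactly two edges. So they differ in three
  edges and are not adjacent, whereas each differs in two edges from the complement of the other and
  is adjacent to it.\<close>

lemma card_pentagon_Diff:
  "i \<in> {1..6} \<Longrightarrow> j \<in> {1..6} \<Longrightarrow> i \<noteq> j \<Longrightarrow> card (pentagon i - pentagon j) = 3"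
  unfolding atLeastAtMost_1_6
  by (elim insertE emptyE; simp add: pentagon_def doubleton_eq_iff insert_Diff_if)

text \<open>Writing each degree as a sum of four truth values turns the classification of 2-regular
  graphs into a Boolean problem in ten variables.\<close>

lemma edeg_subset_K5:
  assumes "A \<subseteq> K5"
  shows
    "edeg A 0 = of_bool ({0,1} \<in> A) + of_bool ({0,2} \<in> A) + of_bool ({0,3} \<in> A) + of_bool ({0,4} \<in> A)"
    "edeg A 1 = of_bool ({0,1} \<in> A) + of_bool ({1,2} \<in> A) + of_bool ({1,3} \<in> A) + of_bool ({1,4} \<in> A)"
    "edeg A 2 = of_bool ({0,2} \<in> A) + of_bool ({1,2} \<in> A) + of_bool ({2,3} \<in> A) + of_bool ({2,4} \<in> A)"
    "edeg A 3 = of_bool ({0,3} \<in> A) + of_bool ({1,3} \<in> A) + of_bool ({2,3} \<in> A) + of_bool ({3,4} \<in> A)"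
    "edeg A 4 = of_bool ({0,4} \<in> A) + of_bool ({1,4} \<in> A) + of_bool ({2,4} \<in> A) + of_bool ({3,4} \<in> A)"
proof -
  have *: "edeg A v = (\<Sum>e\<in>{e \<in> K5. v \<in> e}. of_bool (e \<in> A))" for v
  proof -
    have "{e \<in> A. v \<in> e} = {e \<in> {e \<in> K5. v \<in> e}. e \<in> A}"
      using assms by auto
    moreover have "finite {e \<in> K5. v \<in> e}"
      by (simp add: K5_def)
    ultimately show ?thesis
      unfolding edeg_def by (simp add: of_bool_def sum.If_cases Int_def)
  qed
  have filter_insert: "{e. e \<in> insert x B \<and> P e} = (if P x then insert x {e. e \<in> B \<and> P e} else {e. e \<in> B \<and> P e})"
    for x :: "nat set" and B P
    by auto
  have v: "{e \<in> K5. 0 \<in> e} = {{0,1}, {0,2}, {0,3}, {0,4}}"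
    "{e \<in> K5. 1 \<in> e} = {{0,1}, {1,2}, {1,3}, {1,4}}"
    "{e \<in> K5. 2 \<in> e} = {{0,2}, {1,2}, {2,3}, {2,4}}"
    "{e \<in> K5. 3 \<in> e} = {{0,3}, {1,3}, {2,3}, {3,4}}"
    "{e \<in> K5. 4 \<in> e} = {{0,4}, {1,4}, {2,4}, {3,4}}"
    unfolding K5_def by (simp_all only: filter_insert) simp_all
  show "edeg A 0 = of_bool ({0,1} \<in> A) + of_bool ({0,2} \<in> A) + of_bool ({0,3} \<in> A) + of_bool ({0,4} \<in> A)"
    unfolding * v by (simp add: doubleton_eq_iff)
  show "edeg A 1 = of_bool ({0,1} \<in> A) + of_bool ({1,2} \<in> A) + of_bool ({1,3} \<in> A) + of_bool ({1,4} \<in> A)"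
    unfolding * v by (simp add: doubleton_eq_iff)
  show "edeg A 2 = of_bool ({0,2} \<in> A) + of_bool ({1,2} \<in> A) + of_bool ({2,3} \<in> A) + of_bool ({2,4} \<in> A)"
    unfolding * v by (simp add: doubleton_eq_iff)
  show "edeg A 3 = of_bool ({0,3} \<in> A) + of_bool ({1,3} \<in> A) + of_bool ({2,3} \<in> A) + of_bool ({3,4} \<in> A)"
    unfolding * v by (simp add: doubleton_eq_iff)
  show "edeg A 4 = of_bool ({0,4} \<in> A) + of_bool ({1,4} \<in> A) + of_bool ({2,4} \<in> A) + of_bool ({3,4} \<in> A)"
    unfolding * v by (simp add: doubleton_eq_iff)
qed

text \<open>These are exactly the 5-cycles: a cycle has at least three vertices, so five vertices
  cannot be split among several cycles.\<close>

definition two_regular_K5 :: "nat set set set" where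
  "two_regular_K5 = {A. A \<subseteq> K5 \<and> (\<forall>v\<in>{0, 1, 2, 3, 4}. edeg A v = 2)}"

text \<open>The letters \<open>a\<close> to \<open>j\<close> stand for the ten pairs in the order in
  which \<open>K5\<close> lists them, and the equations for the five vertices. The disjuncts follow
  the order of \<open>pentagon\<close>; \<open>s\<close> chooses between the pentagon and its
  complement.\<close>

lemma two_regular_boolean:
  fixes a b c d e f g h i j :: bool
  assumes "of_bool a + of_bool b + of_bool c + of_bool d = (2::nat)"
    "of_bool a + of_bool e + of_bool f + of_bool g = (2::nat)"
    "of_bool b + of_bool e + of_bool h + of_bool i = (2::nat)"
    "of_bool c + of_bool f + of_bool h + of_bool j = (2::nat)"
    "of_bool d + of_bool g + of_bool i + of_bool j = (2::nat)"
  shows "(\<exists>s. (a \<longleftrightarrow> s) \<and> (b \<longleftrightarrow> s) \<and> (c \<longleftrightarrow> \<not> s) \<and> (d \<longleftrightarrow> \<not> s) \<and> (e \<longleftrightarrow> \<not> s) \<and>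
          (f \<longleftrightarrow> s) \<and> (g \<longleftrightarrow> \<not> s) \<and> (h \<longleftrightarrow> \<not> s) \<and> (i \<longleftrightarrow> s) \<and> (j \<longleftrightarrow> s)) \<or>
    (\<exists>s. (a \<longleftrightarrow> s) \<and> (b \<longleftrightarrow> \<not> s) \<and> (c \<longleftrightarrow> s) \<and> (d \<longleftrightarrow> \<not> s) \<and> (e \<longleftrightarrow> \<not> s) \<and>
          (f \<longleftrightarrow> \<not> s) \<and> (g \<longleftrightarrow> s) \<and> (h \<longleftrightarrow> s) \<and> (i \<longleftrightarrow> s) \<and> (j \<longleftrightarrow> \<not> s)) \<or>
    (\<exists>s. (a \<longleftrightarrow> s) \<and> (b \<longleftrightarrow> \<not> s) \<and> (c \<longleftrightarrow> \<not> s) \<and> (d \<longleftrightarrow> s) \<and> (e \<longleftrightarrow> s) \<and>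
          (f \<longleftrightarrow> \<not> s) \<and> (g \<longleftrightarrow> \<not> s) \<and> (h \<longleftrightarrow> s) \<and> (i \<longleftrightarrow> \<not> s) \<and> (j \<longleftrightarrow> s)) \<or>
    (\<exists>s. (a \<longleftrightarrow> \<not> s) \<and> (b \<longleftrightarrow> s) \<and> (c \<longleftrightarrow> s) \<and> (d \<longleftrightarrow> \<not> s) \<and> (e \<longleftrightarrow> s) \<and>
          (f \<longleftrightarrow> \<not> s) \<and> (g \<longleftrightarrow> s) \<and> (h \<longleftrightarrow> \<not> s) \<and> (i \<longleftrightarrow> \<not> s) \<and> (j \<longleftrightarrow> s)) \<or>
    (\<exists>s. (a \<longleftrightarrow> \<not> s) \<and> (b \<longleftrightarrow> s) \<and> (c \<longleftrightarrow> \<not> s) \<and> (d \<longleftrightarrow> s) \<and> (e \<longleftrightarrow> \<not> s) \<and>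
          (f \<longleftrightarrow> s) \<and> (g \<longleftrightarrow> s) \<and> (h \<longleftrightarrow> s) \<and> (i \<longleftrightarrow> \<not> s) \<and> (j \<longleftrightarrow> \<not> s)) \<or>
    (\<exists>s. (a \<longleftrightarrow> \<not> s) \<and> (b \<longleftrightarrow> \<not> s) \<and> (c \<longleftrightarrow> s) \<and> (d \<longleftrightarrow> s) \<and> (e \<longleftrightarrow> s) \<and>
          (f \<longleftrightarrow> s) \<and> (g \<longleftrightarrow> \<not> s) \<and> (h \<longleftrightarrow> \<not> s) \<and> (i \<longleftrightarrow> s) \<and> (j \<longleftrightarrow> \<not> s))"
  \<comment> \<open>The splits follow the vertices 0, 1, 2, ...; simplifying after each group
    discards the assignments that already violate a degree.\<close>
  using assms
  by (cases a; cases b; cases c; cases d; simp; cases e; cases f; cases g; simp; cases h; cases i; simp; cases j; simp)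

lemma two_regular_K5_cases:
  assumes "A \<in> two_regular_K5"
  shows "\<exists>i\<in>{1..6}. A = pentagon i \<or> A = K5 - pentagon i"
proof -
  have A: "A \<subseteq> K5"
    and "edeg A 0 = 2" "edeg A 1 = 2" "edeg A 2 = 2" "edeg A 3 = 2" "edeg A 4 = 2"
    using assms unfolding two_regular_K5_def by simp_all
  note d = this(2-6)[unfolded edeg_subset_K5[OF A]]
  have *: "\<exists>i\<in>{1..6}. A = pentagon i \<or> A = K5 - pentagon i"
    if i: "i \<in> {1..6}" and ex: "\<exists>s. \<forall>e\<in>K5. e \<in> A \<longleftrightarrow> (if e \<in> pentagon i then s else \<not> s)" for i
  proof -
    obtain s where s: "\<forall>e\<in>K5. e \<in> A \<longleftrightarrow> (if e \<in> pentagon i then s else \<not> s)"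
      using ex by blast
    show ?thesis
    proof (cases s)
      case True
      then have "\<forall>e\<in>K5. e \<in> A \<longleftrightarrow> e \<in> pentagon i"
        using s by simp
      then have "A = pentagon i"
        using A pentagon_subset[OF i] by blast
      then show ?thesis
        using i by blast
    next
      case False
      then have "\<forall>e\<in>K5. e \<in> A \<longleftrightarrow> e \<notin> pentagon i"
        using s by simp
      then have "A = K5 - pentagon i"
        using A by blast
      then show ?thesis
        using i by blast
    qed
  qed
  from two_regular_boolean[OF d] show ?thesis
    apply (elim disjE)
    subgoal by (rule *[of 1]) (simp_all add: K5_def pentagon_def doubleton_eq_iff)
    subgoal by (rule *[of 2]) (simp_all add: K5_def pentagon_def doubleton_eq_iff)
    subgoal by (rule *[of 3]) (simp_all add: K5_def pentagon_def doubleton_eq_iff)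
    subgoal by (rule *[of 4]) (simp_all add: K5_def pentagon_def doubleton_eq_iff)
    subgoal by (rule *[of 5]) (simp_all add: K5_def pentagon_def doubleton_eq_iff)
    subgoal by (rule *[of 6]) (simp_all add: K5_def pentagon_def doubleton_eq_iff)
    done
qed

text \<open>\<open>K5\<close> is 4-regular, so the complement of a 2-regular graph is again
  2-regular.\<close>

lemma pentagon_two_regular:
  assumes "i \<in> {1..6}"
  shows "pentagon i \<in> two_regular_K5" "K5 - pentagon i \<in> two_regular_K5"
proof -
  have d: "edeg (pentagon i) v = 2" if "v \<in> {0, 1, 2, 3, 4}" for v
    using assms that unfolding atLeastAtMost_1_6
    by (elim insertE emptyE; hypsubst;
      subst edeg_subset_K5; simp add: pentagon_def doubleton_eq_iff K5_def)
  have d': "edeg K5 v = 4" if "v \<in> {0, 1, 2, 3, 4}" for v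
    using that by (elim insertE emptyE; hypsubst; subst edeg_subset_K5; simp add: K5_def)
  have fin: "finite K5"
    by (simp add: K5_def)
  have "K5 \<inter> pentagon i = pentagon i"
    using pentagon_subset[OF assms] by blast
  then have "edeg (K5 - pentagon i) v = 2" if "v \<in> {0, 1, 2, 3, 4}" for v
    using edeg_Int_Diff[OF fin, of v "pentagon i"] d[OF that] d'[OF that] by simp
  then show "pentagon i \<in> two_regular_K5" "K5 - pentagon i \<in> two_regular_K5"
    using pentagon_subset[OF assms] d unfolding two_regular_K5_def by simp_all
qed

text \<open>One side consists of the listed pentagons, the other of their complements. Differences
  have size 0 or 3 within a side and 5 or 2 across, with 5 exactly for a complementary pair; so the
  value 2 picks out the edges of \<open>K66_minus_6K2\<close>.\<close>

lemma switch_graph_two_regular_K5: "K66_minus_6K2 \<simeq>\<^sub>g switch_graph two_regular_K5"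
proof -
  define f where "f = case_sum pentagon (\<lambda>i. K5 - pentagon i)"
  have f [simp]: "f (Inl i) = pentagon i" "f (Inr i) = K5 - pentagon i" for i
    by (simp_all add: f_def)
  have fin: "finite K5" "finite (pentagon i)" if "i \<in> {1..6}" for i
    using pentagon_subset[OF that] finite_subset by (auto simp: K5_def)
  have int: "card (pentagon i \<inter> pentagon j) = (if i = j then 5 else 2)"
    if "i \<in> {1..6}" "j \<in> {1..6}" for i j
    using card_pentagon[OF that(1)] card_pentagon_Diff[OF that] fin[OF that(1)]
      card_Diff_subset_Int[of "pentagon i" "pentagon j"] card_mono[of "pentagon i" "pentagon i \<inter> pentagon j"]
    by auto
  \<comment> \<open>The value 8 is 5 + 5 - 2; the 10 - 8 pairs outside the union are what a
    complement has beyond another pentagon.\<close>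
  have un: "card (pentagon i \<union> pentagon j) = (if i = j then 5 else 8)"
    if "i \<in> {1..6}" "j \<in> {1..6}" for i j
    using card_Un_Int[OF fin(2)[OF that(1)] fin(2)[OF that(2)]] card_pentagon[OF that(1)]
      card_pentagon[OF that(2)] int[OF that] by auto
  have LL: "card (f (Inl i) - f (Inl j)) = (if i = j then 0 else 3)" if "i \<in> {1..6}" "j \<in> {1..6}" for i j
    using card_pentagon_Diff[OF that] by simp
  have RR: "card (f (Inr i) - f (Inr j)) = (if i = j then 0 else 3)" if "i \<in> {1..6}" "j \<in> {1..6}" for i j
  proof -
    have "f (Inr i) - f (Inr j) = pentagon j - pentagon i"
      using pentagon_subset[OF that(2)] by auto
    then show ?thesis
      using card_pentagon_Diff[OF that(2,1)] by auto
  qed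
  have LR: "card (f (Inl i) - f (Inr j)) = (if i = j then 5 else 2)" if "i \<in> {1..6}" "j \<in> {1..6}" for i j
  proof -
    have "f (Inl i) - f (Inr j) = pentagon i \<inter> pentagon j"
      using pentagon_subset[OF that(1)] by auto
    then show ?thesis
      using int[OF that] by simp
  qed
  have RL: "card (f (Inr i) - f (Inl j)) = (if i = j then 5 else 2)" if "i \<in> {1..6}" "j \<in> {1..6}" for i j
  proof -
    have "f (Inr i) - f (Inl j) = K5 - (pentagon i \<union> pentagon j)"
      by auto
    moreover have "pentagon i \<union> pentagon j \<subseteq> K5"
      using that by (simp add: pentagon_subset)
    ultimately show ?thesis
      using un[OF that] card_K5 fin that by (simp add: card_Diff_subset)
  qed
  show ?thesis
  proof (rule graph_isoI[of f])
    show "bij_betw f (verts K66_minus_6K2) (verts (switch_graph two_regular_K5))"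
      unfolding bij_betw_def
    proof
      show "inj_on f (verts K66_minus_6K2)"
      proof (rule inj_onI)
        fix x y assume xy: "x \<in> verts K66_minus_6K2" "y \<in> verts K66_minus_6K2" "f x = f y"
        \<comment> \<open>Among the possible sizes 0, 2, 3 and 5, the value 0 occurs only for equal
          arguments.\<close>
        then have "card (f x - f y) = 0"
          by simp
        then show "x = y"
          using xy(1,2) LL LR RL RR unfolding verts_K66_minus_6K2
          by (elim UnE imageE) (auto simp del: f split: if_splits)
      qed
      show "f ` verts K66_minus_6K2 = verts (switch_graph two_regular_K5)"
      proof (intro equalityI subsetI)
        fix A assume "A \<in> verts (switch_graph two_regular_K5)"
        then obtain i where i: "i \<in> {1..6}" "A = f (Inl i) \<or> A = f (Inr i)"
          using two_regular_K5_cases[of A] unfolding f verts_switch_graph by blast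
        then have "Inl i \<in> verts K66_minus_6K2" "Inr i \<in> verts K66_minus_6K2"
          unfolding verts_K66_minus_6K2 by blast+
        then show "A \<in> f ` verts K66_minus_6K2"
          using i(2) by blast
      next
        fix A assume "A \<in> f ` verts K66_minus_6K2"
        then obtain i where "i \<in> {1..6}" "A = f (Inl i) \<or> A = f (Inr i)"
          by auto
        then show "A \<in> verts (switch_graph two_regular_K5)"
          using pentagon_two_regular by auto
      qed
    qed
    have tr: "f x \<in> two_regular_K5" if "x \<in> verts K66_minus_6K2" for x
      using that pentagon_two_regular by auto
    fix x y assume xy: "x \<in> verts K66_minus_6K2" "y \<in> verts K66_minus_6K2"
    from xy show "adj K66_minus_6K2 x y \<longleftrightarrow> adj (switch_graph two_regular_K5) (f x) (f y)"
      using tr[OF xy(1)] tr[OF xy(2)] unfolding adj_switch_graph verts_K66_minus_6K2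
      by (elim UnE imageE) (simp_all add: adj_K66_minus_6K2 LL LR RL RR del: f)
  qed
qed

lemma switch_graph_pentagons:
  assumes X: "card X = 5" and F: "\<And>v. v \<in> X \<Longrightarrow> edeg (F \<inter> [X]\<^bsup>2\<^esup>) v = 2"
  shows "K66_minus_6K2 \<simeq>\<^sub>g switch_graph (same_degrees ([X]\<^bsup>2\<^esup>) F)"
proof -
  have "finite X"
    using X card_ge_0_finite by force
  then obtain g where g: "bij_betw g {..<5::nat} X"
    using ex_bij_betw_nat_finite[of X] X by (auto simp: atLeast0LessThan)
  have inj: "inj_on g {..<5}"
    using g by (rule bij_betw_imp_inj_on)
  let ?g = "image (image g)"
  have bK: "bij_betw (image g) K5 ([X]\<^bsup>2\<^esup>)"
    using bij_betw_nsets[OF g, of 2] unfolding K5_eq .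
  then have bP: "bij_betw ?g (Pow K5) (Pow ([X]\<^bsup>2\<^esup>))"
    by (rule bij_betw_Pow)
  have injK: "inj_on (image g) K5"
    using bK by (rule bij_betw_imp_inj_on)
  have edeg: "edeg (?g A) (g v) = edeg A v" if A: "A \<subseteq> K5" and v: "v < 5" for A v
  proof -
    have "g v \<in> g ` e \<longleftrightarrow> v \<in> e" if "e \<in> A" for e
    proof -
      have "e \<subseteq> {..<5}"
        using A that unfolding K5_eq[symmetric] nsets_def by auto
      then show ?thesis
        using inj v by (auto simp: inj_on_def)
    qed
    then have "{e \<in> ?g A. g v \<in> e} = image g ` {e \<in> A. v \<in> e}"
      by auto
    moreover have "inj_on (image g) {e \<in> A. v \<in> e}"
      using injK A by (rule inj_on_subset[OF _ order_trans[rotated]]) auto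
    ultimately show ?thesis
      unfolding edeg_def by (simp add: card_image)
  qed
  have sd: "?g A \<in> same_degrees ([X]\<^bsup>2\<^esup>) F \<longleftrightarrow> A \<in> two_regular_K5" if A: "A \<subseteq> K5" for A
  proof -
    have sub: "?g A \<subseteq> [X]\<^bsup>2\<^esup>"
      using bK A unfolding bij_betw_def by blast
    have z: "edeg B v = 0" if "B \<subseteq> [X]\<^bsup>2\<^esup>" "v \<notin> X" for B v
      using that unfolding edeg_def by (auto simp: nsets_def card_eq_0_iff)
    have "(\<forall>v. edeg (?g A) v = edeg (F \<inter> [X]\<^bsup>2\<^esup>) v) \<longleftrightarrow> (\<forall>v\<in>X. edeg (?g A) v = 2)"
      using F z[OF sub] z[of "F \<inter> [X]\<^bsup>2\<^esup>"] by (metis Int_lower2)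
    also have "\<dots> \<longleftrightarrow> (\<forall>v\<in>g ` {..<5}. edeg (?g A) v = 2)"
      using g unfolding bij_betw_def by simp
    also have "\<dots> \<longleftrightarrow> (\<forall>v\<in>{..<5}. edeg A v = 2)"
      using edeg[OF A] by simp
    also have "{..<5} = {0, 1, 2, 3, 4::nat}"
      by auto
    finally show ?thesis
      using sub A unfolding same_degrees_def two_regular_K5_def by simp
  qed
  have "switch_graph two_regular_K5 \<simeq>\<^sub>g switch_graph (same_degrees ([X]\<^bsup>2\<^esup>) F)"
  proof (rule graph_isoI[of ?g])
    have img: "?g ` two_regular_K5 = same_degrees ([X]\<^bsup>2\<^esup>) F"
    proof (intro equalityI subsetI)
      fix B assume B: "B \<in> same_degrees ([X]\<^bsup>2\<^esup>) F"
      then have "B \<in> ?g ` Pow K5"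
        using bP unfolding bij_betw_def same_degrees_def by simp
      then show "B \<in> ?g ` two_regular_K5"
        using B sd by auto
    next
      fix B assume "B \<in> ?g ` two_regular_K5"
      then show "B \<in> same_degrees ([X]\<^bsup>2\<^esup>) F"
        using sd unfolding two_regular_K5_def by auto
    qed
    have "two_regular_K5 \<subseteq> Pow K5"
      unfolding two_regular_K5_def by auto
    then show "bij_betw ?g (verts (switch_graph two_regular_K5)) (verts (switch_graph (same_degrees ([X]\<^bsup>2\<^esup>) F)))"
      using bP img inj_on_subset[of ?g "Pow K5" two_regular_K5] unfolding bij_betw_def by simp
    fix A B assume AB: "A \<in> verts (switch_graph two_regular_K5)" "B \<in> verts (switch_graph two_regular_K5)"
    then have sub: "A \<subseteq> K5" "B \<subseteq> K5"
      unfolding two_regular_K5_def by auto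
    have "card (?g A - ?g B) = card (A - B)" if "A \<subseteq> K5" "B \<subseteq> K5" for A B
    proof -
      have "?g A - ?g B = ?g (A - B)"
        using inj_on_image_set_diff[OF injK, of A B] that by (simp add: le_infI1 Diff_subset_conv le_supI2)
      moreover have "inj_on (image g) (A - B)"
        using that by (intro inj_on_subset[OF injK]) auto
      ultimately show ?thesis
        by (simp add: card_image)
    qed
    then show "adj (switch_graph two_regular_K5) A B \<longleftrightarrow>
        adj (switch_graph (same_degrees ([X]\<^bsup>2\<^esup>) F)) (?g A) (?g B)"
      using AB sub sd unfolding adj_switch_graph by simp
  qed
  then show ?thesis
    using graph_iso_trans[OF switch_graph_two_regular_K5] by blast
qed

section \<open>Graphs whose alternating 4-cycles behave uniformly\<close>

text \<open>If both diagonals \<open>{a, c}\<close> and \<open>{b, d}\<close> were edges the four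
  vertices would induce a 4-cycle, and if neither were, two disjoint edges. The last axiom names
  only \<open>a\<close> and \<open>c\<close>; reflecting the cycle yields the same for
  \<open>b\<close> and \<open>d\<close>.\<close>

locale uniform_graph =
  fixes G :: "'a graph"
  assumes simple: "simple_graph G"
    and opposite_adj: "alternating_4_cycle G a b c d \<Longrightarrow> adj G a c \<noteq> adj G b d"
    and uniform: "alternating_4_cycle G a b c d \<Longrightarrow> v \<in> verts G \<Longrightarrow> v \<notin> {a, b, c, d} \<Longrightarrow>
      adj G v a \<longleftrightarrow> adj G v c"
begin

abbreviation V where "V \<equiv> verts G"
abbreviation E where "E \<equiv> adj G"
abbreviation alt where "alt \<equiv> alternating_4_cycle G"
abbreviation deg where "deg \<equiv> degree G"

definition cls :: "'a \<Rightarrow> 'a set" where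
  "cls v = {u \<in> V. deg u = deg v}"

lemma finite_V: "finite V"
  using simple unfolding simple_graph_def by simp

lemma E_verts: "E u v \<Longrightarrow> u \<in> V \<and> v \<in> V \<and> u \<noteq> v"
  using simple doubleton_in_nsets_2[of u v V] unfolding simple_graph_def adj_def by blast

lemma E_irrefl [simp]: "\<not> E v v"
  using E_verts by blast

lemma E_commute: "E u v \<longleftrightarrow> E v u"
  by (rule adj_commute)

lemma alt_iff:
  "alt a b c d \<longleftrightarrow> E a b \<and> \<not> E b c \<and> E c d \<and> \<not> E d a \<and> a \<noteq> c \<and> b \<noteq> d \<and> b \<noteq> c \<and> d \<noteq> a"
  unfolding alternating_4_cycle_def using E_verts[of a b] E_verts[of c d] by auto

lemma alt_verts: "alt a b c d \<Longrightarrow> a \<in> V \<and> b \<in> V \<and> c \<in> V \<and> d \<in> V"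
  unfolding alternating_4_cycle_def by simp

lemma alt_half_turn: "alt a b c d \<Longrightarrow> alt c d a b"
  unfolding alt_iff by blast

lemma alt_flip: "alt a b c d \<Longrightarrow> alt b a d c"
  unfolding alt_iff using E_commute[of a b] E_commute[of b c] E_commute[of c d] E_commute[of d a] by blast

lemma uniform': "alt a b c d \<Longrightarrow> v \<in> V \<Longrightarrow> v \<notin> {a, b, c, d} \<Longrightarrow> E v b \<longleftrightarrow> E v d"
  using uniform[OF alt_flip, of a b c d v] by auto

text \<open>Outside the cycle \<open>a\<close> and \<open>c\<close> have the same neighbours
  \<open>R\<close>. On it, \<open>b\<close> is replaced by \<open>d\<close>, and the adjacency
  between \<open>a\<close> and \<open>c\<close> counts for both.\<close>

lemma alt_degree_1:
  assumes "alt a b c d"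
  shows "deg a = deg c"
proof -
  define R where "R = {v \<in> V - {a, b, c, d}. E v a}"
  have ac: "E a b" "\<not> E b c" "E c d" "\<not> E d a" "a \<noteq> c" "b \<noteq> d" "b \<noteq> c" "d \<noteq> a"
    using assms unfolding alt_iff by blast+
  have v: "a \<in> V" "b \<in> V" "c \<in> V" "d \<in> V"
    using alt_verts[OF assms] by blast+
  have Na: "{u \<in> V. E a u} = insert b (R \<union> (if E a c then {c} else {}))"
    using ac v by (auto simp: R_def E_commute)
  have Nc: "{u \<in> V. E c u} = insert d (R \<union> (if E a c then {a} else {}))"
  proof -
    have "E c u \<longleftrightarrow> u = d \<or> u \<in> R \<or> E a c \<and> u = a" if "u \<in> V" for u
    proof (cases "u \<in> {a, b, c, d}")
      case True
      then show ?thesis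
        using ac E_commute[of a c] E_commute[of b c] by (auto simp: R_def)
    next
      case False
      then show ?thesis
        using uniform[OF assms that False] E_commute[of c u] that by (auto simp: R_def)
    qed
    moreover have "R \<subseteq> V"
      by (auto simp: R_def)
    ultimately show ?thesis
      using v by auto
  qed
  have "finite R" "a \<notin> R" "b \<notin> R" "c \<notin> R" "d \<notin> R"
    using finite_V by (simp_all add: R_def)
  then show ?thesis
    unfolding degree_def Na Nc using ac(5,7,8) by (cases "E a c") simp_all
qed

lemma alt_degree: "alt a b c d \<Longrightarrow> deg a = deg c \<and> deg b = deg d"
  using alt_degree_1 alt_flip by blast

text \<open>If \<open>u\<close> has a neighbour \<open>p\<close> that \<open>v\<close> lacks, while
  \<open>v\<close> has at least as many neighbours, then \<open>v\<close> has a neighbour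
  \<open>q\<close> that \<open>u\<close> lacks, and \<open>u p v q\<close> alternates.\<close>

lemma exchange:
  assumes "E u p" "\<not> E v p" "p \<noteq> v" "u \<noteq> v" "v \<in> V" "deg u \<le> deg v"
  shows "\<exists>q. alt u p v q"
proof (rule ccontr)
  assume no: "\<not> (\<exists>q. alt u p v q)"
  \<comment> \<open>Removing \<open>u\<close> and \<open>v\<close> from each other's neighbourhoods
    makes the comparison independent of whether they are adjacent; \<open>p\<close> makes the
    inclusion strict.\<close>
  have sub: "{w \<in> V. E v w} - {u} \<subset> {w \<in> V. E u w} - {v}"
  proof (rule psubsetI)
    show "{w \<in> V. E v w} - {u} \<subseteq> {w \<in> V. E u w} - {v}"
    proof
      fix q assume q: "q \<in> {w \<in> V. E v w} - {u}"
      then have "E v q" "q \<noteq> u" "q \<noteq> p" "q \<noteq> v"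
        using assms by auto
      then have "E u q"
        using no assms unfolding alt_iff by (metis E_commute)
      then show "q \<in> {w \<in> V. E u w} - {v}"
        using q \<open>q \<noteq> v\<close> by simp
    qed
    show "{w \<in> V. E v w} - {u} \<noteq> {w \<in> V. E u w} - {v}"
      using assms E_verts[OF assms(1)] by auto
  qed
  have "card ({w \<in> V. E v w} - {u}) < card ({w \<in> V. E u w} - {v})"
    by (rule psubset_card_mono[OF _ sub]) (simp add: finite_V)
  moreover have "u \<in> V"
    using E_verts[OF assms(1)] by simp
  ultimately have "deg v < deg u"
    using assms(5) finite_V E_commute[of u v] unfolding degree_def
    by (cases "E u v") (simp_all add: card_Diff_singleton_if)
  then show False
    using assms by simp
qed

text \<open>Were \<open>deg v\<close> larger, \<open>exchange\<close> would produce an alternating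
  4-cycle through \<open>u\<close> and \<open>v\<close>, whose degrees would then agree.\<close>

lemma degree_le:
  assumes "E u p" "\<not> E v p" "p \<noteq> v" "u \<noteq> v" "v \<in> V"
  shows "deg v \<le> deg u"
proof (rule ccontr)
  assume "\<not> deg v \<le> deg u"
  then have "deg u < deg v" by simp
  moreover from this obtain q where "alt u p v q"
    using exchange[OF assms] by auto
  ultimately show False
    using alt_degree by fastforce
qed

text \<open>A second neighbour of \<open>a\<close> not adjacent to \<open>c\<close> would lie off
  the cycle and tell \<open>a\<close> from \<open>c\<close>, against uniformity. This uniqueness is
  the source of the matchings.\<close>

lemma alt_unique:
  assumes "alt a b c d" "E a b'" "\<not> E b' c" "b' \<noteq> c"
  shows "b' = b"
proof (rule ccontr)
  assume "b' \<noteq> b"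
  moreover have "b' \<noteq> d"
    using assms unfolding alt_iff by (metis E_commute)
  ultimately have "E b' a \<longleftrightarrow> E b' c"
    using assms E_verts[of a b'] by (intro uniform[OF assms(1)]) auto
  then show False
    using assms E_commute by blast
qed

section \<open>Induced 5-cycles\<close>

definition C5 :: "'a \<Rightarrow> 'a \<Rightarrow> 'a \<Rightarrow> 'a \<Rightarrow> 'a \<Rightarrow> bool" where
  "C5 s t u v w \<longleftrightarrow> E s t \<and> E t u \<and> E u v \<and> E v w \<and> E w s \<and>
     \<not> E s u \<and> \<not> E t v \<and> \<not> E u w \<and> \<not> E v s \<and> \<not> E w t \<and> distinct [s, t, u, v, w]"

lemma C5_rotate: "C5 s t u v w \<Longrightarrow> C5 t u v w s"
  unfolding C5_def by auto

lemma C5_alt: "C5 s t u v w \<Longrightarrow> alt s t v u"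
  unfolding C5_def alt_iff by (auto simp: E_commute)

lemma C5_verts: "C5 s t u v w \<Longrightarrow> {s, t, u, v, w} \<subseteq> V"
  unfolding C5_def using E_verts by blast

lemma C5_alts:
  assumes "C5 s t u v w"
  shows "alt s t v u" "alt t u w v" "alt u v s w" "alt v w t s" "alt w s u t"
  using assms by (meson C5_alt C5_rotate)+

text \<open>Leaving out one vertex gives five alternating 4-cycles. Each has two diagonals, one an
  edge and one a non-edge of the 5-cycle, and together these are all ten pairs.\<close>

lemma C5_pairs:
  assumes "C5 s t u v w" "x \<in> {s, t, u, v, w}" "y \<in> {s, t, u, v, w}" "x \<noteq> y"
  shows "\<exists>p\<in>{s, t, u, v, w}. \<exists>q\<in>{s, t, u, v, w}. alt x p y q"
proof -
  note a = C5_alts[OF assms(1)]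
  note b = a[THEN alt_flip]
  note c = a[THEN alt_half_turn] b[THEN alt_half_turn]
  show ?thesis
    using assms(2-4) a b c by (elim insertE emptyE) blast+
qed

lemma C5_degree:
  assumes "C5 s t u v w" "x \<in> {s, t, u, v, w}"
  shows "deg x = deg s"
  using C5_pairs[OF assms(1,2), of s] alt_degree assms(2) by blast

lemma C5_uniform:
  assumes "C5 s t u v w" "x \<in> V" "x \<notin> {s, t, u, v, w}" "y \<in> {s, t, u, v, w}"
  shows "E x y \<longleftrightarrow> E x s"
proof (cases "y = s")
  case False
  then obtain p q where "alt y p s q" "p \<in> {s, t, u, v, w}" "q \<in> {s, t, u, v, w}"
    using C5_pairs[OF assms(1,4), of s] by auto
  moreover have "x \<notin> {y, p, s, q}"
    using assms(3,4) calculation(2,3) by auto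
  ultimately show ?thesis
    using uniform assms(2) by blast
qed simp

text \<open>By \<open>C5_uniform\<close> a further vertex \<open>x\<close> of the same degree sees
  all of the cycle or none of it. If all, \<open>u\<close> and \<open>v\<close> are two neighbours
  of \<open>x\<close> that \<open>s\<close> lacks; if none, \<open>t\<close> and \<open>w\<close>
  are two neighbours of \<open>s\<close> that \<open>x\<close> lacks. Either way
  \<open>exchange\<close> gives an alternating 4-cycle that contradicts
  \<open>alt_unique\<close>.\<close>

lemma C5_cls:
  assumes C: "C5 s t u v w"
  shows "cls s = {s, t, u, v, w}"
proof
  show "{s, t, u, v, w} \<subseteq> cls s"
    using C5_verts[OF C] C5_degree[OF C] unfolding cls_def by blast
  show "cls s \<subseteq> {s, t, u, v, w}"
  proof (rule ccontr)
    assume "\<not> cls s \<subseteq> {s, t, u, v, w}"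
    then obtain x where x: "x \<in> V" "deg x = deg s" "x \<notin> {s, t, u, v, w}"
      unfolding cls_def by blast
    have c: "E s t" "E w s" "\<not> E s u" "\<not> E v s" "distinct [s, t, u, v, w]" "s \<in> V"
      using C C5_verts[OF C] unfolding C5_def by auto
    have xs: "x \<noteq> s" "x \<noteq> t" "x \<noteq> u" "x \<noteq> v" "x \<noteq> w"
      using x(3) by auto
    show False
    proof (cases "E x s")
      case True
      then have "E x u" "E x v"
        using C5_uniform[OF C x(1,3), of u] C5_uniform[OF C x(1,3), of v] by simp_all
      then obtain q where "alt x u s q"
        using exchange[of x u s] c xs x(2) by auto
      then have "v = u"
        by (rule alt_unique) (use \<open>E x v\<close> c in auto)
      then show False
        using c by simp
    next
      case False
      then have n: "\<not> E x t" "\<not> E x w"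
        using C5_uniform[OF C x(1,3), of t] C5_uniform[OF C x(1,3), of w] by simp_all
      then obtain q where "alt s t x q"
        using exchange[of s t x] c xs x(1,2) by auto
      then have "w = t"
        by (rule alt_unique) (use n c xs E_commute[of w s] E_commute[of w x] in simp_all)
      then show False
        using c by simp
    qed
  qed
qed

text \<open>If \<open>ac\<close> is an edge, the induced path is \<open>b a c d\<close>, with
  \<open>b\<close> an end and \<open>a\<close> inside. Equal degrees give \<open>b\<close> a
  neighbour \<open>r\<close> that \<open>a\<close> lacks; by uniformity \<open>r\<close> sees just
  the two ends and closes the path to a 5-cycle.\<close>

lemma C5_exists:
  assumes "alt a b c d" "deg a = deg b"
  obtains t u v w where "C5 a t u v w"
proof -
  have *: "\<exists>r. C5 a c d r b" if alt: "alt a b c d" and deg: "deg a = deg b" and ac: "E a c" for a b c d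
  proof -
    have f: "E a b" "\<not> E b c" "E c d" "\<not> E d a" "a \<noteq> c" "b \<noteq> d" "b \<noteq> c" "d \<noteq> a" "\<not> E b d"
      using alt opposite_adj[OF alt] ac unfolding alt_iff by blast+
    have v: "a \<in> V" "b \<in> V" "c \<in> V" "d \<in> V"
      using alt_verts[OF alt] by blast+
    \<comment> \<open>Otherwise every neighbour of \<open>b\<close> except \<open>a\<close> is a
      neighbour of \<open>a\<close> other than \<open>b\<close> and \<open>c\<close>, so that
      \<open>deg b - 1\<close> is at most \<open>deg a - 2\<close>.\<close>
    have "\<exists>r. E b r \<and> r \<noteq> a \<and> \<not> E r a"
    proof (rule ccontr)
      assume "\<nexists>r. E b r \<and> r \<noteq> a \<and> \<not> E r a"
      then have "{r \<in> V. E b r} - {a} \<subseteq> {r \<in> V. E a r} - {b, c}"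
        using f E_commute E_irrefl by (auto simp: E_commute)
      then have "card ({r \<in> V. E b r} - {a}) \<le> card ({r \<in> V. E a r} - {b, c})"
        by (rule card_mono[rotated]) (simp add: finite_V)
      moreover have "card ({r \<in> V. E b r} - {a}) = deg b - 1"
        using f v E_commute[of a b] unfolding degree_def by (subst card_Diff_singleton) auto
      moreover have "card ({r \<in> V. E a r} - {b, c}) = deg a - card {b, c}"
        using f v ac unfolding degree_def by (subst card_Diff_subset) auto
      moreover have "card {b, c} \<le> deg a"
        using f v ac finite_V unfolding degree_def by (intro card_mono) auto
      ultimately show False
        using deg f(7) by simp
    qed
    then obtain r where r: "E b r" "r \<noteq> a" "\<not> E r a"
      by blast
    have rn: "r \<notin> {a, b, c, d}" "r \<in> V"
      using r f E_verts[OF r(1)] by auto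
    have "\<not> E r c"
      using uniform[OF alt rn(2,1)] r by simp
    moreover have "E r d"
      using uniform'[OF alt rn(2,1)] r E_commute by simp
    ultimately have "C5 a c d r b"
      unfolding C5_def using f ac r rn E_commute by auto
    then show ?thesis ..
  qed
  show ?thesis
  proof (cases "E a c")
    case True
    then show ?thesis
      using *[OF assms] that by blast
  next
    case False
    then have "E b d"
      using opposite_adj[OF assms(1)] by simp
    \<comment> \<open>In the reflected cycle \<open>b a d c\<close> the edge \<open>bd\<close> is
      the diagonal at the starting vertex.\<close>
    then obtain r where "C5 b d c r a"
      using *[OF alt_flip[OF assms(1)] assms(2)[symmetric]] by blast
    then have "C5 a b d c r"
      by (meson C5_rotate)
    then show ?thesis
      using that by blast
  qed
qed

section \<open>Degree classes and the partners of a class\<close>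

text \<open>Any other vertex of the class of \<open>a\<close> can take the place of \<open>c\<close>
  without changing the degree of the partners. This spreads the information of one alternating
  4-cycle over its whole block.\<close>

lemma alt_same_degree:
  assumes alt: "alt a b c d" and a': "a' \<in> V" "a' \<noteq> a" "deg a' = deg a"
  shows "\<exists>b' d'. alt a b' a' d' \<and> deg b' = deg b"
proof (cases "deg a = deg b")
  case True
  then obtain t u v w where C: "C5 a t u v w"
    using C5_exists[OF alt] by blast
  then have "a' \<in> {a, t, u, v, w}"
    using C5_cls[OF C] a' unfolding cls_def by blast
  then obtain p q where "p \<in> {a, t, u, v, w}" "alt a p a' q"
    using C5_pairs[OF C, of a a'] a' by auto
  then show ?thesis
    using C5_degree[OF C] True by metis
next
  case False
  show ?thesis
  proof (cases "a' = c")
    case True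
    then show ?thesis using alt by blast
  next
    case neq: False
    have "a' \<notin> {a, b, c, d}"
      using neq a' False alt_degree[OF alt] by auto
    then have u: "E a' b \<longleftrightarrow> E a' d"
      using uniform'[OF alt a'(1)] by simp
    have f: "E a b" "\<not> E d a" "a \<in> V" "a' \<noteq> b" "a' \<noteq> d" "d \<noteq> a"
      using alt alt_verts[OF alt] False a' alt_degree[OF alt] unfolding alt_iff by auto
    \<comment> \<open>If \<open>a'\<close> sees both \<open>b\<close> and \<open>d\<close>, then
      \<open>d\<close> is a neighbour that \<open>a\<close> lacks; if it sees neither,
      \<open>b\<close> is a neighbour of \<open>a\<close> that \<open>a'\<close> lacks.
      \<open>exchange\<close> completes either pair.\<close>
    show ?thesis
    proof (cases "E a' b")
      case True
      then obtain q where "alt a' d a q"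
        using exchange[of a' d a] u f a' E_commute by auto
      then have "alt a q a' d"
        by (rule alt_half_turn)
      then show ?thesis
        using alt_degree[OF alt] alt_degree[of a q a' d] by auto
    next
      case False
      then obtain q where "alt a b a' q"
        using exchange[of a b a'] f a' E_commute by auto
      then show ?thesis by blast
    qed
  qed
qed

lemma partner_degree_same:
  assumes "alt a b c d" "alt a b' c' d'"
  shows "deg b = deg b'"
proof -
  have "c' \<in> V" "c' \<noteq> a" "deg c' = deg a"
    using assms(2) alt_verts[OF assms(2)] alt_degree[OF assms(2)] unfolding alt_iff by auto
  then obtain b'' d'' where b: "alt a b'' c' d''" "deg b'' = deg b"
    using alt_same_degree[OF assms(1)] by blast
  have "b' = b''"
    using alt_unique[OF b(1), of b'] assms(2) unfolding alt_iff by blast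
  then show ?thesis
    using b by simp
qed

text \<open>Thus the class of \<open>a\<close> determines the class of \<open>b\<close>, which is
  what keeps blocks from overlapping. \<open>alt_same_degree\<close> first moves both cycles to a
  common pair, where \<open>alt_unique\<close> identifies the partners.\<close>

lemma partner_degree:
  assumes "alt a b c d" "alt a' b' c' d'" "deg a = deg a'"
  shows "deg b = deg b'"
proof (cases "a = a'")
  case True
  then show ?thesis
    using partner_degree_same assms by blast
next
  case False
  moreover have "a' \<in> V"
    using alt_verts[OF assms(2)] by blast
  ultimately obtain b'' d'' where b: "alt a b'' a' d''" "deg b'' = deg b"
    using alt_same_degree[OF assms(1)] assms(3) by metis
  then have "deg d'' = deg b'"
    using partner_degree_same[OF alt_half_turn[OF b(1)] assms(2)] by simp
  then show ?thesis
    using b alt_degree[OF b(1)] by simp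
qed

lemma row_unique:
  assumes alt: "alt a b c d" and "deg a \<noteq> deg b" and x: "x \<in> cls a" "x' \<in> cls a" "x \<noteq> x'"
  shows "\<exists>!y. y \<in> cls b \<and> E x y \<and> \<not> E x' y"
proof -
  have dx: "x \<in> V" "x' \<in> V" "deg x = deg a" "deg x' = deg a"
    using x unfolding cls_def by auto
  obtain b1 c1 d1 where 1: "alt x b1 c1 d1" "deg b1 = deg b"
  proof (cases "x = a")
    case True
    then show ?thesis using alt that by blast
  next
    case False
    then obtain b' d' where "alt a b' x d'" "deg b' = deg b"
      using alt_same_degree[OF alt dx(1)] dx by blast
    then show ?thesis
      using that[of d' a b'] alt_half_turn[of a b' x d'] alt_degree[of a b' x d'] by simp
  qed
  obtain y z where y: "alt x y x' z" "deg y = deg b"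
    using alt_same_degree[OF 1(1) dx(2)] x(3) dx 1(2) by auto
  show ?thesis
  proof (rule ex1I[of _ y])
    show "y \<in> cls b \<and> E x y \<and> \<not> E x' y"
      using y alt_verts[OF y(1)] E_commute unfolding cls_def alt_iff by auto
    fix y' assume y': "y' \<in> cls b \<and> E x y' \<and> \<not> E x' y'"
    then have "y' \<noteq> x'"
      using dx assms(2) unfolding cls_def by auto
    then show "y' = y"
      using y' E_commute by (intro alt_unique[OF y(1)]) auto
  qed
qed

end

section \<open>Incidence relations in which any two rows differ in one place each way\<close>

text \<open>Two columns differ by trading one element for another, so all have equally many. If the
  column of \<open>b\<close> has just one, every column has just one.\<close>

lemma matching_if_unique_neighbour:
  assumes row: "\<And>x x'. x \<in> X \<Longrightarrow> x' \<in> X \<Longrightarrow> x \<noteq> x' \<Longrightarrow> \<exists>!y. y \<in> Y \<and> B x y \<and> \<not> B x' y"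
    and col: "\<And>y y'. y \<in> Y \<Longrightarrow> y' \<in> Y \<Longrightarrow> y \<noteq> y' \<Longrightarrow> \<exists>!x. x \<in> X \<and> B x y \<and> \<not> B x y'"
    and b: "b \<in> Y" "a \<in> X" "B a b" "\<And>x. x \<in> X \<Longrightarrow> B x b \<Longrightarrow> x = a"
    and c: "c \<in> X" "c \<noteq> a"
  shows "(\<forall>y\<in>Y. \<exists>!x. x \<in> X \<and> B x y) \<and> (\<forall>x\<in>X. \<exists>!y. y \<in> Y \<and> B x y)"
proof -
  have Y: "\<exists>!x. x \<in> X \<and> B x y" if y: "y \<in> Y" for y
  proof (cases "y = b")
    case True
    then show ?thesis using b by blast
  next
    case False
    obtain x where x: "x \<in> X" "B x y" "\<not> B x b"
      using col[OF y b(1) False] by blast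
    \<comment> \<open>The element that \<open>b\<close> has and \<open>y\<close> lacks can only be
      \<open>a\<close>, so the columns of \<open>b\<close> and \<open>y\<close> are
      disjoint.\<close>
    have "\<not> B a y"
      using col[OF b(1) y] False b by blast
    then have "\<not> B z b" if "z \<in> X" "B z y" for z
      using b(4) that by blast
    then have "z = x" if "z \<in> X" "B z y" for z
      using col[OF y b(1) False] x that by blast
    then show ?thesis
      using x by blast
  qed
  moreover have "\<exists>!y. y \<in> Y \<and> B x y" if x: "x \<in> X" for x
  proof -
    \<comment> \<open>A second row is needed for comparison, since only a difference of rows
      provides a neighbour; \<open>c\<close> ensures that there is one.\<close>
    obtain x' where "x' \<in> X" "x' \<noteq> x"
      using b(2) c by metis
    then obtain y where y: "y \<in> Y" "B x y"
      using row[OF x] by blast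
    have "z = y" if z: "z \<in> Y" "B x z" for z
    proof (rule ccontr)
      assume "z \<noteq> y"
      then obtain u where "u \<in> X" "B u z" "\<not> B u y"
        using col[OF z(1) y(1)] by blast
      then show False
        using Y[OF z(1)] x z y by blast
    qed
    then show ?thesis
      using y by blast
  qed
  ultimately show ?thesis by blast
qed

text \<open>Take \<open>b\<close> in row \<open>a\<close> but not in row \<open>c\<close>. If
  \<open>a\<close> is the only neighbour of \<open>b\<close>, the relation is a matching; otherwise
  \<open>c\<close> turns out to be the only non-neighbour of \<open>b\<close>, and the preceding
  lemma applies to the complement with \<open>a\<close> and \<open>c\<close> interchanged.\<close>

lemma matching_or_comatching:
  assumes row: "\<And>x x'. x \<in> X \<Longrightarrow> x' \<in> X \<Longrightarrow> x \<noteq> x' \<Longrightarrow> \<exists>!y. y \<in> Y \<and> B x y \<and> \<not> B x' y"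
    and col: "\<And>y y'. y \<in> Y \<Longrightarrow> y' \<in> Y \<Longrightarrow> y \<noteq> y' \<Longrightarrow> \<exists>!x. x \<in> X \<and> B x y \<and> \<not> B x y'"
    and ac: "a \<in> X" "c \<in> X" "a \<noteq> c"
  shows "(\<forall>y\<in>Y. \<exists>!x. x \<in> X \<and> B x y) \<and> (\<forall>x\<in>X. \<exists>!y. y \<in> Y \<and> B x y) \<or>
    (\<forall>y\<in>Y. \<exists>!x. x \<in> X \<and> \<not> B x y) \<and> (\<forall>x\<in>X. \<exists>!y. y \<in> Y \<and> \<not> B x y)"
proof -
  obtain b where b: "b \<in> Y" "B a b" "\<not> B c b"
    using row[OF ac] by blast
  obtain d where d: "d \<in> Y" "B c d" "\<not> B a d"
    using row[OF ac(2,1)] ac(3) by blast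
  have bd: "b \<noteq> d"
    using b d by blast
  show ?thesis
  proof (cases "\<forall>x\<in>X. B x b \<longrightarrow> x = a")
    case True
    then have "(\<forall>y\<in>Y. \<exists>!x. x \<in> X \<and> B x y) \<and> (\<forall>x\<in>X. \<exists>!y. y \<in> Y \<and> B x y)"
      using matching_if_unique_neighbour[where B = B and X = X and Y = Y, OF row col b(1) ac(1) b(2) _ ac(2)] ac(3)
      by blast
    then show ?thesis ..
  next
    case False
    then obtain x where x: "x \<in> X" "B x b" "x \<noteq> a"
      by blast
    \<comment> \<open>Only \<open>a\<close> lies in column \<open>b\<close> and not in column
      \<open>d\<close>.\<close>
    have xd: "B x d"
      using col[OF b(1) d(1) bd] x ac b d by blast
    \<comment> \<open>Another non-neighbour \<open>z\<close> of \<open>b\<close> would miss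
      \<open>d\<close> as well, so that row \<open>x\<close> would exceed row \<open>z\<close> in
      both \<open>b\<close> and \<open>d\<close>.\<close>
    have zc: "z = c" if z: "z \<in> X" "\<not> B z b" for z
    proof (rule ccontr)
      assume "z \<noteq> c"
      then have "\<not> B z d"
        using col[OF d(1) b(1)] bd z ac b d by blast
      moreover have "x \<noteq> z"
        using x z by blast
      ultimately show False
        using row[OF x(1) z(1)] x xd z b d bd by blast
    qed
    have r: "\<exists>!y. y \<in> Y \<and> \<not> B u y \<and> \<not> \<not> B u' y" if "u \<in> X" "u' \<in> X" "u \<noteq> u'" for u u'
      using row[OF that(2,1) that(3)[symmetric]] unfolding not_not by (simp only: conj_commute)
    have l: "\<exists>!u. u \<in> X \<and> \<not> B u y \<and> \<not> \<not> B u y'" if "y \<in> Y" "y' \<in> Y" "y \<noteq> y'" for y y'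
      using col[OF that(2,1) that(3)[symmetric]] unfolding not_not by (simp only: conj_commute)
    have "(\<forall>y\<in>Y. \<exists>!x. x \<in> X \<and> \<not> B x y) \<and> (\<forall>x\<in>X. \<exists>!y. y \<in> Y \<and> \<not> B x y)"
      by (rule matching_if_unique_neighbour[of X Y "\<lambda>x y. \<not> B x y" b c a,
            OF r l b(1) ac(2) b(3) zc ac(1,3)])
    then show ?thesis ..
  qed
qed

section \<open>The realization graph of a uniform graph\<close>

lemma cross_commute: "cross X Y = cross Y X"
  unfolding cross_def by (metis insert_commute)

lemma edeg_cross:
  assumes "X \<inter> Y = {}" "v \<in> X"
  shows "edeg (A \<inter> cross X Y) v = card {y \<in> Y. {v, y} \<in> A}"
proof -
  have "{e \<in> A \<inter> cross X Y. v \<in> e} = (\<lambda>y. {v, y}) ` {y \<in> Y. {v, y} \<in> A}"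
  proof (intro equalityI subsetI)
    fix e assume e: "e \<in> {e \<in> A \<inter> cross X Y. v \<in> e}"
    then obtain x y where "e = {x, y}" "x \<in> X" "y \<in> Y"
      unfolding cross_def by blast
    moreover from this have "v = x"
      using e assms by auto
    ultimately show "e \<in> (\<lambda>y. {v, y}) ` {y \<in> Y. {v, y} \<in> A}"
      using e by auto
  next
    fix e assume "e \<in> (\<lambda>y. {v, y}) ` {y \<in> Y. {v, y} \<in> A}"
    then obtain y where y: "e = {v, y}" "y \<in> Y" "{v, y} \<in> A"
      by blast
    moreover have "v \<noteq> y"
      using y assms by auto
    ultimately show "e \<in> {e \<in> A \<inter> cross X Y. v \<in> e}"
      using assms(2) unfolding cross_def by blast
  qed
  moreover have "inj_on (\<lambda>y. {v, y}) {y \<in> Y. {v, y} \<in> A}"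
    by (auto simp: inj_on_def doubleton_eq_iff)
  ultimately show ?thesis
    unfolding edeg_def by (simp add: card_image)
qed

lemma edeg_nsets_2:
  assumes "v \<in> X"
  shows "edeg (A \<inter> [X]\<^bsup>2\<^esup>) v = card {y \<in> X. y \<noteq> v \<and> {v, y} \<in> A}"
proof -
  have "{e \<in> A \<inter> [X]\<^bsup>2\<^esup>. v \<in> e} = (\<lambda>y. {v, y}) ` {y \<in> X. y \<noteq> v \<and> {v, y} \<in> A}"
  proof (intro equalityI subsetI)
    fix e assume e: "e \<in> {e \<in> A \<inter> [X]\<^bsup>2\<^esup>. v \<in> e}"
    then obtain x y where "e = {x, y}" "x \<in> X" "y \<in> X" "x \<noteq> y"
      by (auto elim: nsets2_E)
    then show "e \<in> (\<lambda>y. {v, y}) ` {y \<in> X. y \<noteq> v \<and> {v, y} \<in> A}"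
      using e by (auto simp: insert_commute)
  qed (use assms in auto)
  moreover have "inj_on (\<lambda>y. {v, y}) {y \<in> X. y \<noteq> v \<and> {v, y} \<in> A}"
    by (auto simp: inj_on_def doubleton_eq_iff)
  ultimately show ?thesis
    unfolding edeg_def by (simp add: card_image)
qed

lemma card_Collect_ex1:
  assumes "\<exists>!y. y \<in> Y \<and> P y"
  shows "card {y \<in> Y. P y} = 1"
proof -
  obtain y where "{y \<in> Y. P y} = {y}"
    using assms by blast
  then show ?thesis by simp
qed

text \<open>By symmetry \<open>a\<close> belongs to \<open>R b\<close> for exactly
  \<open>card (R a)\<close> choices of \<open>b\<close>. Integer values allow differences to be
  summed later.\<close>

lemma sum_symmetric_relation:
  fixes f :: "'a \<Rightarrow> int"
  assumes "finite V" "\<And>b. R b \<subseteq> V" "\<And>a b. a \<in> R b \<longleftrightarrow> b \<in> R a"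
  shows "(\<Sum>b\<in>V. \<Sum>a\<in>R b. f a) = (\<Sum>a\<in>V. int (card (R a)) * f a)"
proof -
  have 1: "{a \<in> V. a \<in> R b} = R b" "{a \<in> V. b \<in> R a} = R b" for b
    using assms(2,3) by blast+
  have "(\<Sum>b\<in>V. \<Sum>a\<in>{a \<in> V. a \<in> R b}. f a) = (\<Sum>a\<in>V. \<Sum>b\<in>{b \<in> V. a \<in> R b}. f a)"
    by (rule sum.swap_restrict[OF assms(1,1)])
  then show ?thesis
    unfolding 1 sum_constant .
qed

text \<open>Both double sums below count every vertex with the same multiplicity, so the inequality between
  the neighbours along the two relations must be an equality everywhere.\<close>

lemma balanced_relations_eq:
  fixes f :: "'a \<Rightarrow> int"
  assumes V: "finite V"
    and R: "\<And>b. R b \<subseteq> V" "\<And>a b. a \<in> R b \<longleftrightarrow> b \<in> R a"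
    and B: "\<And>b. B b \<subseteq> V" "\<And>a b. a \<in> B b \<longleftrightarrow> b \<in> B a"
    and card: "\<And>b. card (R b) = card (B b)"
    and le: "\<And>a b c. a \<in> R b \<Longrightarrow> c \<in> B b \<Longrightarrow> f c \<le> f a"
    and ac: "a \<in> R b" "c \<in> B b"
  shows "f a = f c"
proof -
  have fin: "finite (R b)" "finite (B b)" for b
    using finite_subset[OF R(1) V] finite_subset[OF B(1) V] .
  have dbl: "(\<Sum>a\<in>R b. \<Sum>c\<in>B b. f a - f c) = int (card (R b)) * (sum f (R b) - sum f (B b))" for b
    using card[of b] by (simp add: sum_subtractf algebra_simps flip: sum_distrib_left sum_distrib_right)
  have nonneg: "0 \<le> (\<Sum>a\<in>R b. \<Sum>c\<in>B b. f a - f c)" for b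
    using le by (intro sum_nonneg) simp
  \<comment> \<open>The factor \<open>card (R b)\<close> can be cancelled unless it is 0, in which
    case both sets are empty.\<close>
  have le': "sum f (B b) \<le> sum f (R b)" for b
  proof (cases "card (R b) = 0")
    case True
    then have "R b = {}" "B b = {}"
      using card[of b] fin[of b] by simp_all
    then show ?thesis by simp
  next
    case False
    then show ?thesis
      using nonneg[of b] unfolding dbl by (simp add: zero_le_mult_iff)
  qed
  have "(\<Sum>b\<in>V. sum f (B b)) = (\<Sum>b\<in>V. sum f (R b))"
    using sum_symmetric_relation[OF V B, of f] sum_symmetric_relation[OF V R, of f] card by simp
  moreover have "b \<in> V"
    using ac(1) R by blast
  ultimately have "sum f (B b) = sum f (R b)"
    using le' V by (intro sum_mono_inv[of "\<lambda>b. sum f (B b)" V "\<lambda>b. sum f (R b)"]) auto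
  then have "(\<Sum>a\<in>R b. \<Sum>c\<in>B b. f a - f c) = 0"
    unfolding dbl by simp
  moreover have "0 \<le> (\<Sum>c\<in>B b. f a' - f c)" if "a' \<in> R b" for a'
    using le that by (intro sum_nonneg) simp
  ultimately have "(\<Sum>c\<in>B b. f a - f c) = 0"
    using sum_nonneg_eq_0_iff[of "R b" "\<lambda>a. \<Sum>c\<in>B b. f a - f c"] fin ac by simp
  moreover have "0 \<le> f a - f c'" if "c' \<in> B b" for c'
    using le[OF ac(1) that] by simp
  ultimately have "f a - f c = 0"
    using sum_nonneg_eq_0_iff[of "B b" "\<lambda>c. f a - f c"] fin ac by simp
  then show ?thesis by simp
qed

lemma switch_graph_Union_iso_product:
  assumes V: "finite V" and "finite \<U>"
    and "\<And>U. U \<in> \<U> \<Longrightarrow> U \<subseteq> [V]\<^bsup>2\<^esup>"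
    and "\<And>U W. U \<in> \<U> \<Longrightarrow> W \<in> \<U> \<Longrightarrow> U \<noteq> W \<Longrightarrow> \<Union>U \<inter> \<Union>W = {}"
    and "\<And>U. U \<in> \<U> \<Longrightarrow> \<exists>k\<ge>1. transposition_graph k \<simeq>\<^sub>g switch_graph (same_degrees U F)"
  shows "\<exists>ks. (\<forall>k\<in>set ks. k \<ge> 1) \<and>
    switch_graph (same_degrees (\<Union>\<U>) F) \<simeq>\<^sub>g cartesian_product_list (map transposition_graph ks)"
  using assms(2-)
proof (induction \<U> rule: finite_induct)
  case empty
  have "edeg {} v = 0" for v :: 'a
    by (simp add: edeg_def)
  then have "same_degrees {} F = {{}}"
    unfolding same_degrees_def by auto
  moreover have "verts (cartesian_product_list []) = {[]}"
    by (auto simp: verts_cartesian_product_list)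
  ultimately have "switch_graph (same_degrees {} F) \<simeq>\<^sub>g cartesian_product_list (map transposition_graph [])"
    by (intro graph_isoI[of "\<lambda>_. []"])
      (auto simp: adj_switch_graph adj_cartesian_product_list bij_betw_def)
  then show ?case
    by (intro exI[of _ "[]"]) simp
next
  case (insert U \<U>)
  have "\<exists>ks. (\<forall>k\<in>set ks. k \<ge> 1) \<and>
    switch_graph (same_degrees (\<Union>\<U>) F) \<simeq>\<^sub>g cartesian_product_list (map transposition_graph ks)"
    using insert.prems by (intro insert.IH) simp_all
  then obtain ks where ks: "\<forall>k\<in>set ks. k \<ge> 1"
    "switch_graph (same_degrees (\<Union>\<U>) F) \<simeq>\<^sub>g cartesian_product_list (map transposition_graph ks)"
    by blast
  obtain k where k: "k \<ge> 1" "transposition_graph k \<simeq>\<^sub>g switch_graph (same_degrees U F)"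
    using insert.prems(3)[of U] by auto
  have "\<Union>U \<inter> \<Union>W = {}" if "W \<in> \<U>" for W
    using insert.prems(2)[of U W] insert.hyps(2) that by auto
  then have dis: "\<Union>U \<inter> \<Union>(\<Union>\<U>) = {}"
    by blast
  have sub: "U \<subseteq> [V]\<^bsup>2\<^esup>" "\<Union>\<U> \<subseteq> [V]\<^bsup>2\<^esup>"
    using insert.prems(1) by (simp, blast)
  have "switch_graph (same_degrees (U \<union> \<Union>\<U>) F) \<simeq>\<^sub>g
      switch_graph (same_degrees U F) \<box>\<^sub>g switch_graph (same_degrees (\<Union>\<U>) F)"
    using switch_graph_same_degrees_Un[OF V sub dis] by (rule graph_iso_sym)
  also have "\<dots> \<simeq>\<^sub>g transposition_graph k \<box>\<^sub>g cartesian_product_list (map transposition_graph ks)"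
    using graph_iso_sym[OF k(2)] ks(2) by (rule cartesian_product_cong)
  also have "\<dots> \<simeq>\<^sub>g cartesian_product_list (transposition_graph k # map transposition_graph ks)"
    by (rule cartesian_product_list_Cons)
  finally show ?case
    using k(1) ks(1) by (intro exI[of _ "k # ks"]) simp
qed

section \<open>Blocks of a uniform graph\<close>

context uniform_graph
begin

lemma cls_finite: "finite (cls a)" "cls a \<subseteq> V"
  using finite_V unfolding cls_def by auto

lemma block_subset: "cross (cls a) (cls b) \<subseteq> [V]\<^bsup>2\<^esup>"
  unfolding cross_def cls_def by auto

lemma block_transposition_graph:
  assumes alt: "alt a b c d" and deg: "deg a \<noteq> deg b"
  shows "\<exists>k\<ge>1. transposition_graph k \<simeq>\<^sub>g switch_graph (same_degrees (cross (cls a) (cls b)) (edges G))"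
proof -
  let ?X = "cls a" and ?Y = "cls b" and ?U = "cross (cls a) (cls b)"
  have XY: "?X \<inter> ?Y = {}" "?Y \<inter> ?X = {}"
    using deg unfolding cls_def by auto
  have ac: "a \<in> ?X" "c \<in> ?X" "a \<noteq> c"
    using alt alt_verts[OF alt] alt_degree[OF alt] unfolding cls_def alt_iff by auto
  have finU: "finite ?U"
    using finite_edge_set[OF finite_V block_subset] .
  have k: "card ?X \<ge> 1"
    using ac(1) cls_finite(1) by (simp add: Suc_le_eq card_gt_0_iff) blast
  have row: "\<exists>!y. y \<in> ?Y \<and> E x y \<and> \<not> E x' y" if "x \<in> ?X" "x' \<in> ?X" "x \<noteq> x'" for x x'
    using row_unique[OF alt deg that] .
  have col: "\<exists>!x. x \<in> ?X \<and> E x y \<and> \<not> E x y'" if "y \<in> ?Y" "y' \<in> ?Y" "y \<noteq> y'" for y y'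
    using row_unique[OF alt_flip[OF alt] deg[symmetric] that]
    unfolding E_commute[of y] E_commute[of y'] .
  have "(\<forall>y\<in>?Y. \<exists>!x. x \<in> ?X \<and> E x y) \<and> (\<forall>x\<in>?X. \<exists>!y. y \<in> ?Y \<and> E x y) \<or>
    (\<forall>y\<in>?Y. \<exists>!x. x \<in> ?X \<and> \<not> E x y) \<and> (\<forall>x\<in>?X. \<exists>!y. y \<in> ?Y \<and> \<not> E x y)"
    by (rule matching_or_comatching[of ?X ?Y E, OF row col ac])
  then show ?thesis
  proof (elim disjE conjE)
    assume matching: "\<forall>y\<in>?Y. \<exists>!x. x \<in> ?X \<and> E x y" "\<forall>x\<in>?X. \<exists>!y. y \<in> ?Y \<and> E x y"
    have "edeg (edges G \<inter> ?U) v = 1" if "v \<in> ?X \<union> ?Y" for v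
    proof (cases "v \<in> ?X")
      case True
      then show ?thesis
        using edeg_cross[OF XY(1) True, of "edges G"] matching(2)
          card_Collect_ex1[of ?Y "\<lambda>y. E v y"] by (simp add: adj_def)
    next
      case False
      then have v: "v \<in> ?Y" using that by simp
      then have "card {x \<in> ?X. E x v} = 1"
        using matching(1) card_Collect_ex1[of ?X "\<lambda>x. E x v"] by simp
      moreover have "{x \<in> ?X. {v, x} \<in> edges G} = {x \<in> ?X. E x v}"
        unfolding E_commute[of _ v] by (simp add: adj_def)
      ultimately show ?thesis
        using edeg_cross[OF XY(2) v, of "edges G"] by (simp add: cross_commute[of ?Y])
    qed
    then show ?thesis
      using switch_graph_matchings[OF cls_finite(1) XY(1)] k by blast
  next
    assume comatching: "\<forall>y\<in>?Y. \<exists>!x. x \<in> ?X \<and> \<not> E x y" "\<forall>x\<in>?X. \<exists>!y. y \<in> ?Y \<and> \<not> E x y"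
    \<comment> \<open>In this case the perfect matching consists of the non-edges of the
      block.\<close>
    have mem: "{x, y} \<in> ?U - edges G \<longleftrightarrow> \<not> E x y" "{y, x} \<in> ?U - edges G \<longleftrightarrow> \<not> E x y"
      if "x \<in> ?X" "y \<in> ?Y" for x y
    proof -
      have "x \<noteq> y"
        using that XY by auto
      then have "{x, y} \<in> ?U"
        using that unfolding cross_def by blast
      then show "{x, y} \<in> ?U - edges G \<longleftrightarrow> \<not> E x y" "{y, x} \<in> ?U - edges G \<longleftrightarrow> \<not> E x y"
        unfolding adj_def by (simp_all add: insert_commute)
    qed
    have "edeg ((?U - edges G) \<inter> ?U) v = 1" if "v \<in> ?X \<union> ?Y" for v
    proof (cases "v \<in> ?X")
      case True
      then have "{y \<in> ?Y. {v, y} \<in> ?U - edges G} = {y \<in> ?Y. \<not> E v y}"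
        using mem by blast
      then show ?thesis
        using edeg_cross[OF XY(1) True, of "?U - edges G"] comatching(2) True
          card_Collect_ex1[of ?Y "\<lambda>y. \<not> E v y"] by simp
    next
      case False
      then have v: "v \<in> ?Y" using that by simp
      then have "{x \<in> ?X. {v, x} \<in> ?U - edges G} = {x \<in> ?X. \<not> E x v}"
        using mem by blast
      then show ?thesis
        using edeg_cross[OF XY(2) v, of "?U - edges G"] comatching(1) v
          card_Collect_ex1[of ?X "\<lambda>x. \<not> E x v"] by (simp add: cross_commute[of ?Y])
    qed
    then have "transposition_graph (card ?X) \<simeq>\<^sub>g switch_graph (same_degrees ?U (?U - edges G))"
      by (rule switch_graph_matchings[OF cls_finite(1) XY(1)])
    also have "\<dots> \<simeq>\<^sub>g switch_graph (same_degrees ?U (edges G))"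
      using switch_graph_same_degrees_complement[OF finU] by (rule graph_iso_sym)
    finally show ?thesis
      using k by blast
  qed
qed

lemma C5_rotate_to:
  assumes "C5 s t u v w" "x \<in> {s, t, u, v, w}"
  obtains t' u' v' w' where "C5 x t' u' v' w'"
proof -
  note r1 = C5_rotate[OF assms(1)]
  note r2 = C5_rotate[OF r1]
  note r3 = C5_rotate[OF r2]
  note r4 = C5_rotate[OF r3]
  show ?thesis
    using assms(2) that[of t u v w] that[of u v w s] that[of v w s t] that[of w s t u] that[of s t u v]
      assms(1) r1 r2 r3 r4 by auto
qed

text \<open>Both classes coincide with the vertex set of one 5-cycle, so the block consists of its
  ten pairs.\<close>

lemma block_pentagon:
  assumes alt: "alt a b c d" and deg: "deg a = deg b"
  shows "K66_minus_6K2 \<simeq>\<^sub>g switch_graph (same_degrees (cross (cls a) (cls b)) (edges G))"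
proof -
  obtain t u v w where C: "C5 a t u v w"
    using C5_exists[OF alt deg] .
  have X: "cls a = {a, t, u, v, w}" "cls b = cls a"
    using C5_cls[OF C] deg unfolding cls_def by auto
  have dist: "distinct [a, t, u, v, w]"
    using C unfolding C5_def by blast
  have "card (cls a) = 5"
    unfolding X using dist by simp
  moreover have "edeg (edges G \<inter> [cls a]\<^bsup>2\<^esup>) x = 2" if x: "x \<in> cls a" for x
  proof -
    have two: "card {y \<in> {s, t, u, v, w}. y \<noteq> s \<and> {s, y} \<in> edges G} = 2" if "C5 s t u v w" for s t u v w
    proof -
      have "{y \<in> {s, t, u, v, w}. y \<noteq> s \<and> {s, y} \<in> edges G} = {t, w}"
        using that unfolding C5_def adj_def by (auto simp: insert_commute)
      moreover have "t \<noteq> w"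
        using that unfolding C5_def by auto
      ultimately show ?thesis by simp
    qed
    obtain t' u' v' w' where C': "C5 x t' u' v' w'"
      using C5_rotate_to[OF C, of x] x unfolding X(1) by blast
    have "cls a = cls x"
      using x unfolding cls_def by simp
    then have "cls a = {x, t', u', v', w'}"
      using C5_cls[OF C'] by simp
    then show ?thesis
      using edeg_nsets_2[OF x, of "edges G"] two[OF C'] by simp
  qed
  ultimately show ?thesis
    using switch_graph_pentagons[of "cls a" "edges G"] unfolding X(2) cross_self by blast
qed

text \<open>Two 5-cycles of different degree would be disjoint and joined completely or not at all.
  In the first case a non-adjacent pair from each induces a 4-cycle, in the second an edge from each
  induces two disjoint edges; \<open>opposite_adj\<close> forbids both.\<close>

lemma C5_degree_unique:
  assumes C: "C5 s t u v w" and C': "C5 s' t' u' v' w'"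
  shows "deg s = deg s'"
proof (rule ccontr)
  assume neq: "deg s \<noteq> deg s'"
  have "cls s \<inter> cls s' = {}"
    using neq unfolding cls_def by auto
  then have dis: "{s, t, u, v, w} \<inter> {s', t', u', v', w'} = {}"
    using C5_cls[OF C] C5_cls[OF C'] by simp
  have const: "E y x \<longleftrightarrow> E s s'" if y: "y \<in> {s, t, u, v, w}" and x: "x \<in> {s', t', u', v', w'}" for y x
  proof -
    have "x \<notin> {s, t, u, v, w}" "s \<notin> {s', t', u', v', w'}" "x \<in> V" "s \<in> V"
      using dis x C5_verts[OF C] C5_verts[OF C'] by blast+
    then show ?thesis
      using C5_uniform[OF C, of x y] C5_uniform[OF C', of s x] x y E_commute by metis
  qed
  have cs: "E s t" "\<not> E s u" "s \<noteq> u" "E s' t'" "\<not> E s' u'" "s' \<noteq> u'" "s \<noteq> t" "s' \<noteq> t'"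
    using C C' unfolding C5_def by auto
  have ne: "s \<noteq> s'" "s \<noteq> u'" "u \<noteq> s'" "u \<noteq> u'" "t \<noteq> s'" "t \<noteq> t'" "s \<noteq> t'"
    using dis by auto
  show False
  proof (cases "E s s'")
    case True
    then have "E s u'" "E u s'" "E u u'"
      using const[of s u'] const[of u s'] const[of u u'] by simp_all
    moreover from this have "alt s s' u' u"
      using True cs ne E_commute unfolding alt_iff by auto
    ultimately show False
      using opposite_adj E_commute by blast
  next
    case False
    then have "\<not> E t s'" "\<not> E s t'" "\<not> E t t'"
      using const[of t s'] const[of s t'] const[of t t'] by simp_all
    moreover from this have "alt s t s' t'"
      using False cs ne E_commute unfolding alt_iff by auto
    ultimately show False
      using opposite_adj False by blast
  qed
qed

definition blocks :: "'a set set set" where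
  "blocks = {cross (cls a) (cls b) | a b c d. alt a b c d}"

lemma finite_blocks: "finite blocks"
proof (rule finite_subset)
  show "blocks \<subseteq> Pow ([V]\<^bsup>2\<^esup>)"
    unfolding blocks_def using block_subset by blast
  show "finite (Pow ([V]\<^bsup>2\<^esup>))"
    using finite_V finite_imp_finite_nsets by simp
qed

text \<open>After reflecting the cycles, a common vertex lies in the first class of both blocks;
  \<open>partner_degree\<close> then makes the second classes equal too.\<close>

lemma blocks_disjoint:
  assumes "U \<in> blocks" "W \<in> blocks" "U \<noteq> W"
  shows "\<Union>U \<inter> \<Union>W = {}"
proof (rule ccontr)
  assume "\<Union>U \<inter> \<Union>W \<noteq> {}"
  then obtain x where x: "x \<in> \<Union>U" "x \<in> \<Union>W" by blast
  have norm: "\<exists>a b c d. alt a b c d \<and> U = cross (cls a) (cls b) \<and> x \<in> cls a" if U: "U \<in> blocks" "x \<in> \<Union>U" for U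
  proof -
    obtain a b c d where a: "alt a b c d" "U = cross (cls a) (cls b)"
      using U(1) unfolding blocks_def by blast
    then have "x \<in> cls a \<or> x \<in> cls b"
      using U(2) unfolding cross_def by blast
    then show ?thesis
      using a alt_flip[OF a(1)] cross_commute[of "cls a" "cls b"] by blast
  qed
  obtain a b c d where a: "alt a b c d" "U = cross (cls a) (cls b)" "x \<in> cls a"
    using norm[OF assms(1) x(1)] by blast
  obtain a' b' c' d' where a': "alt a' b' c' d'" "W = cross (cls a') (cls b')" "x \<in> cls a'"
    using norm[OF assms(2) x(2)] by blast
  have "deg a = deg a'"
    using a(3) a'(3) unfolding cls_def by simp
  moreover from this have "deg b = deg b'"
    by (rule partner_degree[OF a(1) a'(1)])
  ultimately have "U = W"
    unfolding a(2) a'(2) cls_def by simp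
  then show False
    using assms(3) by simp
qed

lemma realizations_agree_outside_blocks:
  assumes A: "A \<in> same_degrees ([V]\<^bsup>2\<^esup>) (edges G)"
  shows "A - \<Union>blocks = edges G \<inter> [V]\<^bsup>2\<^esup> - \<Union>blocks"
proof -
  have sub: "edges G \<subseteq> [V]\<^bsup>2\<^esup>" "A \<subseteq> [V]\<^bsup>2\<^esup>"
    using simple A unfolding simple_graph_def same_degrees_def by auto
  have fin: "finite (edges G)" "finite A"
    using sub finite_edge_set[OF finite_V] by auto
  have "edges G \<inter> [V]\<^bsup>2\<^esup> = edges G"
    using sub by blast
  then have eq: "\<forall>v. edeg (edges G) v = edeg A v"
    using A unfolding same_degrees_def by simp
  \<comment> \<open>\<open>R b\<close> collects the neighbours that \<open>b\<close> loses in
    passing from the given graph to \<open>A\<close>, and \<open>B b\<close> those that it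
    gains.\<close>
  define R where "R b = {a \<in> V. {b, a} \<in> edges G - A}" for b
  define B where "B b = {a \<in> V. {b, a} \<in> A - edges G}" for b
  have card_nbrs: "card {a \<in> V. {b, a} \<in> D} = edeg D b" if "D \<subseteq> [V]\<^bsup>2\<^esup>" for D b
    using degree_eq_edeg[of "(V, D)" b] that finite_V
    unfolding simple_graph_def degree_def adj_def by simp
  have "card (R b) = card (B b)" for b
  proof -
    have "edges G - A \<subseteq> [V]\<^bsup>2\<^esup>" "A - edges G \<subseteq> [V]\<^bsup>2\<^esup>"
      using sub by auto
    then show ?thesis
      unfolding R_def B_def
      using card_nbrs[of "edges G - A" b] card_nbrs[of "A - edges G" b] edeg_Diff_eq[OF fin eq, of b]
      by simp
  qed
  note card = this
  have sym: "a \<in> R b \<longleftrightarrow> b \<in> R a" "a \<in> B b \<longleftrightarrow> b \<in> B a" for a b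
  proof -
    have c: "{b, a} = {a, b}"
      by blast
    have "{b, a} \<in> [V]\<^bsup>2\<^esup>" if "{b, a} \<in> edges G \<union> A"
      using that sub by blast
    then have V: "a \<in> V \<and> b \<in> V" if "{b, a} \<in> edges G \<union> A"
      using that unfolding doubleton_in_nsets_2 by blast
    show "a \<in> R b \<longleftrightarrow> b \<in> R a" "a \<in> B b \<longleftrightarrow> b \<in> B a"
      using V unfolding R_def B_def mem_Collect_eq c by auto
  qed
  have rb: "E a b \<and> \<not> E c b \<and> b \<noteq> c \<and> a \<noteq> c \<and> c \<in> V" if "a \<in> R b" "c \<in> B b" for a b c
  proof -
    have "{b, c} \<in> [V]\<^bsup>2\<^esup>"
      using that(2) sub unfolding B_def by blast
    then show ?thesis
      using that unfolding R_def B_def adj_def by (auto simp: insert_commute)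
  qed
  have "int (deg a) = int (deg c)" if "a \<in> R b" "c \<in> B b" for a b c
  proof (rule balanced_relations_eq[of V R B "\<lambda>v. int (deg v)" a b c])
    show "int (deg c) \<le> int (deg a)" if "a \<in> R b" "c \<in> B b" for a b c
      using rb[OF that] degree_le[of a b c] by simp
  qed (use finite_V sym card that in \<open>auto simp: R_def B_def\<close>)
  \<comment> \<open>Equality of degrees is exactly what \<open>exchange\<close> needs to find an
    alternating 4-cycle in the given graph.\<close>
  then have alt: "\<exists>q. alt a b c q" if "a \<in> R b" "c \<in> B b" for a b c
    using rb[OF that] exchange[of a b c] that by auto
  have block: "{b, a} \<in> \<Union>blocks \<and> {b, c} \<in> \<Union>blocks" if ac: "a \<in> R b" "c \<in> B b" for a b c
  proof -
    obtain q where q: "alt a b c q"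
      using alt[OF ac] by blast
    have "a \<in> cls a" "c \<in> cls a" "b \<in> cls b"
      using alt_verts[OF q] alt_degree[OF q] unfolding cls_def by auto
    moreover have "a \<noteq> b" "c \<noteq> b"
      using rb[OF ac] by auto
    ultimately have "{a, b} \<in> cross (cls a) (cls b)" "{c, b} \<in> cross (cls a) (cls b)"
      unfolding cross_def by blast+
    moreover have "cross (cls a) (cls b) \<in> blocks"
      unfolding blocks_def using q by blast
    ultimately show ?thesis
      by (auto simp: insert_commute)
  qed
  \<comment> \<open>An end of a lost edge also gains an edge and conversely, so the argument reaches
    every pair that changes.\<close>
  have nonempty: "R b \<noteq> {} \<longleftrightarrow> B b \<noteq> {}" for b
    using card[of b] finite_V card_0_eq[of "R b"] card_0_eq[of "B b"] unfolding R_def B_def by auto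
  have "e \<in> \<Union>blocks" if eG: "e \<in> edges G - A" for e
  proof -
    have "e \<in> [V]\<^bsup>2\<^esup>"
      using eG sub by blast
    then obtain b a where e: "e = {b, a}" "a \<in> V"
      by (elim nsets2_E)
    then have "a \<in> R b"
      using eG unfolding R_def by simp
    then show ?thesis
      using nonempty block e by blast
  qed
  moreover have "e \<in> \<Union>blocks" if eA: "e \<in> A - edges G" for e
  proof -
    have "e \<in> [V]\<^bsup>2\<^esup>"
      using eA sub by blast
    then obtain b a where e: "e = {b, a}" "a \<in> V"
      by (elim nsets2_E)
    then have "a \<in> B b"
      using eA unfolding B_def by simp
    then show ?thesis
      using nonempty block e by blast
  qed
  ultimately show ?thesis
    using sub by blast
qed

theorem switch_graph_decomposition:
  "\<exists>ks. (\<forall>k\<in>set ks. k \<ge> 1) \<and>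
    (switch_graph (same_degrees ([V]\<^bsup>2\<^esup>) (edges G)) \<simeq>\<^sub>g
       cartesian_product_list (map transposition_graph ks) \<or>
     switch_graph (same_degrees ([V]\<^bsup>2\<^esup>) (edges G)) \<simeq>\<^sub>g
       cartesian_product_list (map transposition_graph ks) \<box>\<^sub>g K66_minus_6K2)"
proof -
  let ?S = "\<lambda>U. switch_graph (same_degrees U (edges G))"
  have sub: "U \<subseteq> [V]\<^bsup>2\<^esup>" if "U \<in> blocks" for U
    using that block_subset unfolding blocks_def by blast
  then have Un: "\<Union>blocks \<subseteq> [V]\<^bsup>2\<^esup>"
    by blast
  have restrict: "?S ([V]\<^bsup>2\<^esup>) \<simeq>\<^sub>g ?S (\<Union>blocks)"
    by (rule switch_graph_same_degrees_restrict[OF finite_V order_refl Un])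
      (rule realizations_agree_outside_blocks)
  show ?thesis
  proof (cases "\<exists>a b c d. alt a b c d \<and> deg a = deg b")
    case False
    have "\<exists>k\<ge>1. transposition_graph k \<simeq>\<^sub>g ?S U" if "U \<in> blocks" for U
      using that False block_transposition_graph unfolding blocks_def by blast
    then obtain ks where "\<forall>k\<in>set ks. k \<ge> 1"
      "?S (\<Union>blocks) \<simeq>\<^sub>g cartesian_product_list (map transposition_graph ks)"
      using switch_graph_Union_iso_product[OF finite_V finite_blocks sub blocks_disjoint] by blast
    then show ?thesis
      using graph_iso_trans[OF restrict] by blast
  next
    case True
    then obtain a b c d where p: "alt a b c d" "deg a = deg b" by blast
    define U0 where "U0 = cross (cls a) (cls b)"
    have U0: "U0 \<in> blocks"
      unfolding U0_def blocks_def using p by blast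
    have tr: "\<exists>k\<ge>1. transposition_graph k \<simeq>\<^sub>g ?S U" if U: "U \<in> blocks - {U0}" for U
    proof -
      obtain a' b' c' d' where p': "alt a' b' c' d'" "U = cross (cls a') (cls b')"
        using U unfolding blocks_def by blast
      \<comment> \<open>Equal degrees would place a 5-cycle in this block too. All 5-cycles lie in
        one degree class, so the block would be \<open>U0\<close>.\<close>
      have "deg a' \<noteq> deg b'"
      proof
        assume eq: "deg a' = deg b'"
        obtain t u v w where C: "C5 a t u v w"
          using C5_exists[OF p] .
        obtain t' u' v' w' where C': "C5 a' t' u' v' w'"
          using C5_exists[OF p'(1) eq] .
        have "deg a = deg a'"
          by (rule C5_degree_unique[OF C C'])
        then have "U = U0"
          unfolding p'(2) U0_def cls_def using p(2) eq by simp
        then show False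
          using U by simp
      qed
      then show ?thesis
        using block_transposition_graph[OF p'(1)] p'(2) by simp
    qed
    have "\<exists>ks. (\<forall>k\<in>set ks. k \<ge> 1) \<and>
      ?S (\<Union>(blocks - {U0})) \<simeq>\<^sub>g cartesian_product_list (map transposition_graph ks)"
      by (rule switch_graph_Union_iso_product[OF finite_V])
        (use finite_blocks sub blocks_disjoint tr in auto)
    then obtain ks where ks: "\<forall>k\<in>set ks. k \<ge> 1"
      "?S (\<Union>(blocks - {U0})) \<simeq>\<^sub>g cartesian_product_list (map transposition_graph ks)"
      by blast
    have un: "\<Union>blocks = \<Union>(blocks - {U0}) \<union> U0"
      using U0 by blast
    have "\<Union>W \<inter> \<Union>U0 = {}" if "W \<in> blocks - {U0}" for W
      using blocks_disjoint[of W U0] U0 that by blast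
    then have dis: "\<Union>(\<Union>(blocks - {U0})) \<inter> \<Union>U0 = {}"
      by blast
    have "\<Union>(blocks - {U0}) \<subseteq> [V]\<^bsup>2\<^esup>" "U0 \<subseteq> [V]\<^bsup>2\<^esup>"
      using Un sub[OF U0] by blast+
    note iso = graph_iso_sym[OF switch_graph_same_degrees_Un[OF finite_V this dis, of "edges G"]]
    have "?S ([V]\<^bsup>2\<^esup>) \<simeq>\<^sub>g ?S (\<Union>(blocks - {U0}) \<union> U0)"
      using restrict unfolding un .
    also note iso
    also have "?S (\<Union>(blocks - {U0})) \<box>\<^sub>g ?S U0 \<simeq>\<^sub>g
        cartesian_product_list (map transposition_graph ks) \<box>\<^sub>g K66_minus_6K2"
      using ks(2) graph_iso_sym[OF block_pentagon[OF p]] unfolding U0_def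
      by (rule cartesian_product_cong)
    finally show ?thesis
      using ks(1) by blast
  qed
qed

end

section \<open>Uniform graphs are the pseudo-split matrogenic graphs\<close>

lemma adj_cycle_graph_5:
  assumes "i < 5" "j < 5"
  shows "adj (cycle_graph 5) i j \<longleftrightarrow> j = Suc i mod 5 \<or> i = Suc j mod 5"
proof -
  have "adj (cycle_graph 5) i j \<longleftrightarrow> (\<exists>k<5. {i, j} = {k, Suc k mod 5})"
    unfolding adj_def cycle_graph_def by auto
  also have "\<dots> \<longleftrightarrow> j = Suc i mod 5 \<or> i = Suc j mod 5"
    unfolding doubleton_eq_iff using assms by blast
  finally show ?thesis .
qed

lemma less_5_cases: "i < 5 \<Longrightarrow> i = 0 \<or> i = 1 \<or> i = 2 \<or> i = 3 \<or> i = (4::nat)"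
  by linarith

lemma C5_opposite_adj:
  fixes i j k l :: nat
  assumes "i < 5" "j < 5" "k < 5" "l < 5" "i \<noteq> k" "j \<noteq> l"
    "j = Suc i mod 5 \<or> i = Suc j mod 5" "\<not> (k = Suc j mod 5 \<or> j = Suc k mod 5)"
    "l = Suc k mod 5 \<or> k = Suc l mod 5" "\<not> (i = Suc l mod 5 \<or> l = Suc i mod 5)" "j \<noteq> k" "l \<noteq> i"
  shows "(k = Suc i mod 5 \<or> i = Suc k mod 5) \<noteq> (l = Suc j mod 5 \<or> j = Suc l mod 5)"
proof -
  \<comment> \<open>Writing the predecessor as \<open>(x + 4) mod 5\<close> bounds the neighbours by
    explicit sets, so that the claim can be decided by evaluation.\<close>
  have nbr: "y \<in> {Suc x mod 5, (x + 4) mod 5}" if "y < 5" "y = Suc x mod 5 \<or> x = Suc y mod 5" for x y :: nat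
    using that less_5_cases[OF that(1)] by auto
  have "\<forall>i\<in>{..<5}. \<forall>j\<in>{Suc i mod 5, (i + 4) mod 5}. \<forall>k\<in>{..<5}. \<forall>l\<in>{Suc k mod 5, (k + 4) mod 5}.
    i \<noteq> k \<and> j \<noteq> l \<and> j \<noteq> k \<and> l \<noteq> i \<and>
    \<not> (k = Suc j mod 5 \<or> j = Suc k mod 5) \<and> \<not> (i = Suc l mod 5 \<or> l = Suc i mod 5) \<longrightarrow>
    (k = Suc i mod 5 \<or> i = Suc k mod 5) \<noteq> (l = Suc j mod 5 \<or> j = Suc l mod (5::nat))"
    by code_simp
  from this[rule_format, of i j k l] show ?thesis
    using assms nbr[OF assms(2,7)] nbr[OF assms(4,9)] by simp
qed

text \<open>A rotation by one step would exchange edges and non-edges. The half turn and the two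
  reflections remain, and they suffice to bring any of the four vertices to the front.\<close>

lemma alternating_4_cycle_rotations:
  assumes "alternating_4_cycle G a b c d"
  shows "alternating_4_cycle G c d a b" "alternating_4_cycle G b a d c" "alternating_4_cycle G d c b a"
  using assms adj_commute[of G] unfolding alternating_4_cycle_def by auto

lemma alternating_4_cycle_from:
  assumes "alternating_4_cycle G a b c d" "x \<in> {a, b, c, d}"
  obtains q r s where "alternating_4_cycle G x q r s" "{a, b, c, d} = {x, q, r, s}"
proof -
  note r = alternating_4_cycle_rotations[OF assms(1)]
  have "{a, b, c, d} = {c, d, a, b}" "{a, b, c, d} = {b, a, d, c}" "{a, b, c, d} = {d, c, b, a}"
    by blast+
  then show ?thesis
    using assms r that[of b c d] that[of d a b] that[of a d c] that[of c b a] by auto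
qed

lemma card_alternating_4_cycle: "alternating_4_cycle G a b c d \<Longrightarrow> card {a, b, c, d} = 4"
  unfolding alternating_4_cycle_def by simp

context uniform_graph
begin

text \<open>Degrees reveal the parts: \<open>V3\<close> is the 5-cycle if there is one, a vertex of
  the independent part sees only vertices of larger degree, and every remaining vertex has a
  neighbour of no larger degree.\<close>

lemma pseudo_split: "pseudo_split G"
proof -
  define V3 where "V3 = {v \<in> V. \<exists>t u w x. C5 v t u w x}"
  define V1 where "V1 = {v \<in> V - V3. \<forall>u. E v u \<longrightarrow> deg v < deg u}"
  define V2 where "V2 = {v \<in> V - V3. \<exists>u. E v u \<and> deg u \<le> deg v}"
  have V3_eq: "V3 = {s, t, u, v, w}" if C: "C5 s t u v w" for s t u v w
  proof
    show "V3 \<subseteq> {s, t, u, v, w}"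
    proof
      fix x assume "x \<in> V3"
      then obtain t' u' v' w' where "x \<in> V" "C5 x t' u' v' w'"
        unfolding V3_def by blast
      then have "x \<in> cls s"
        using C5_degree_unique[OF C] unfolding cls_def by auto
      then show "x \<in> {s, t, u, v, w}"
        using C5_cls[OF C] by simp
    qed
    show "{s, t, u, v, w} \<subseteq> V3"
    proof
      fix x assume x: "x \<in> {s, t, u, v, w}"
      obtain t' u' v' w' where "C5 x t' u' v' w'"
        using C5_rotate_to[OF C x] .
      then show "x \<in> V3"
        using C5_verts[OF C] x unfolding V3_def by blast
    qed
  qed
  have "V1 \<union> V2 \<union> V3 = V" "V1 \<inter> V2 = {}" "V1 \<inter> V3 = {}" "V2 \<inter> V3 = {}"
    unfolding V1_def V2_def V3_def by (auto simp: not_less)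
  moreover have "indep V1 (edges G)"
    unfolding indep_def
  proof (intro ballI impI notI)
    fix v w assume "v \<in> V1" "w \<in> V1" "{v, w} \<in> edges G"
    then have "deg v < deg w" "deg w < deg v"
      unfolding V1_def using E_commute[of v w] by (auto simp: adj_def)
    then show False by simp
  qed
  moreover have "clique V2 (edges G)"
  proof -
    \<comment> \<open>If \<open>x\<close> and \<open>y\<close> are not adjacent, a neighbour
      \<open>y'\<close> of \<open>y\<close> with \<open>deg y' \<le> deg y\<close> satisfies
      \<open>deg x \<le> deg y'\<close>, so all three degrees agree. \<open>exchange\<close> then
      yields an alternating 4-cycle with equal degrees at \<open>y'\<close> and \<open>y\<close>,
      which puts \<open>y\<close> into \<open>V3\<close>.\<close>
    have *: "E x y" if xy: "x \<in> V2" "y \<in> V2" "x \<noteq> y" "deg y \<le> deg x" for x y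
    proof (rule ccontr)
      assume n: "\<not> E x y"
      obtain y' where y': "E y y'" "deg y' \<le> deg y"
        using xy(2) unfolding V2_def by blast
      have v: "x \<in> V" "y \<in> V" "y \<notin> V3"
        using xy unfolding V2_def by auto
      have y'': "E y' y" "y' \<noteq> x"
        using y' n E_commute by blast+
      have "deg x \<le> deg y'"
        using degree_le[of y' y x] y'' n xy(3) v(1) by simp
      then have eq: "deg y' = deg x" "deg y' = deg y"
        using y' xy(4) by simp_all
      obtain q where "alt y' y x q"
        using exchange[of y' y x] y'' n xy(3) v(1) eq by auto
      then obtain t u p w where C: "C5 y' t u p w"
        using C5_exists eq(2) by blast
      have "y \<in> cls y'"
        using v eq unfolding cls_def by simp
      then have "y \<in> V3"
        using V3_eq[OF C] C5_cls[OF C] by simp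
      then show False
        using v by simp
    qed
    show ?thesis
      unfolding clique_def
    proof (intro ballI impI)
      fix v w assume vw: "v \<in> V2" "w \<in> V2" "v \<noteq> w"
      then have "E v w"
        using *[of v w] *[of w v] E_commute[of v w] by (cases "deg w \<le> deg v") auto
      then show "{v, w} \<in> edges G"
        by (simp add: adj_def)
    qed
  qed
  \<comment> \<open>If adjacent, \<open>u\<close> sees the whole 5-cycle, including a vertex
    \<open>p\<close> that \<open>v\<close> misses; this makes \<open>deg u\<close> at least
    \<open>deg v\<close>, against \<open>u \<in> V1\<close>.\<close>
  moreover have "\<not> E u v" if uv: "u \<in> V1" "v \<in> V3" for u v
  proof
    assume uv': "E u v"
    obtain t p q w where C: "C5 v t p q w"
      using uv(2) unfolding V3_def by blast
    have u: "u \<in> V" "u \<notin> {v, t, p, q, w}" "deg u < deg v"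
      using uv uv' V3_eq[OF C] unfolding V1_def by auto
    have "E u p"
      using C5_uniform[OF C u(1,2), of p] uv' by simp
    moreover have "\<not> E v p" "p \<noteq> v" "v \<in> V"
      using C uv(2) unfolding C5_def V3_def by auto
    ultimately have "deg v \<le> deg u"
      using degree_le[of u p v] u(2) by simp
    then show False
      using u(3) by simp
  qed
  moreover have "E u v" if uv: "u \<in> V2" "v \<in> V3" for u v
  proof (rule ccontr)
    assume uv': "\<not> E u v"
    obtain t p q w where C: "C5 v t p q w"
      using uv(2) unfolding V3_def by blast
    have u: "u \<in> V" "u \<notin> {v, t, p, q, w}" "v \<in> V"
      using uv V3_eq[OF C] unfolding V2_def V3_def by auto
    have t: "E v t" "\<not> E u t" "t \<noteq> u" "u \<noteq> v"
      using C C5_uniform[OF C u(1,2), of t] uv' u(2) unfolding C5_def by auto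
    \<comment> \<open>If not adjacent, \<open>u\<close> sees none of the 5-cycle, which bounds
      \<open>deg u\<close> by \<open>deg v\<close>. The neighbour \<open>u'\<close> supplied by
      \<open>V2\<close> gives the reverse bound, while the class of \<open>v\<close> is only the
      5-cycle.\<close>
    have "deg u \<le> deg v"
      using degree_le[of v t u] t u by simp
    moreover have "deg u \<noteq> deg v"
      using C5_cls[OF C] u unfolding cls_def by blast
    moreover obtain u' where u': "E u u'" "deg u' \<le> deg u"
      using uv(1) unfolding V2_def by blast
    moreover have "deg v \<le> deg u'"
      using degree_le[of u' u v] u' uv' u(3) t(4) E_commute by metis
    ultimately show False
      by simp
  qed
  moreover have "V3 = {} \<or> induced_subgraph G V3 \<simeq>\<^sub>g cycle_graph 5"
  proof (cases "V3 = {}")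
    case False
    then obtain s t u v w where C: "C5 s t u v w"
      unfolding V3_def by blast
    define f where "f i = [s, t, u, v, w] ! i" for i
    have f: "f 0 = s" "f 1 = t" "f 2 = u" "f 3 = v" "f 4 = w"
      unfolding f_def by simp_all
    have dist: "distinct [s, t, u, v, w]"
      using C unfolding C5_def by blast
    have "cycle_graph 5 \<simeq>\<^sub>g induced_subgraph G V3"
    proof (rule graph_isoI[of f])
      have "bij_betw f {..<length [s, t, u, v, w]} (set [s, t, u, v, w])"
        unfolding f_def using bij_betw_nth[OF dist] by simp
      moreover have "length [s, t, u, v, w] = 5"
        by simp
      ultimately have "bij_betw f {..<5} {s, t, u, v, w}"
        by (simp only: list.set)
      then show "bij_betw f (verts (cycle_graph 5)) (verts (induced_subgraph G V3))"
        unfolding induced_subgraph_def cycle_graph_def V3_eq[OF C] by simp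
      fix i j assume "i \<in> verts (cycle_graph 5)" "j \<in> verts (cycle_graph 5)"
      then have ij: "i < 5" "j < 5"
        unfolding cycle_graph_def by simp_all
      then have mem: "f i \<in> V3" "f j \<in> V3"
        unfolding V3_eq[OF C] using less_5_cases[OF ij(1)] less_5_cases[OF ij(2)] f by auto
      then have "adj (induced_subgraph G V3) (f i) (f j) \<longleftrightarrow> E (f i) (f j)"
        unfolding adj_def induced_subgraph_def by simp
      moreover have "j = Suc i mod 5 \<or> i = Suc j mod 5 \<longleftrightarrow> E (f i) (f j)"
        using less_5_cases[OF ij(1)] less_5_cases[OF ij(2)] C E_commute
        unfolding C5_def by (elim disjE) (simp_all add: f f[simplified])
      ultimately show "adj (cycle_graph 5) i j \<longleftrightarrow> adj (induced_subgraph G V3) (f i) (f j)"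
        using adj_cycle_graph_5[OF ij] by simp
    qed
    then show ?thesis
      using graph_iso_sym by blast
  qed simp
  ultimately show ?thesis
    unfolding pseudo_split_def by (intro exI[of _ V1] exI[of _ V2] exI[of _ V3]) simp
qed

text \<open>The vertices \<open>c\<close> and \<open>c'\<close> opposite to \<open>x\<close> have
  the same degree, hence are opposite on a further alternating 4-cycle \<open>c p c' q\<close>. This
  is the required circuit unless it passes through \<open>x\<close>, which happens only inside a
  5-cycle.\<close>

lemma circuit_elimination:
  assumes C: "alt x b c d" and D: "alt x b' c' d'" and neq: "{x, b, c, d} \<noteq> {x, b', c', d'}"
  obtains p q r s where "alt p q r s" "{p, q, r, s} \<subseteq> {x, b, c, d} \<union> {x, b', c', d'} - {x}"
proof -
  have cd: "E x b" "\<not> E b c" "b \<noteq> c" "E c d" "\<not> E d x" "d \<noteq> x" "x \<noteq> c"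
    "E x b'" "\<not> E b' c'" "b' \<noteq> c'" "E c' d'" "\<not> E d' x" "d' \<noteq> x" "x \<noteq> c'"
    using C D unfolding alt_iff by blast+
  \<comment> \<open>With equal opposite vertices, uniqueness of partners would make the two vertex
    sets equal.\<close>
  have "c \<noteq> c'"
  proof
    assume "c = c'"
    moreover from this have "b' = b"
      using alt_unique[OF C, of b'] cd by simp
    moreover have "d' = d"
      using alt_unique[OF alt_half_turn[OF C], of d'] cd \<open>c = c'\<close> by simp
    ultimately show False
      using neq by simp
  qed
  moreover have "c' \<in> V" "deg c' = deg c"
    using alt_verts[OF D] alt_degree[OF C] alt_degree[OF D] by simp_all
  ultimately obtain p q where pq: "alt c p c' q"
    using alt_same_degree[OF alt_half_turn[OF C], of c'] by auto
  \<comment> \<open>A vertex outside both circuits sees \<open>c\<close> iff it sees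
    \<open>x\<close> iff it sees \<open>c'\<close>.\<close>
  have in_union: "p \<in> {x, b, c, d} \<union> {x, b', c', d'}" if p: "E p c \<noteq> E p c'" "p \<in> V" for p
    using uniform[OF C p(2)] uniform[OF D p(2)] p(1) by blast
  have pq': "E p c \<noteq> E p c'" "E q c \<noteq> E q c'" "p \<in> V" "q \<in> V"
    using pq alt_verts[OF pq] E_commute unfolding alt_iff by auto
  show ?thesis
  proof (cases "x \<in> {p, q}")
    case False
    then have "{c, p, c', q} \<subseteq> {x, b, c, d} \<union> {x, b', c', d'} - {x}"
      using in_union[OF pq'(1,3)] in_union[OF pq'(2,4)] cd(7,14) by blast
    then show ?thesis
      using that[OF pq] by blast
  next
    case True
    \<comment> \<open>Here \<open>x\<close> is a partner of \<open>c\<close> or of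
      \<open>c'\<close>, and so has the degree of the other partners.\<close>
    have "deg x = deg b"
    proof (cases "x = p")
      case True
      then show ?thesis
        using partner_degree_same[OF pq alt_half_turn[OF C]] alt_degree[OF C] by simp
    next
      case False
      then have "alt c' x c p"
        using \<open>x \<in> {p, q}\<close> alt_half_turn[OF pq] by simp
      then have "deg x = deg d'"
        using partner_degree_same[OF _ alt_half_turn[OF D]] by blast
      then show ?thesis
        using alt_degree[OF D] partner_degree_same[OF C D] by simp
    qed
    then obtain t u v w where K: "C5 x t u v w"
      using C5_exists[OF C] by blast
    have deg: "deg b = deg x" "deg c = deg x" "deg d = deg x" "deg b' = deg x" "deg c' = deg x" "deg d' = deg x"
      using \<open>deg x = deg b\<close> alt_degree[OF C] alt_degree[OF D] partner_degree_same[OF C D] by simp_all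
    have sub: "{x, b, c, d} \<union> {x, b', c', d'} \<subseteq> {x, t, u, v, w}"
      unfolding C5_cls[OF K, symmetric] cls_def using deg alt_verts[OF C] alt_verts[OF D] by simp
    have c4: "card {x, b, c, d} = 4" "card {x, b', c', d'} = 4"
      using card_alternating_4_cycle[OF C] card_alternating_4_cycle[OF D] .
    have "\<not> {x, b', c', d'} \<subseteq> {x, b, c, d}"
      using card_subset_eq[of "{x, b, c, d}" "{x, b', c', d'}"] c4 neq by auto
    then have "{x, b, c, d} \<subset> {x, b, c, d} \<union> {x, b', c', d'}"
      by blast
    then have "card {x, b, c, d} < card ({x, b, c, d} \<union> {x, b', c', d'})"
      by (intro psubset_card_mono) simp_all
    moreover have "card {x, t, u, v, w} = 5"
      using K unfolding C5_def by simp
    ultimately have "card {x, t, u, v, w} \<le> card ({x, b, c, d} \<union> {x, b', c', d'})"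
      using c4 by linarith
    then have eq: "{x, b, c, d} \<union> {x, b', c', d'} = {x, t, u, v, w}"
      by (intro card_seteq[OF _ sub]) simp_all
    \<comment> \<open>Two different 4-subsets cover the 5-cycle, so the four vertices other than
      \<open>x\<close> are available, and they carry an alternating 4-cycle.\<close>
    have "alt t u w v" "x \<notin> {t, u, w, v}"
      using C5_alts[OF K] K unfolding C5_def by auto
    then show ?thesis
      using that[of t u w v] unfolding eq by auto
  qed
qed

lemma matrogenic: "matrogenic G"
  unfolding matrogenic_def matroid_circuits_def
proof (intro conjI ballI impI)
  let ?C = "{{a, b, c, d} | a b c d. alt a b c d}"
  show "finite V" by (rule finite_V)
  show "?C \<subseteq> Pow V"
    unfolding alternating_4_cycle_def by auto
  show "{} \<notin> ?C"
    by auto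
  fix C D assume CD: "C \<in> ?C" "D \<in> ?C"
  obtain a b c d where C: "alt a b c d" "C = {a, b, c, d}"
    using CD(1) by blast
  obtain a' b' c' d' where D: "alt a' b' c' d'" "D = {a', b', c', d'}"
    using CD(2) by blast
  show "C = D" if "C \<subseteq> D"
    using card_subset_eq[OF _ that] card_alternating_4_cycle[OF C(1)] card_alternating_4_cycle[OF D(1)]
    unfolding C(2) D(2) by simp
  fix x assume x: "x \<in> C \<inter> D" and neq: "C \<noteq> D"
  have xC: "x \<in> {a, b, c, d}" "x \<in> {a', b', c', d'}"
    using x C D by auto
  obtain q r s where 1: "alt x q r s" "C = {x, q, r, s}"
    using alternating_4_cycle_from[OF C(1) xC(1)] C(2) by metis
  obtain q' r' s' where 2: "alt x q' r' s'" "D = {x, q', r', s'}"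
    using alternating_4_cycle_from[OF D(1) xC(2)] D(2) by metis
  have "{x, q, r, s} \<noteq> {x, q', r', s'}"
    using neq 1(2) 2(2) by simp
  then obtain i j k l where "alt i j k l" "{i, j, k, l} \<subseteq> C \<union> D - {x}"
    unfolding 1(2) 2(2) by (rule circuit_elimination[OF 1(1) 2(1)])
  then show "\<exists>F\<in>?C. F \<subseteq> C \<union> D - {x}"
    by blast
qed

end

section \<open>From pseudo-split and matrogenic to uniform\<close>

text \<open>The part containing \<open>a\<close> forces the others: the cycle alternates between
  \<open>V1\<close> and \<open>V2\<close>, so that the diagonal inside \<open>V2\<close> is the only
  one present, or it lies in \<open>V3\<close>, where the 5-cycle is checked directly.\<close>

lemma pseudo_split_opposite_adj:
  assumes "pseudo_split G" "alternating_4_cycle G a b c d"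
  shows "adj G a c \<noteq> adj G b d"
proof -
  obtain V1 V2 V3 where V: "V1 \<union> V2 \<union> V3 = verts G"
    and i: "indep V1 (edges G)" and k: "clique V2 (edges G)"
    and n: "\<forall>u\<in>V1. \<forall>v\<in>V3. \<not> adj G u v" and m: "\<forall>u\<in>V2. \<forall>v\<in>V3. adj G u v"
    and c: "V3 = {} \<or> induced_subgraph G V3 \<simeq>\<^sub>g cycle_graph 5"
    using assms(1) unfolding pseudo_split_def by blast
  have f: "adj G a b" "\<not> adj G b c" "adj G c d" "\<not> adj G d a" "distinct [a, b, c, d]"
    "a \<in> verts G" "b \<in> verts G" "c \<in> verts G" "d \<in> verts G"
    using assms(2) unfolding alternating_4_cycle_def by auto
  have i': "\<not> adj G u v" if "u \<in> V1" "v \<in> V1" "u \<noteq> v" for u v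
    using i that unfolding indep_def adj_def by blast
  have k': "adj G u v" if "u \<in> V2" "v \<in> V2" "u \<noteq> v" for u v
    using k that unfolding clique_def adj_def by blast
  have n': "\<not> adj G u v" "\<not> adj G v u" if "u \<in> V1" "v \<in> V3" for u v
    using n that adj_commute[of G u v] by blast+
  have m': "adj G u v" "adj G v u" if "u \<in> V2" "v \<in> V3" for u v
    using m that adj_commute[of G u v] by blast+
  have neq: "a \<noteq> b" "a \<noteq> c" "a \<noteq> d" "b \<noteq> c" "b \<noteq> d" "c \<noteq> d"
    using f(5) by auto
  have mem: "a \<in> V1 \<or> a \<in> V2 \<or> a \<in> V3" "b \<in> V1 \<or> b \<in> V2 \<or> b \<in> V3"
    "c \<in> V1 \<or> c \<in> V2 \<or> c \<in> V3" "d \<in> V1 \<or> d \<in> V2 \<or> d \<in> V3"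
    using f(6-9) V by blast+
  have 1: "b \<in> V2" "c \<in> V1" "d \<in> V2" if a: "a \<in> V1"
  proof -
    show b: "b \<in> V2"
      using mem(2) i'[OF a, of b] n'[OF a, of b] f(1) neq by blast
    show c: "c \<in> V1"
      using mem(3) k'[OF b, of c] m'[OF b, of c] f(2) neq by blast
    show "d \<in> V2"
      using mem(4) i'[OF c, of d] n'[OF c, of d] f(3) neq by blast
  qed
  have 2: "d \<in> V1" "c \<in> V2" "b \<in> V1" if a: "a \<in> V2"
  proof -
    show d: "d \<in> V1"
      using mem(4) k'[of d a] a m'[OF a, of d] f(4) neq by blast
    show c: "c \<in> V2"
      using mem(3) i'[of c d] d n'[OF d, of c] f(3) neq by blast
    show "b \<in> V1"
      using mem(2) k'[of b c] c m'[OF c, of b] f(2) neq by blast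
  qed
  have 3: "b \<in> V3" "c \<in> V3" "d \<in> V3" if a: "a \<in> V3"
  proof -
    have d: "d \<notin> V2"
      using m'[of d a] a f(4) by blast
    have b: "b \<notin> V1"
      using n'[of b a] a f(1) by blast
    have c: "c \<notin> V1"
      using n'[of c d] i'[of c d] mem(4) d f(3) neq by blast
    have c': "c \<notin> V2"
      using m'[of c b] k'[of b c] mem(2) b f(2) neq by blast
    show "c \<in> V3"
      using mem(3) c c' by blast
    then show "b \<in> V3" "d \<in> V3"
      using mem(2,4) b d n'[of d c] m'[of b c] f(2,3) by blast+
  qed
  from mem(1) show ?thesis
  proof (elim disjE)
    assume a: "a \<in> V1"
    show ?thesis
      using i'[OF a 1(2)[OF a]] k'[OF 1(1,3)[OF a]] neq by blast
  next
    assume a: "a \<in> V2"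
    show ?thesis
      using k'[OF a 2(2)[OF a]] i'[OF 2(3,1)[OF a]] neq by blast
  next
    assume a: "a \<in> V3"
    note bcd = 3[OF a]
    have "induced_subgraph G V3 \<simeq>\<^sub>g cycle_graph 5"
      using c a by blast
    then obtain g where g: "bij_betw g V3 {..<5}"
      "\<forall>u\<in>V3. \<forall>v\<in>V3. adj (induced_subgraph G V3) u v \<longleftrightarrow> adj (cycle_graph 5) (g u) (g v)"
      unfolding graph_iso_def by (auto simp: induced_subgraph_def cycle_graph_def)
    have g5: "g u < 5" if "u \<in> V3" for u
      using g(1) that bij_betwE by blast
    have adj: "adj G u v \<longleftrightarrow> g v = Suc (g u) mod 5 \<or> g u = Suc (g v) mod 5" if "u \<in> V3" "v \<in> V3" for u v
    proof -
      have "adj G u v \<longleftrightarrow> adj (induced_subgraph G V3) u v"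
        using that unfolding adj_def induced_subgraph_def by simp
      then show ?thesis
        using g(2) that adj_cycle_graph_5[OF g5[OF that(1)] g5[OF that(2)]] by blast
    qed
    have gn: "g a \<noteq> g c" "g b \<noteq> g d"
      using g(1) a bcd neq by (auto simp: bij_betw_def inj_on_eq_iff)
    have gn': "g b \<noteq> g c" "g d \<noteq> g a"
      using g(1) a bcd neq by (auto simp: bij_betw_def inj_on_eq_iff)
    show ?thesis
      using C5_opposite_adj[OF g5[OF a] g5[OF bcd(1)] g5[OF bcd(2)] g5[OF bcd(3)] gn] gn' f(1-4) adj a bcd by blast
  qed
qed

text \<open>If \<open>v\<close> saw \<open>a\<close> but not \<open>c\<close>, then
  \<open>v a d c\<close> would be a second circuit. Eliminating \<open>d\<close> leaves only
  \<open>{a, b, c, v}\<close> as a circuit; there \<open>c\<close> has no possible neighbour but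
  \<open>a\<close>, and \<open>a\<close> sees both \<open>b\<close> and \<open>v\<close>, so no
  alternating 4-cycle fits.\<close>

lemma matrogenic_uniform:
  assumes "matrogenic G" "alternating_4_cycle G a b c d" "v \<in> verts G" "v \<notin> {a, b, c, d}"
    and va: "adj G v a"
  shows "adj G v c"
proof (rule ccontr)
  assume vc: "\<not> adj G v c"
  let ?C = "{{a, b, c, d} | a b c d. alternating_4_cycle G a b c d}"
  have f: "adj G a b" "\<not> adj G b c" "adj G c d" "\<not> adj G d a" "distinct [a, b, c, d]"
    "{a, b, c, d} \<subseteq> verts G"
    using assms(2) unfolding alternating_4_cycle_def by auto
  have "alternating_4_cycle G v a d c"
    using f va vc assms(3,4) adj_commute[of G] unfolding alternating_4_cycle_def by auto
  then have D: "{v, a, d, c} \<in> ?C" and C: "{a, b, c, d} \<in> ?C"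
    using assms(2) by blast+
  have neq: "{a, b, c, d} \<noteq> {v, a, d, c}"
    using assms(4) by blast
  have "\<forall>C\<in>?C. \<forall>D\<in>?C. \<forall>x\<in>C \<inter> D. C \<noteq> D \<longrightarrow> (\<exists>F\<in>?C. F \<subseteq> C \<union> D - {x})"
    using assms(1) unfolding matrogenic_def matroid_circuits_def by (elim conjE)
  moreover have "d \<in> {a, b, c, d} \<inter> {v, a, d, c}"
    by simp
  ultimately have "\<exists>F\<in>?C. F \<subseteq> {a, b, c, d} \<union> {v, a, d, c} - {d}"
    using C D neq by meson
  then obtain F where F: "F \<in> ?C" "F \<subseteq> {a, b, c, d} \<union> {v, a, d, c} - {d}"
    by (rule bexE)
  have "F \<subseteq> {a, b, c, v}"
    using F(2) by blast
  then obtain p q r s where pqrs: "alternating_4_cycle G p q r s" "{p, q, r, s} \<subseteq> {a, b, c, v}"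
    using F(1) by blast
  have "card {a, b, c, v} \<le> 4"
    by (simp add: card_insert_if)
  then have eq: "{p, q, r, s} = {a, b, c, v}"
    using card_alternating_4_cycle[OF pqrs(1)] pqrs(2) by (intro card_seteq) simp_all
  then have "c \<in> {p, q, r, s}" by blast
  then obtain i j k where i: "alternating_4_cycle G c i j k" "{p, q, r, s} = {c, i, j, k}"
    using alternating_4_cycle_from[OF pqrs(1)] by blast
  have ijk: "adj G c i" "\<not> adj G i j" "i \<noteq> c" "j \<noteq> c" "i \<noteq> j" "i \<in> {a, b, v}" "j \<in> {a, b, v}"
    using i eq unfolding alternating_4_cycle_def by auto
  have "i = a"
    using ijk(1,6) f(2) vc adj_commute[of G] by blast
  then show False
    using ijk f(1) va adj_commute[of G] by blast
qed

lemma uniform_graphI: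
  assumes "simple_graph G" "pseudo_split G" "matrogenic G"
  shows "uniform_graph G"
proof
  show "simple_graph G" by fact
  fix a b c d assume alt: "alternating_4_cycle G a b c d"
  show "adj G a c \<noteq> adj G b d"
    by (rule pseudo_split_opposite_adj[OF assms(2) alt])
  fix v assume v: "v \<in> verts G" "v \<notin> {a, b, c, d}"
  then have v': "v \<notin> {c, d, a, b}"
    by blast
  show "adj G v a \<longleftrightarrow> adj G v c"
    using matrogenic_uniform[OF assms(3) alt v]
      matrogenic_uniform[OF assms(3) alternating_4_cycle_rotations(1)[OF alt] v(1) v'] by blast
qed

section \<open>Triangle-free realization graphs\<close>

definition switched :: "'a graph \<Rightarrow> 'a \<Rightarrow> 'a \<Rightarrow> 'a \<Rightarrow> 'a \<Rightarrow> 'a graph" where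
  "switched G a b c d = (verts G, edges G - {{a, b}, {c, d}} \<union> {{a, d}, {b, c}})"

lemma two_switch_switched:
  assumes "alternating_4_cycle G a b c d"
  shows "two_switch G (switched G a b c d)"
proof -
  have "\<not> adj G a d"
    using assms adj_commute[of G a d] unfolding alternating_4_cycle_def by simp
  then show ?thesis
    using assms unfolding two_switch_def switched_def alternating_4_cycle_def by blast
qed

text \<open>Two switches of one graph whose results differ in two edges would complete a
  triangle.\<close>

lemma two_switches_adj:
  assumes "realization d G" "triangle_free (realization_graph d)" "two_switch G H" "two_switch G K"
  shows "card (edges H - edges K) \<noteq> 2"
proof
  assume 2: "card (edges H - edges K) = 2"
  have HK: "realization d H" "realization d K"
    using realization_two_switch assms by blast+
  have "adj (realization_graph d) G H" "adj (realization_graph d) G K"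
    using assms(1,3,4) HK unfolding adj_def realization_graph_def snd_conv by blast+
  moreover have "adj (realization_graph d) H K"
    using HK 2 adj_realization_graph by blast
  ultimately show False
    using assms(1,2) HK unfolding triangle_free_def verts_realization_graph by blast
qed

lemma triangle_free_uniform:
  assumes "realization d G" "triangle_free (realization_graph d)"
  shows "uniform_graph G"
proof
  show s: "simple_graph G"
    using assms(1) unfolding realization_def by simp
  note no = two_switches_adj[OF assms two_switch_switched two_switch_switched]
  fix a b c e assume alt: "alternating_4_cycle G a b c e"
  have f: "adj G a b" "\<not> adj G b c" "adj G c e" "\<not> adj G e a" "distinct [a, b, c, e]"
    "{a, b, c, e} \<subseteq> verts G"
    using alt unfolding alternating_4_cycle_def by auto
  show "adj G a c \<noteq> adj G b e"
  proof
    assume eq: "adj G a c = adj G b e"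
    show False
    \<comment> \<open>Four vertices have three perfect matchings. With both diagonals present, two
      of them are in the graph and either can be traded for the third; with none present, the one in
      the graph can be traded for either of the other two.\<close>
    proof (cases "adj G a c")
      case True
      have alt': "alternating_4_cycle G a c b e"
        using f True eq adj_commute[of G] unfolding alternating_4_cycle_def by auto
      have "edges (switched G a b c e) - edges (switched G a c b e) = {{a, c}, {b, e}}"
        using f True eq unfolding switched_def adj_def by (auto simp: doubleton_eq_iff insert_commute)
      moreover have "card {{a, c}, {b, e}} = 2"
        using f(5) by (auto simp: doubleton_eq_iff)
      ultimately show False
        using no[OF alt alt'] by simp
    next
      case False
      have alt': "alternating_4_cycle G a b e c"
        using f False eq adj_commute[of G] unfolding alternating_4_cycle_def by auto
      have "edges (switched G a b c e) - edges (switched G a b e c) = {{a, e}, {b, c}}"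
        using f False eq unfolding switched_def adj_def by (auto simp: doubleton_eq_iff insert_commute)
      moreover have "card {{a, e}, {b, c}} = 2"
        using f(5) by (auto simp: doubleton_eq_iff)
      ultimately show False
        using no[OF alt alt'] by simp
    qed
  qed
  \<comment> \<open>If \<open>v\<close> sees \<open>a\<close> but not \<open>c\<close>, it can
    replace \<open>b\<close> in the cycle; the two switches then differ only in whether
    \<open>b\<close> or \<open>v\<close> passes from \<open>a\<close> to \<open>c\<close>.\<close>
  have *: "adj G v c" if alt: "alternating_4_cycle G a b c e"
    and v: "v \<in> verts G" "v \<notin> {a, b, c, e}" "adj G v a" for a b c e v
  proof (rule ccontr)
    assume vc: "\<not> adj G v c"
    have f: "adj G a b" "\<not> adj G b c" "adj G c e" "\<not> adj G e a" "distinct [a, b, c, e]"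
      "{a, b, c, e} \<subseteq> verts G"
      using alt unfolding alternating_4_cycle_def by auto
    have alt': "alternating_4_cycle G a v c e"
      using f v vc adj_commute[of G] unfolding alternating_4_cycle_def by auto
    have "edges (switched G a b c e) - edges (switched G a v c e) = {{v, a}, {b, c}}"
      using f v vc unfolding switched_def adj_def by (auto simp: doubleton_eq_iff insert_commute)
    moreover have "card {{v, a}, {b, c}} = 2"
      using f(5) v(2) by (auto simp: doubleton_eq_iff)
    ultimately show False
      using no[OF alt alt'] by simp
  qed
  fix v assume v: "v \<in> verts G" "v \<notin> {a, b, c, e}"
  then have v': "v \<notin> {c, e, a, b}"
    by blast
  show "adj G v a \<longleftrightarrow> adj G v c"
    using *[OF alt v] *[OF alternating_4_cycle_rotations(1)[OF alt] v(1) v'] by blast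
qed

lemma bipartite_imp_triangle_free:
  assumes "bipartite (realization_graph d)"
  shows "triangle_free (realization_graph d)"
proof -
  obtain c :: "nat graph \<Rightarrow> bool" where c: "\<forall>u\<in>verts (realization_graph d). \<forall>v\<in>verts (realization_graph d).
      u \<noteq> v \<longrightarrow> adj (realization_graph d) u v \<longrightarrow> c u \<noteq> c v"
    using assms unfolding bipartite_iff_colouring by (elim exE)
  have "u \<noteq> v" if "adj (realization_graph d) u v" for u v
    using that unfolding adj_realization_graph by auto
  then have "c u \<noteq> c v" if "adj (realization_graph d) u v" "u \<in> verts (realization_graph d)"
    "v \<in> verts (realization_graph d)" for u v
    using that c by blast
  then show ?thesis
    unfolding triangle_free_def by metis
qed

theorem theorem4p3:
  fixes d :: "nat list"
  assumes "\<exists>G. realization d G"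
  shows "(bipartite (realization_graph d) \<longleftrightarrow> triangle_free (realization_graph d)) \<and>
    (triangle_free (realization_graph d) \<longleftrightarrow>
      (\<exists>ks. (\<forall>k\<in>set ks. k \<ge> 1) \<and>
        (realization_graph d \<simeq>\<^sub>g cartesian_product_list (map transposition_graph ks) \<or>
         realization_graph d \<simeq>\<^sub>g
           cartesian_product_list (map transposition_graph ks) \<box>\<^sub>g K66_minus_6K2))) \<and>
    ((\<exists>ks. (\<forall>k\<in>set ks. k \<ge> 1) \<and>
        (realization_graph d \<simeq>\<^sub>g cartesian_product_list (map transposition_graph ks) \<or>
         realization_graph d \<simeq>\<^sub>g
           cartesian_product_list (map transposition_graph ks) \<box>\<^sub>g K66_minus_6K2)) \<longleftrightarrow>
      (\<exists>G. realization d G \<and> pseudo_split G \<and> matrogenic G))"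
  (is "(?a \<longleftrightarrow> ?b) \<and> (?b \<longleftrightarrow> ?c) \<and> (?c \<longleftrightarrow> ?d)")
proof -
  obtain G where G: "realization d G"
    using assms by blast
  have ab: "?a \<Longrightarrow> ?b"
    by (rule bipartite_imp_triangle_free)
  \<comment> \<open>Triangle-freeness makes every realization uniform, so any one of them serves as
    witness.\<close>
  have bd: "?b \<Longrightarrow> ?d"
    using triangle_free_uniform[OF G] G uniform_graph.pseudo_split uniform_graph.matrogenic by blast
  have dc: "?d \<Longrightarrow> ?c"
  proof -
    assume ?d
    then obtain H where H: "realization d H" "pseudo_split H" "matrogenic H"
      by blast
    then interpret uniform_graph H
      using uniform_graphI unfolding realization_def by blast
    note iso = realization_graph_iso_switch_graph[OF H(1)]
    obtain ks where ks: "\<forall>k\<in>set ks. k \<ge> 1"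
      "switch_graph (same_degrees ([verts H]\<^bsup>2\<^esup>) (edges H)) \<simeq>\<^sub>g
         cartesian_product_list (map transposition_graph ks) \<or>
       switch_graph (same_degrees ([verts H]\<^bsup>2\<^esup>) (edges H)) \<simeq>\<^sub>g
         cartesian_product_list (map transposition_graph ks) \<box>\<^sub>g K66_minus_6K2"
      using switch_graph_decomposition by (elim exE conjE)
    from ks(2) show ?c
    proof
      assume "switch_graph (same_degrees ([verts H]\<^bsup>2\<^esup>) (edges H)) \<simeq>\<^sub>g
        cartesian_product_list (map transposition_graph ks)"
      from graph_iso_trans[OF iso this] show ?thesis
        using ks(1) by blast
    next
      assume "switch_graph (same_degrees ([verts H]\<^bsup>2\<^esup>) (edges H)) \<simeq>\<^sub>g
        cartesian_product_list (map transposition_graph ks) \<box>\<^sub>g K66_minus_6K2"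
      from graph_iso_trans[OF iso this] show ?thesis
        using ks(1) by blast
    qed
  qed
  have ca: "?c \<Longrightarrow> ?a"
  proof -
    assume ?c
    then obtain ks where
      "realization_graph d \<simeq>\<^sub>g cartesian_product_list (map transposition_graph ks) \<or>
       realization_graph d \<simeq>\<^sub>g cartesian_product_list (map transposition_graph ks) \<box>\<^sub>g K66_minus_6K2"
      by (elim exE conjE)
    moreover have T: "bipartite (cartesian_product_list (map transposition_graph ks))"
      by (rule bipartite_cartesian_product_list) (auto simp: bipartite_transposition_graph)
    ultimately show ?a
      using bipartite_iso[OF _ T] bipartite_iso[OF _ bipartite_cartesian_product[OF T bipartite_K66_minus_6K2]]
      by (elim disjE)
  qed
  show ?thesis
    using ab bd dc ca by argo
qed

end
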